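(* Let $n\ge2$, let $\{P_j(D)\}_{j=1}^N$ be an elliptic system of order $l$ of differential operators with constant coefficients on $\mathbb R^n$, and let $R_{uv}(D):=(D_u+i)(D_v+i)$, where $D_k=-i\,\partial/\partial x_k$. Then the system of operators $$S_{juv}(D):=P_j(D)R_{uv}(D),\qquad j\in\{1,\dots,N\},\quad u,v\in\{1,\dots,n\},\quad u>v,$$ is weakly coercive in $\overset{\circ}{W}{}^{l+2}_p(\mathbb R^n)$ for every $p\in[1,\infty]$, but is not elliptic.
   Context: A system $\{T_j(D)\}$ of order $m$, $T_j(D)=\sum_{|\alpha|\le m}a_{j\alpha}D^\alpha$ with constant complex coefficients, is elliptic if the principal symbols $T_j^m(\xi)=\sum_{|\alpha|=m}a_{j\alpha}\xi^\alpha$ have no common zero $\xi\in\mathbb R^n\setminus\{0\}$. It is weakly coercive in the isotropic space $\overset{\circ}{W}{}^m_p(\mathbb R^n)$ if there are constants $C_1,C_2$ such that $\sum_{|\alpha|<m}\|D^\alpha f\|_{L^p(\mathbb R^n)}\le C_1\sum_j\|T_j(D)f\|_{L^p(\mathbb R^n)}+C_2\|f\|_{L^p(\mathbb R^n)}$ for all $f\in C_0^\infty(\mathbb R^n)$. The order $l$ is a positive integer; the system $\{S_{juv}\}$ is regarded as a system of order $l+2$. *)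

theory Defs
  imports
    "HOL-Analysis.Analysis"
    "HOL-Library.Poly_Mapping"
    "HOL-Probability.Essential_Supremum"
begin

section \<open>Multi-indices and test functions\<close>

definition mdeg :: "('n::finite \<Rightarrow>\<^sub>0 nat) \<Rightarrow> nat" where
  "mdeg \<alpha> = (\<Sum>k\<in>UNIV. Poly_Mapping.lookup \<alpha> k)"

text \<open>The sums over \<open>|\<alpha>| < m\<close> and \<open>|\<alpha>| = m\<close> below are genuine finite sums.\<close>

lemma finite_mdeg_le: "finite {\<alpha> :: 'n::finite \<Rightarrow>\<^sub>0 nat. mdeg \<alpha> \<le> m}"
proof -
  have "Poly_Mapping.lookup ` {\<alpha> :: 'n \<Rightarrow>\<^sub>0 nat. mdeg \<alpha> \<le> m} \<subseteq> PiE UNIV (\<lambda>_. {..m})"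
  proof -
    have "Poly_Mapping.lookup \<alpha> k \<le> mdeg \<alpha>" for \<alpha> :: "'n \<Rightarrow>\<^sub>0 nat" and k
      unfolding mdeg_def by (rule member_le_sum) auto
    then show ?thesis
      by (auto simp: PiE_UNIV_domain intro: order_trans)
  qed
  moreover have "finite (PiE (UNIV :: 'n set) (\<lambda>_. {..m}))"
    by (intro finite_PiE) auto
  ultimately have "finite (Poly_Mapping.lookup ` {\<alpha> :: 'n \<Rightarrow>\<^sub>0 nat. mdeg \<alpha> \<le> m})"
    by (rule finite_subset)
  then show ?thesis
    by (rule finite_imageD) (auto intro: inj_onI poly_mapping_eqI)
qed

lemma finite_mdeg_less: "finite {\<alpha> :: 'n::finite \<Rightarrow>\<^sub>0 nat. mdeg \<alpha> < m}"
  by (rule finite_subset[OF _ finite_mdeg_le[of m]]) auto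

lemma finite_mdeg_eq: "finite {\<alpha> :: 'n::finite \<Rightarrow>\<^sub>0 nat. mdeg \<alpha> = m}"
  by (rule finite_subset[OF _ finite_mdeg_le[of m]]) auto

definition partial_deriv :: "'n::finite \<Rightarrow> (real^'n \<Rightarrow> complex) \<Rightarrow> real^'n \<Rightarrow> complex" where
  "partial_deriv k f x = frechet_derivative f (at x) (axis k 1)"

fun C_class :: "nat \<Rightarrow> (real^'n::finite \<Rightarrow> complex) \<Rightarrow> bool" where
  "C_class 0 f \<longleftrightarrow> continuous_on UNIV f"
| "C_class (Suc r) f \<longleftrightarrow> (\<forall>x. f differentiable (at x)) \<and> (\<forall>k. C_class r (partial_deriv k f))"

text \<open>The space \<open>C\<^sub>0\<^sup>\<infinity>\<close> of complex-valued test functions.\<close>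

definition test_functions :: "(real^'n::finite \<Rightarrow> complex) set" where
  "test_functions = {f. (\<forall>r. C_class r f) \<and> compact (closure {x. f x \<noteq> 0})}"

definition D_op :: "'n::finite \<Rightarrow> (real^'n \<Rightarrow> complex) \<Rightarrow> real^'n \<Rightarrow> complex" where
  "D_op k f = (\<lambda>x. - \<i> * partial_deriv k f x)"

text \<open>\<open>D\<^sup>\<alpha> f\<close>, with the coordinates taken in increasing order; the order is irrelevant on
  test functions, where partial derivatives commute.\<close>

definition D_multi ::
  "('n::{finite,linorder} \<Rightarrow>\<^sub>0 nat) \<Rightarrow> (real^'n::{finite,linorder} \<Rightarrow> complex) \<Rightarrow> real^'n::{finite,linorder} \<Rightarrow> complex" where
  "D_multi \<alpha> f =
     foldr (\<lambda>k g. (D_op k ^^ Poly_Mapping.lookup \<alpha> k) g) (sorted_list_of_set UNIV) f"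

text \<open>The \<open>L\<^sup>p\<close> norm for \<open>1 \<le> p \<le> \<infinity>\<close>, as a real number. It is only applied to continuous
  compactly supported functions; on functions of infinite norm its value is meaningless.\<close>

definition Lp_norm :: "ennreal \<Rightarrow> (real^'n::finite \<Rightarrow> complex) \<Rightarrow> real" where
  "Lp_norm p f =
     (if p = \<infinity> then enn2real (esssup lborel (\<lambda>x. ennreal (norm (f x))))
      else (LINT x|lborel. norm (f x) powr enn2real p) powr (1 / enn2real p))"

section \<open>Constant-coefficient differential operators\<close>

text \<open>A constant-coefficient operator is a polynomial in the commuting symbols \<open>D\<^sub>k\<close>, the
  coefficient of \<open>D\<^sup>\<alpha>\<close> being the value at \<open>\<alpha>\<close>. The ring product on this type is the
  polynomial product, that is, the composition of operators.\<close>

type_synonym 'n diffop = "('n \<Rightarrow>\<^sub>0 nat) \<Rightarrow>\<^sub>0 complex"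

definition apply_op ::
  "'n::{finite,linorder} diffop \<Rightarrow> (real^'n::{finite,linorder} \<Rightarrow> complex) \<Rightarrow> real^'n::{finite,linorder} \<Rightarrow> complex" where
  "apply_op T f = (\<lambda>x. \<Sum>\<alpha>\<in>Poly_Mapping.keys T. Poly_Mapping.lookup T \<alpha> * D_multi \<alpha> f x)"

definition D_sym :: "'n \<Rightarrow> 'n diffop" where
  "D_sym k = Poly_Mapping.single (Poly_Mapping.single k 1) 1"

definition const_op :: "complex \<Rightarrow> 'n diffop" where
  "const_op c = Poly_Mapping.single 0 c"

definition R_op :: "'n \<Rightarrow> 'n \<Rightarrow> 'n diffop" where
  "R_op u v = (D_sym u + const_op \<i>) * (D_sym v + const_op \<i>)"

definition principal_symbol :: "nat \<Rightarrow> 'n::finite diffop \<Rightarrow> real^'n \<Rightarrow> complex" where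
  "principal_symbol m T \<xi> =
     (\<Sum>\<alpha> | mdeg \<alpha> = m. Poly_Mapping.lookup T \<alpha> *
        (\<Prod>k\<in>UNIV. complex_of_real (\<xi> $ k) ^ Poly_Mapping.lookup \<alpha> k))"

section \<open>Systems of operators\<close>

text \<open>A system is a family \<open>T\<close> over an index set \<open>J\<close>. Its order \<open>m\<close> is an upper bound for the
  orders of its members and part of the data, so some (or all) of them may have lower order.\<close>

definition system_of_order :: "nat \<Rightarrow> 'j set \<Rightarrow> ('j \<Rightarrow> 'n::finite diffop) \<Rightarrow> bool" where
  "system_of_order m J T \<longleftrightarrow> finite J \<and> (\<forall>j\<in>J. \<forall>\<alpha>\<in>Poly_Mapping.keys (T j). mdeg \<alpha> \<le> m)"

definition elliptic :: "nat \<Rightarrow> 'j set \<Rightarrow> ('j \<Rightarrow> 'n::finite diffop) \<Rightarrow> bool" where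
  "elliptic m J T \<longleftrightarrow> \<not> (\<exists>\<xi>. \<xi> \<noteq> 0 \<and> (\<forall>j\<in>J. principal_symbol m (T j) \<xi> = 0))"

definition weakly_coercive ::
  "ennreal \<Rightarrow> nat \<Rightarrow> 'j set \<Rightarrow> ('j \<Rightarrow> 'n::{finite,linorder} diffop) \<Rightarrow> bool" where
  "weakly_coercive p m J T \<longleftrightarrow>
     (\<exists>C1 C2 :: real. \<forall>f\<in>test_functions.
        (\<Sum>\<alpha> | mdeg \<alpha> < m. Lp_norm p (D_multi \<alpha> f))
          \<le> C1 * (\<Sum>j\<in>J. Lp_norm p (apply_op (T j) f)) + C2 * Lp_norm p f)"

end

theory Submission
  imports Defs "HOL-Probability.Characteristic_Functions" "HOL-Probability.Sinc_Integral"
begin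

text \<open>Write \<open>N\<close> for the \<open>L\<^sup>p\<close> norm, \<open>Q\<^sub>j\<close> for the principal symbol of \<open>P\<^sub>j\<close>, and let
  \<open>L = \<Sum>\<^sub>j |Q\<^sub>j|\<^sup>2\<close>, \<open>K\<^sub>q(x) = \<integral> e\<^sup>i\<^sup>x\<^sup>\<xi> q(\<xi>) e\<^sup>-\<^sup>L\<^sup>(\<^sup>\<xi>\<^sup>) d\<xi>\<close> for polynomials \<open>q\<close>. Since
  multiplication by \<open>x\<^sub>k\<close> and application of \<open>D\<^sub>k\<close> both map kernels \<open>K\<^sub>q\<close> to kernels of the same
  form, all of them are integrable. Differentiating \<open>r \<mapsto> \<integral> K\<^sub>1(z) h(x - rz) dz\<close>, with Euler's
  identity for \<open>L\<close>, gives for \<open>h = D\<^sup>\<beta> f\<close>, \<open>|\<beta>| < l\<close>,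
  \<open>c D\<^sup>\<beta> f(x) = \<integral> K\<^sub>1(z) D\<^sup>\<beta> f(x - tz) dz + 2l \<integral>\<^sub>0\<^sup>t r\<^sup>l\<^sup>-\<^sup>1\<^sup>-\<^sup>|\<^sup>\<beta>\<^sup>| \<Sum>\<^sub>j \<integral> K\<^sub>q(z) (Q\<^sub>j(D) f)(x - rz) dz dr\<close>
  with \<open>q = \<xi>\<^sup>\<beta> cnj Q\<^sub>j\<close> and \<open>c = \<integral> K\<^sub>1 \<noteq> 0\<close>. Moving the derivatives of the first term onto the kernel
  and absorbing the lower order terms of \<open>P\<^sub>j\<close> for small \<open>t\<close>, one obtains, for every \<open>\<gamma>\<close> and
  every \<open>|\<beta>| < l\<close>, that \<open>N(D\<^sup>\<beta>\<^sup>+\<^sup>\<gamma> f)\<close> is bounded by \<open>N(f) + \<Sum>\<^sub>j N(P\<^sub>j D\<^sup>\<gamma> f)\<close>.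

  On the other hand \<open>N(f) \<le> 2 N((D\<^sub>u + i) f)\<close>, so the system controls \<open>P\<^sub>j f\<close>, \<open>P\<^sub>j D\<^sub>u f\<close> and
  \<open>P\<^sub>j D\<^sub>u D\<^sub>v f\<close> for \<open>u \<noteq> v\<close>. Taking for \<open>D\<^sup>\<gamma>\<close> the operators \<open>D\<^sub>u\<close> and \<open>D\<^sub>u D\<^sub>v\<close> controls all
  derivatives of order at most \<open>l\<close> and the mixed ones of order \<open>l + 1\<close>; the pure ones \<open>D\<^sub>u\<^sup>l\<^sup>+\<^sup>1 f\<close>
  are read off from \<open>P\<^sub>j D\<^sub>u f\<close> by ellipticity on the axis \<open>u\<close>. On the axes all products
  \<open>\<xi>\<^sub>u \<xi>\<^sub>v\<close> vanish, so the system is not elliptic.\<close>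

section \<open>Test functions and commuting derivatives\<close>

lemma partial_deriv_eq:
  "(f has_derivative f') (at x) \<Longrightarrow> partial_deriv k f x = f' (axis k 1)"
  unfolding partial_deriv_def by (metis frechet_derivative_at)

lemma partial_deriv_add:
  assumes "f differentiable (at x)" "g differentiable (at x)"
  shows "partial_deriv k (\<lambda>x. f x + g x) x = partial_deriv k f x + partial_deriv k g x"
  unfolding partial_deriv_def
  by (rule partial_deriv_eq[unfolded partial_deriv_def])
     (intro has_derivative_add assms[unfolded frechet_derivative_works])

lemma partial_deriv_cmult:
  assumes "f differentiable (at x)"
  shows "partial_deriv k (\<lambda>x. c * f x) x = c * partial_deriv k f x"
  unfolding partial_deriv_def
  by (rule partial_deriv_eq[unfolded partial_deriv_def])
     (intro has_derivative_mult_right assms[unfolded frechet_derivative_works])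

lemma partial_deriv_mult:
  assumes "f differentiable (at x)" "g differentiable (at x)"
  shows "partial_deriv k (\<lambda>x. f x * g x) x = f x * partial_deriv k g x + partial_deriv k f x * g x"
  unfolding partial_deriv_def
  by (rule partial_deriv_eq[unfolded partial_deriv_def])
     (intro has_derivative_mult assms[unfolded frechet_derivative_works])

lemma frechet_derivative_partial_deriv:
  assumes "f differentiable (at (x :: real^'n::finite))"
  shows "frechet_derivative f (at x) z = (\<Sum>k\<in>UNIV. of_real (z $ k) * partial_deriv k f x)"
proof -
  have lin: "linear (frechet_derivative f (at x))"
    using assms by (rule linear_frechet_derivative)
  have "frechet_derivative f (at x) z = frechet_derivative f (at x) (\<Sum>k\<in>UNIV. z $ k *\<^sub>R axis k 1)"
    using basis_expansion[of z] by (simp add: scalar_mult_eq_scaleR)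
  also have "\<dots> = (\<Sum>k\<in>UNIV. z $ k *\<^sub>R frechet_derivative f (at x) (axis k 1))"
    by (simp add: linear_sum[OF lin] linear_scale[OF lin])
  finally show ?thesis
    by (simp add: partial_deriv_def scaleR_conv_of_real)
qed

text \<open>Reduces R^n to one real variable: the mean value inequality, the fundamental theorem of
  calculus and Euler's identity are all applied along such lines below.\<close>

lemma has_vector_derivative_along_line:
  assumes "f differentiable (at (x + s *\<^sub>R v))"
  shows "((\<lambda>s. f (x + s *\<^sub>R v)) has_vector_derivative frechet_derivative f (at (x + s *\<^sub>R v)) v) (at s within S)"
proof -
  let ?f' = "frechet_derivative f (at (x + s *\<^sub>R v))"
  have "(f has_derivative ?f') (at (x + s *\<^sub>R v))"
    using assms frechet_derivative_works by blast
  then have "((\<lambda>s. f (x + s *\<^sub>R v)) has_derivative (\<lambda>h. ?f' (h *\<^sub>R v))) (at s within S)"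
    by (rule has_derivative_compose[rotated]) (auto intro!: derivative_eq_intros)
  then show ?thesis
    by (simp add: has_vector_derivative_def linear_scale[OF linear_frechet_derivative[OF assms]])
qed

section \<open>Closure properties of test functions\<close>

lemma C_class_add: "C_class r f \<Longrightarrow> C_class r g \<Longrightarrow> C_class r (\<lambda>x. f x + g x)"
proof (induction r arbitrary: f g)
  case (Suc r)
  have "partial_deriv k (\<lambda>x. f x + g x) = (\<lambda>x. partial_deriv k f x + partial_deriv k g x)" for k
    using Suc.prems by (auto simp: partial_deriv_add)
  with Suc show ?case by auto
qed (auto intro: continuous_on_add)

lemma C_class_cmult: "C_class r f \<Longrightarrow> C_class r (\<lambda>x. c * f x)"
proof (induction r arbitrary: f)
  case (Suc r)
  have "partial_deriv k (\<lambda>x. c * f x) = (\<lambda>x. c * partial_deriv k f x)" for k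
    using Suc.prems by (auto simp: partial_deriv_cmult)
  with Suc show ?case by auto
qed (auto intro: continuous_intros)

lemma test_functionsI:
  assumes "\<And>r. C_class r f" "compact K" "{x. f x \<noteq> 0} \<subseteq> K"
  shows "f \<in> test_functions"
  using assms compact_Int_closed[OF assms(2) closed_closure[of "{x. f x \<noteq> 0}"]]
        closure_minimal[OF assms(3) compact_imp_closed[OF assms(2)]]
  by (auto simp: test_functions_def Int_absorb1)

lemma test_differentiable: "f \<in> test_functions \<Longrightarrow> f differentiable (at x)"
  unfolding test_functions_def using C_class.simps(2) by blast

lemma test_continuous: "f \<in> test_functions \<Longrightarrow> continuous_on S f"
  unfolding test_functions_def using C_class.simps(1) continuous_on_subset by blast

lemma test_measurable [measurable_dest]: "f \<in> test_functions \<Longrightarrow> f \<in> borel_measurable borel"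
  using test_continuous borel_measurable_continuous_onI by blast

lemma test_add:
  assumes "f \<in> test_functions" "g \<in> test_functions"
  shows "(\<lambda>x. f x + g x) \<in> test_functions"
proof (rule test_functionsI)
  show "C_class r (\<lambda>x. f x + g x)" for r
    using assms by (intro C_class_add) (auto simp: test_functions_def)
  show "compact (closure {x. f x \<noteq> 0} \<union> closure {x. g x \<noteq> 0})"
    using assms by (auto simp: test_functions_def)
  show "{x. f x + g x \<noteq> 0} \<subseteq> closure {x. f x \<noteq> 0} \<union> closure {x. g x \<noteq> 0}"
  proof
    fix x assume "x \<in> {x. f x + g x \<noteq> 0}"
    then have "x \<in> {x. f x \<noteq> 0} \<union> {x. g x \<noteq> 0}" by auto
    then show "x \<in> closure {x. f x \<noteq> 0} \<union> closure {x. g x \<noteq> 0}"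
      by (rule subsetD[OF Un_mono[OF closure_subset closure_subset]])
  qed
qed

lemma test_cmult:
  assumes "f \<in> test_functions"
  shows "(\<lambda>x. c * f x) \<in> test_functions"
proof (rule test_functionsI)
  show "C_class r (\<lambda>x. c * f x)" for r
    using assms by (intro C_class_cmult) (auto simp: test_functions_def)
  show "compact (closure {x. f x \<noteq> 0})"
    using assms by (auto simp: test_functions_def)
  show "{x. c * f x \<noteq> 0} \<subseteq> closure {x. f x \<noteq> 0}"
    using closure_subset[of "{x. f x \<noteq> 0}"] by auto
qed

lemma test_zero: "(\<lambda>x :: real^'n::finite. 0) \<in> test_functions"
proof (rule test_functionsI)
  show "C_class r (\<lambda>x :: real^'n. 0)" for r
  proof (induction r)
    case (Suc r)
    have "partial_deriv k (\<lambda>x :: real^'n. 0) = (\<lambda>x. 0)" for k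
      by (rule ext, subst partial_deriv_eq[OF has_derivative_const]) auto
    with Suc show ?case by auto
  qed auto
  show "compact {}" by simp
qed auto

lemma test_sum: "(\<And>i. i \<in> I \<Longrightarrow> f i \<in> test_functions) \<Longrightarrow> (\<lambda>x. \<Sum>i\<in>I. f i x) \<in> test_functions"
  by (induction I rule: infinite_finite_induct) (auto intro: test_zero test_add)

text \<open>Off the closed support \<open>f\<close> vanishes on an open set, so its derivatives
  vanish there as well and the support does not grow.\<close>

lemma test_partial_deriv:
  assumes f: "f \<in> test_functions"
  shows "partial_deriv k f \<in> test_functions"
proof (rule test_functionsI)
  let ?S = "closure {x. f x \<noteq> 0}"
  show "C_class r (partial_deriv k f)" for r
    using f by (auto simp: test_functions_def dest: spec[of _ "Suc r"])
  show "compact ?S"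
    using f by (auto simp: test_functions_def)
  show "{x. partial_deriv k f x \<noteq> 0} \<subseteq> ?S"
  proof (rule ccontr)
    assume "\<not> ?thesis"
    then obtain x where x: "x \<notin> ?S" "partial_deriv k f x \<noteq> 0" by auto
    have "(f has_derivative (\<lambda>_. 0)) (at x)"
    proof (rule has_derivative_transform_within_open[OF has_derivative_const[of 0]])
      show "open (- ?S)" "x \<in> - ?S" using x by auto
    qed (use closure_subset[of "{x. f x \<noteq> 0}"] in auto)
    from partial_deriv_eq[OF this, of k] x(2) show False by simp
  qed
qed

lemma test_D_op: "f \<in> test_functions \<Longrightarrow> D_op k f \<in> test_functions"
  unfolding D_op_def by (intro test_cmult test_partial_deriv)

text \<open>Both mixed second derivatives are the limit of the same second difference quotient.\<close>

lemma second_difference_bound: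
  fixes f :: "real^'n::finite \<Rightarrow> complex"
  assumes f: "f \<in> test_functions" and "h \<ge> 0"
    and le: "\<And>s t. s \<in> {0..h} \<Longrightarrow> t \<in> {0..h} \<Longrightarrow>
      norm (partial_deriv k (partial_deriv j f) (x + s *\<^sub>R axis j 1 + t *\<^sub>R axis k 1) - A) \<le> \<epsilon>"
  shows "norm (f (x + h *\<^sub>R axis j 1 + h *\<^sub>R axis k 1) - f (x + h *\<^sub>R axis j 1)
            - f (x + h *\<^sub>R axis k 1) + f x - of_real (h * h) * A) \<le> \<epsilon> * h * h"
proof -
  have mvt: "norm (c h - c 0) \<le> B * h"
    if "\<And>s. s \<in> {0..h} \<Longrightarrow> (c has_vector_derivative c' s) (at s within {0..h})"
       "\<And>s. s \<in> {0..h} \<Longrightarrow> norm (c' s) \<le> B" for c :: "real \<Rightarrow> complex" and c' B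
    using differentiable_bound[of "{0..h}" c "\<lambda>s x. x *\<^sub>R c' s" B h 0] that \<open>h \<ge> 0\<close>
    by (auto simp: has_vector_derivative_def onorm_scaleR_left onorm_id)
  have line: "((\<lambda>s. g (y + s *\<^sub>R axis i 1)) has_vector_derivative partial_deriv i g (y + s *\<^sub>R axis i 1))
       (at s within S)" if "g \<in> test_functions" for g and y :: "real^'n" and s i S
    unfolding partial_deriv_def by (rule has_vector_derivative_along_line) (rule test_differentiable[OF that])
  \<comment> \<open>The mean value inequality is used twice: along \<open>axis k 1\<close> it bounds
    \<open>?d\<close>, and \<open>?d\<close> is in turn the derivative along \<open>axis j 1\<close>
    of a function whose increment is the second difference minus
    \<open>of_real (h * h) * A\<close>.\<close>
  let ?d = "\<lambda>s. partial_deriv j f (x + h *\<^sub>R axis k 1 + s *\<^sub>R axis j 1) - partial_deriv j f (x + s *\<^sub>R axis j 1) - of_real h * A"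
  have d: "norm (?d s) \<le> \<epsilon> * h" if s: "s \<in> {0..h}" for s
  proof -
    let ?c = "\<lambda>t. partial_deriv j f (x + s *\<^sub>R axis j 1 + t *\<^sub>R axis k 1) - of_real t * A"
    have "norm (?c h - ?c 0) \<le> \<epsilon> * h"
    proof (rule mvt)
      fix t assume "t \<in> {0..h}"
      show "(?c has_vector_derivative (partial_deriv k (partial_deriv j f) (x + s *\<^sub>R axis j 1 + t *\<^sub>R axis k 1) - A)) (at t within {0..h})"
        by (auto intro!: derivative_eq_intros line test_partial_deriv f)
    qed (rule le[OF s])
    then show ?thesis by (simp add: algebra_simps)
  qed
  let ?c = "\<lambda>s. f (x + h *\<^sub>R axis k 1 + s *\<^sub>R axis j 1) - f (x + s *\<^sub>R axis j 1) - of_real s * (of_real h * A)"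
  have "norm (?c h - ?c 0) \<le> \<epsilon> * h * h"
  proof (rule mvt)
    fix t assume "t \<in> {0..h}"
    show "(?c has_vector_derivative ?d t) (at t within {0..h})"
      by (auto intro!: derivative_eq_intros line test_partial_deriv f)
  qed (rule d)
  moreover have "?c h - ?c 0 = f (x + h *\<^sub>R axis j 1 + h *\<^sub>R axis k 1) - f (x + h *\<^sub>R axis j 1)
            - f (x + h *\<^sub>R axis k 1) + f x - of_real (h * h) * A"
    by (simp add: algebra_simps)
  ultimately show ?thesis by (simp only:)
qed

lemma partial_deriv_commute:
  fixes f :: "real^'n::finite \<Rightarrow> complex"
  assumes f: "f \<in> test_functions"
  shows "partial_deriv j (partial_deriv k f) = partial_deriv k (partial_deriv j f)"
proof
  fix x
  let ?A = "partial_deriv k (partial_deriv j f)" and ?B = "partial_deriv j (partial_deriv k f)"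
  have "norm (?B x - ?A x) \<le> 0 + \<epsilon>" if "\<epsilon> > 0" for \<epsilon>
  proof -
    have ex: "\<exists>d>0. \<forall>y. norm (y - x) < d \<longrightarrow> norm (g y - g x) \<le> \<epsilon> / 2"
      if "g \<in> test_functions" for g
      using test_continuous[OF that, of UNIV] \<open>\<epsilon> > 0\<close>
      unfolding continuous_on_iff dist_norm
      by (metis UNIV_I half_gt_zero less_eq_real_def)
    obtain d1 where d1: "d1 > 0" "\<And>y. norm (y - x) < d1 \<Longrightarrow> norm (?A y - ?A x) \<le> \<epsilon> / 2"
      using ex[of ?A] f by (auto intro: test_partial_deriv)
    obtain d2 where d2: "d2 > 0" "\<And>y. norm (y - x) < d2 \<Longrightarrow> norm (?B y - ?B x) \<le> \<epsilon> / 2"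
      using ex[of ?B] f by (auto intro: test_partial_deriv)
    \<comment> \<open>Points of the square with side \<open>h\<close> stay within
      \<open>2 * h\<close> of \<open>x\<close>; the divisor 3 keeps this below both radii.\<close>
    define h where "h = min d1 d2 / 3"
    have h: "h > 0" "2 * h < d1" "2 * h < d2"
      using d1(1) d2(1) by (auto simp: h_def)
    have close: "norm (s *\<^sub>R axis i 1 + t *\<^sub>R axis m 1 :: real^'n) \<le> 2 * h"
      if "s \<in> {0..h}" "t \<in> {0..h}" for s t i m
      using norm_triangle_ineq[of "s *\<^sub>R axis i 1 :: real^'n" "t *\<^sub>R axis m 1"] that by simp
    define \<Delta> where "\<Delta> = f (x + h *\<^sub>R axis j 1 + h *\<^sub>R axis k 1) - f (x + h *\<^sub>R axis j 1)
            - f (x + h *\<^sub>R axis k 1) + f x"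
    have A: "norm (\<Delta> - of_real (h * h) * ?A x) \<le> \<epsilon> / 2 * h * h"
      unfolding \<Delta>_def using f h
      by (intro second_difference_bound d1) (auto intro!: le_less_trans[OF close])
    have "norm (f (x + h *\<^sub>R axis k 1 + h *\<^sub>R axis j 1) - f (x + h *\<^sub>R axis k 1)
            - f (x + h *\<^sub>R axis j 1) + f x - of_real (h * h) * ?B x) \<le> \<epsilon> / 2 * h * h"
      using f h by (intro second_difference_bound d2) (auto intro!: le_less_trans[OF close])
    \<comment> \<open>The second difference is symmetric in \<open>j\<close> and \<open>k\<close>,
      so both derivatives are compared with the same \<open>\<Delta>\<close>.\<close>
    then have B: "norm (\<Delta> - of_real (h * h) * ?B x) \<le> \<epsilon> / 2 * h * h"
      by (simp add: \<Delta>_def algebra_simps)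
    have "(h * h) * norm (?B x - ?A x) = norm (of_real (h * h) * (?B x - ?A x))"
      using h by (simp add: norm_mult)
    also have "\<dots> = norm ((\<Delta> - of_real (h * h) * ?A x) - (\<Delta> - of_real (h * h) * ?B x))"
      by (simp add: algebra_simps)
    also have "\<dots> \<le> \<epsilon> / 2 * h * h + \<epsilon> / 2 * h * h"
      by (rule order_trans[OF norm_triangle_ineq4 add_mono[OF A B]])
    also have "\<dots> = (h * h) * \<epsilon>" by simp
    finally show ?thesis using h by simp
  qed
  then have "norm (?B x - ?A x) \<le> 0" by (rule field_le_epsilon)
  then show "?B x = ?A x" by simp
qed

section \<open>Commuting operators \<open>D_op\<close> and multi-index derivatives\<close>

lemma D_op_commute: "f \<in> test_functions \<Longrightarrow> D_op j (D_op k f) = D_op k (D_op j f)"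
  unfolding D_op_def
  by (rule ext, subst (1 2) partial_deriv_cmult)
     (auto simp: partial_deriv_commute[of f j k] intro!: test_differentiable test_partial_deriv)

lemma D_op_add:
  "f \<in> test_functions \<Longrightarrow> g \<in> test_functions \<Longrightarrow>
    D_op k (\<lambda>x. f x + g x) = (\<lambda>x. D_op k f x + D_op k g x)"
  unfolding D_op_def by (subst partial_deriv_add) (auto simp: test_differentiable algebra_simps)

lemma D_op_cmult: "f \<in> test_functions \<Longrightarrow> D_op k (\<lambda>x. c * f x) = (\<lambda>x. c * D_op k f x)"
  unfolding D_op_def by (subst partial_deriv_cmult) (auto simp: test_differentiable algebra_simps)

lemma test_D_op_pow: "f \<in> test_functions \<Longrightarrow> (D_op k ^^ m) f \<in> test_functions"
  by (induction m) (auto intro: test_D_op)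

lemma D_op_pow_commute:
  "f \<in> test_functions \<Longrightarrow> (D_op j ^^ a) ((D_op k ^^ b) f) = (D_op k ^^ b) ((D_op j ^^ a) f)"
proof (induction a)
  case (Suc a)
  have *: "D_op j ((D_op k ^^ b) g) = (D_op k ^^ b) (D_op j g)" if "g \<in> test_functions" for g
    using that by (induction b) (auto simp: D_op_commute[of _ j k] test_D_op_pow)
  show ?case using Suc by (simp add: * test_D_op_pow)
qed simp

lemma D_op_pow_add:
  "f \<in> test_functions \<Longrightarrow> g \<in> test_functions \<Longrightarrow>
    (D_op k ^^ m) (\<lambda>x. f x + g x) = (\<lambda>x. (D_op k ^^ m) f x + (D_op k ^^ m) g x)"
  by (induction m) (auto simp: D_op_add test_D_op_pow)

lemma D_op_pow_cmult:
  "f \<in> test_functions \<Longrightarrow> (D_op k ^^ m) (\<lambda>x. c * f x) = (\<lambda>x. c * (D_op k ^^ m) f x)"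
  by (induction m) (auto simp: D_op_cmult test_D_op_pow)

text \<open>\<open>D_multi\<close> with an arbitrary list in place of the sorted enumeration of the
  coordinates, so that its properties follow by induction on the list.\<close>

definition D_list ::
  "'n list \<Rightarrow> ('n::finite \<Rightarrow>\<^sub>0 nat) \<Rightarrow> (real^'n \<Rightarrow> complex) \<Rightarrow> real^'n \<Rightarrow> complex" where
  "D_list ks \<alpha> f = foldr (\<lambda>k g. (D_op k ^^ Poly_Mapping.lookup \<alpha> k) g) ks f"

lemma D_multi_eq_D_list: "D_multi \<alpha> f = D_list (sorted_list_of_set UNIV) \<alpha> f"
  by (simp add: D_multi_def D_list_def)

lemma D_list_Nil [simp]: "D_list [] \<alpha> f = f"
  and D_list_Cons [simp]: "D_list (k # ks) \<alpha> f = (D_op k ^^ Poly_Mapping.lookup \<alpha> k) (D_list ks \<alpha> f)"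
  by (simp_all add: D_list_def)

lemma test_D_list: "f \<in> test_functions \<Longrightarrow> D_list ks \<alpha> f \<in> test_functions"
  by (induction ks) (auto intro: test_D_op_pow)

lemma D_list_D_op_pow:
  "f \<in> test_functions \<Longrightarrow> D_list ks \<alpha> ((D_op k ^^ m) f) = (D_op k ^^ m) (D_list ks \<alpha> f)"
  by (induction ks) (simp_all, intro D_op_pow_commute test_D_list)

lemma D_list_D_list:
  "f \<in> test_functions \<Longrightarrow> D_list ks \<alpha> (D_list ks \<beta> f) = D_list ks (\<alpha> + \<beta>) f"
  by (induction ks)
     (simp_all add: D_list_D_op_pow test_D_list lookup_add funpow_add)

lemma test_D_multi: "f \<in> test_functions \<Longrightarrow> D_multi \<alpha> f \<in> test_functions"
  by (simp add: D_multi_eq_D_list test_D_list)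

lemma D_multi_D_multi:
  "f \<in> test_functions \<Longrightarrow> D_multi \<alpha> (D_multi \<beta> f) = D_multi (\<alpha> + \<beta>) f"
  by (simp add: D_multi_eq_D_list D_list_D_list)

lemma D_multi_0 [simp]: "D_multi 0 f = f"
proof -
  have "D_list ks 0 f = f" for ks by (induction ks) auto
  then show ?thesis by (simp add: D_multi_eq_D_list)
qed

lemma D_multi_single:
  "D_multi (Poly_Mapping.single k 1) f = D_op k f"
proof -
  have 1: "k \<notin> set ks \<Longrightarrow> D_list ks (Poly_Mapping.single k 1) f = f" for ks
    by (induction ks) (auto simp: lookup_single)
  have 2: "distinct ks \<Longrightarrow> k \<in> set ks \<Longrightarrow> D_list ks (Poly_Mapping.single k 1) f = D_op k f" for ks
    by (induction ks) (use 1 in \<open>auto simp: lookup_single when_def\<close>)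
  show ?thesis unfolding D_multi_eq_D_list by (rule 2) auto
qed

lemma D_multi_add:
  "f \<in> test_functions \<Longrightarrow> g \<in> test_functions \<Longrightarrow>
    D_multi \<alpha> (\<lambda>x. f x + g x) = (\<lambda>x. D_multi \<alpha> f x + D_multi \<alpha> g x)"
proof -
  assume fg: "f \<in> test_functions" "g \<in> test_functions"
  have "D_list ks \<alpha> (\<lambda>x. f x + g x) = (\<lambda>x. D_list ks \<alpha> f x + D_list ks \<alpha> g x)" for ks
    using fg by (induction ks) (auto simp: D_op_pow_add test_D_list)
  then show ?thesis by (simp add: D_multi_eq_D_list)
qed

lemma D_multi_cmult:
  "f \<in> test_functions \<Longrightarrow> D_multi \<alpha> (\<lambda>x. c * f x) = (\<lambda>x. c * D_multi \<alpha> f x)"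
proof -
  assume f: "f \<in> test_functions"
  have "D_list ks \<alpha> (\<lambda>x. c * f x) = (\<lambda>x. c * D_list ks \<alpha> f x)" for ks
    using f by (induction ks) (auto simp: D_op_pow_cmult test_D_list)
  then show ?thesis by (simp add: D_multi_eq_D_list)
qed

section \<open>Action of the ring of operators on test functions\<close>

lemma apply_op_superset:
  assumes "finite A" "Poly_Mapping.keys T \<subseteq> A"
  shows "apply_op T f x = (\<Sum>\<alpha>\<in>A. Poly_Mapping.lookup T \<alpha> * D_multi \<alpha> f x)"
  unfolding apply_op_def using assms
  by (intro sum.mono_neutral_left) (auto simp: in_keys_iff)

lemma apply_op_plus: "apply_op (S + T) f x = apply_op S f x + apply_op T f x"
proof -
  let ?A = "Poly_Mapping.keys S \<union> Poly_Mapping.keys T"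
  have "Poly_Mapping.keys (S + T) \<subseteq> ?A" by (rule keys_add)
  then show ?thesis
    by (subst (1 2 3) apply_op_superset[of ?A])
       (auto simp: lookup_add algebra_simps sum.distrib)
qed

lemma apply_op_single: "apply_op (Poly_Mapping.single \<alpha> c) f x = c * D_multi \<alpha> f x"
  by (subst apply_op_superset[of "{\<alpha>}"]) auto

lemma test_apply_op: "f \<in> test_functions \<Longrightarrow> apply_op T f \<in> test_functions"
  unfolding apply_op_def by (intro test_sum test_cmult test_D_multi)

lemma apply_op_add:
  "f \<in> test_functions \<Longrightarrow> g \<in> test_functions \<Longrightarrow>
    apply_op T (\<lambda>x. f x + g x) = (\<lambda>x. apply_op T f x + apply_op T g x)"
  by (auto simp: apply_op_def D_multi_add algebra_simps sum.distrib)

lemma apply_op_cmult: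
  "f \<in> test_functions \<Longrightarrow> apply_op T (\<lambda>x. c * f x) = (\<lambda>x. c * apply_op T f x)"
  by (auto simp: apply_op_def D_multi_cmult algebra_simps sum_distrib_left)

lemma diffop_as_sum:
  fixes T :: "'a \<Rightarrow>\<^sub>0 'b::comm_monoid_add"
  shows "T = (\<Sum>\<alpha>\<in>Poly_Mapping.keys T. Poly_Mapping.single \<alpha> (Poly_Mapping.lookup T \<alpha>))"
  by (rule poly_mapping_eqI)
     (auto simp: lookup_sum lookup_single when_def sum.If_cases in_keys_iff
       sum.delta'[of "Poly_Mapping.keys T"])

text \<open>Both sides are biadditive in \<open>S\<close> and \<open>T\<close>, which reduces the
  claim to monomials; there it is \<open>D_multi_D_multi\<close>, that is, the commutation of
  partial derivatives.\<close>

lemma apply_op_mult: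
  assumes f: "f \<in> test_functions"
  shows "apply_op (S * T) f = apply_op S (apply_op T f)"
proof -
  have sum: "apply_op (sum g I) h x = (\<Sum>i\<in>I. apply_op (g i) h x)"
    for g :: "_ \<Rightarrow> 'a diffop" and I h x
    by (induction I rule: infinite_finite_induct) (simp_all add: apply_op_plus, simp_all add: apply_op_def)
  have mono: "apply_op (Poly_Mapping.single \<alpha> c * Poly_Mapping.single \<beta> d) f
    = apply_op (Poly_Mapping.single \<alpha> c) (apply_op (Poly_Mapping.single \<beta> d) f)" for \<alpha> \<beta> c d
  proof -
    have single: "apply_op (Poly_Mapping.single \<gamma> e) g = (\<lambda>x. e * D_multi \<gamma> g x)" for \<gamma> :: "'a \<Rightarrow>\<^sub>0 nat" and e g
      by (simp add: fun_eq_iff apply_op_single)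
    show ?thesis
      using f by (simp add: mult_single single D_multi_cmult test_D_multi D_multi_D_multi mult.assoc)
  qed
  have sum2: "apply_op U (\<lambda>x. \<Sum>i\<in>I. g i x) = (\<lambda>x. \<Sum>i\<in>I. apply_op U (g i) x)"
    if "\<And>i. i \<in> I \<Longrightarrow> g i \<in> test_functions" for U g and I :: "('a \<Rightarrow>\<^sub>0 nat) set"
    using that
  proof (induction I rule: infinite_finite_induct)
    case (insert i I)
    then show ?case by (simp add: apply_op_add test_sum)
  qed (use apply_op_cmult[OF test_zero, of U 0] in auto)
  let ?s = "\<lambda>S \<alpha>. Poly_Mapping.single \<alpha> (Poly_Mapping.lookup S \<alpha>)"
  have "apply_op (S * T) f = apply_op (\<Sum>\<alpha>\<in>Poly_Mapping.keys S. \<Sum>\<beta>\<in>Poly_Mapping.keys T. ?s S \<alpha> * ?s T \<beta>) f"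
    by (subst diffop_as_sum[of S], subst diffop_as_sum[of T]) (simp add: sum_product)
  also have "\<dots> = (\<lambda>x. \<Sum>\<alpha>\<in>Poly_Mapping.keys S. \<Sum>\<beta>\<in>Poly_Mapping.keys T.
      apply_op (?s S \<alpha>) (apply_op (?s T \<beta>) f) x)"
    by (simp add: sum mono fun_eq_iff)
  also have "\<dots> = (\<lambda>x. \<Sum>\<alpha>\<in>Poly_Mapping.keys S. apply_op (?s S \<alpha>) (apply_op T f) x)"
  proof -
    have "apply_op T f = (\<lambda>x. \<Sum>\<beta>\<in>Poly_Mapping.keys T. apply_op (?s T \<beta>) f x)"
      by (subst diffop_as_sum[of T]) (simp add: sum fun_eq_iff)
    then show ?thesis using f by (simp add: sum2 test_apply_op)
  qed
  also have "\<dots> = apply_op S (apply_op T f)"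
    by (subst (2) diffop_as_sum[of S]) (simp add: sum fun_eq_iff)
  finally show ?thesis .
qed

section \<open>Degrees and principal symbols\<close>

lemma mdeg_add: "mdeg (\<alpha> + \<beta>) = mdeg \<alpha> + mdeg \<beta>"
  by (simp add: mdeg_def lookup_add sum.distrib)

lemma mdeg_single [simp]: "mdeg (Poly_Mapping.single k m) = m"
  by (simp add: mdeg_def lookup_single when_def)

lemma mdeg_0 [simp]: "mdeg 0 = 0"
  by (simp add: mdeg_def)

definition monom_fun :: "('n::finite \<Rightarrow>\<^sub>0 nat) \<Rightarrow> real^'n \<Rightarrow> complex" where
  "monom_fun \<alpha> \<xi> = (\<Prod>k\<in>UNIV. complex_of_real (\<xi> $ k) ^ Poly_Mapping.lookup \<alpha> k)"

lemma monom_fun_add: "monom_fun (\<alpha> + \<beta>) \<xi> = monom_fun \<alpha> \<xi> * monom_fun \<beta> \<xi>"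
  by (simp add: monom_fun_def lookup_add power_add prod.distrib)

lemma monom_fun_scaleR: "monom_fun \<alpha> (t *\<^sub>R \<xi>) = of_real t ^ mdeg \<alpha> * monom_fun \<alpha> \<xi>"
  by (simp add: monom_fun_def mdeg_def power_mult_distrib prod.distrib power_sum)

lemma monom_fun_single: "monom_fun (Poly_Mapping.single k m) \<xi> = of_real (\<xi> $ k) ^ m"
proof -
  have "monom_fun (Poly_Mapping.single k m) \<xi> = (\<Prod>j\<in>UNIV. if j = k then of_real (\<xi> $ k) ^ m else 1)"
    unfolding monom_fun_def by (intro prod.cong) (auto simp: lookup_single when_def)
  then show ?thesis by simp
qed

lemma principal_symbol_monom:
  "principal_symbol m T \<xi> = (\<Sum>\<alpha> | mdeg \<alpha> = m. Poly_Mapping.lookup T \<alpha> * monom_fun \<alpha> \<xi>)"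
  by (simp add: principal_symbol_def monom_fun_def)

lemma principal_symbol_scaleR:
  "principal_symbol m T (t *\<^sub>R \<xi>) = of_real t ^ m * principal_symbol m T \<xi>"
  by (simp add: principal_symbol_monom monom_fun_scaleR sum_distrib_left algebra_simps)

lemma principal_symbol_plus:
  "principal_symbol m (S + T) \<xi> = principal_symbol m S \<xi> + principal_symbol m T \<xi>"
  by (simp add: principal_symbol_def lookup_add algebra_simps sum.distrib)

lemma principal_symbol_single:
  "principal_symbol m (Poly_Mapping.single \<alpha> c) \<xi> = (if mdeg \<alpha> = m then c * monom_fun \<alpha> \<xi> else 0)"
proof -
  have "principal_symbol m (Poly_Mapping.single \<alpha> c) \<xi>
      = (\<Sum>\<beta> | mdeg \<beta> = m. if \<beta> = \<alpha> then c * monom_fun \<alpha> \<xi> else 0)"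
    unfolding principal_symbol_monom by (intro sum.cong) (auto simp: lookup_single)
  then show ?thesis by (simp add: sum.delta finite_mdeg_eq)
qed

text \<open>After expansion into monomials the bounds force a pair with
  \<open>mdeg \<alpha> + mdeg \<beta> = a + b\<close> to have degrees exactly \<open>a\<close> and
  \<open>b\<close>, so lower order terms do not reach the top degree.\<close>

lemma principal_symbol_mult:
  assumes "\<And>\<alpha>. \<alpha> \<in> Poly_Mapping.keys S \<Longrightarrow> mdeg \<alpha> \<le> a"
    and "\<And>\<beta>. \<beta> \<in> Poly_Mapping.keys T \<Longrightarrow> mdeg \<beta> \<le> b"
  shows "principal_symbol (a + b) (S * T) \<xi> = principal_symbol a S \<xi> * principal_symbol b T \<xi>"
proof -
  have sum: "principal_symbol m (sum g I) \<xi> = (\<Sum>i\<in>I. principal_symbol m (g i) \<xi>)"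
    for g :: "_ \<Rightarrow> 'a diffop" and I m
    by (induction I rule: infinite_finite_induct)
       (simp_all add: principal_symbol_plus, simp_all add: principal_symbol_def)
  let ?s = "\<lambda>S \<alpha>. Poly_Mapping.single \<alpha> (Poly_Mapping.lookup S \<alpha>)"
  have "principal_symbol (a + b) (S * T) \<xi>
      = (\<Sum>\<alpha>\<in>Poly_Mapping.keys S. \<Sum>\<beta>\<in>Poly_Mapping.keys T. principal_symbol (a + b) (?s S \<alpha> * ?s T \<beta>) \<xi>)"
    by (subst diffop_as_sum[of S], subst diffop_as_sum[of T]) (simp add: sum_product sum)
  also have "\<dots> = (\<Sum>\<alpha>\<in>Poly_Mapping.keys S. \<Sum>\<beta>\<in>Poly_Mapping.keys T.
      principal_symbol a (?s S \<alpha>) \<xi> * principal_symbol b (?s T \<beta>) \<xi>)"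
  proof (intro sum.cong refl)
    fix \<alpha> \<beta> assume "\<alpha> \<in> Poly_Mapping.keys S" "\<beta> \<in> Poly_Mapping.keys T"
    then have "mdeg \<alpha> \<le> a" "mdeg \<beta> \<le> b" using assms by auto
    then show "principal_symbol (a + b) (?s S \<alpha> * ?s T \<beta>) \<xi>
        = principal_symbol a (?s S \<alpha>) \<xi> * principal_symbol b (?s T \<beta>) \<xi>"
      by (auto simp: mult_single principal_symbol_single mdeg_add monom_fun_add)
  qed
  also have "\<dots> = principal_symbol a (\<Sum>\<alpha>\<in>Poly_Mapping.keys S. ?s S \<alpha>) \<xi>
      * principal_symbol b (\<Sum>\<beta>\<in>Poly_Mapping.keys T. ?s T \<beta>) \<xi>"
    by (simp add: sum sum_product)
  finally show ?thesis by (simp flip: diffop_as_sum)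
qed

lemma keys_D_sym_plus_const: "\<alpha> \<in> Poly_Mapping.keys (D_sym u + const_op c) \<Longrightarrow> mdeg \<alpha> \<le> 1"
  using keys_add[of "D_sym u" "const_op c"]
  by (auto simp: D_sym_def const_op_def split: if_splits)

lemma mdeg_keys_mult:
  assumes "\<And>\<alpha>. \<alpha> \<in> Poly_Mapping.keys S \<Longrightarrow> mdeg \<alpha> \<le> a"
    and "\<And>\<beta>. \<beta> \<in> Poly_Mapping.keys T \<Longrightarrow> mdeg \<beta> \<le> b"
    and "\<gamma> \<in> Poly_Mapping.keys (S * T)"
  shows "mdeg \<gamma> \<le> a + b"
proof -
  obtain \<alpha> \<beta> where "\<alpha> \<in> Poly_Mapping.keys S" "\<beta> \<in> Poly_Mapping.keys T" "\<gamma> = \<alpha> + \<beta>"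
    using assms(3) keys_mult[of S T] by auto
  with assms show ?thesis by (auto simp: mdeg_add intro: add_mono)
qed

lemma keys_R_op: "\<alpha> \<in> Poly_Mapping.keys (R_op u v) \<Longrightarrow> mdeg \<alpha> \<le> 2"
proof -
  assume "\<alpha> \<in> Poly_Mapping.keys (R_op u v)"
  then have "mdeg \<alpha> \<le> 1 + 1"
    unfolding R_op_def by (rule mdeg_keys_mult[rotated 2]) (auto dest: keys_D_sym_plus_const)
  then show ?thesis by simp
qed

lemma principal_symbol_R_op:
  "principal_symbol 2 (R_op u v) \<xi> = of_real (\<xi> $ u) * of_real (\<xi> $ v)"
proof -
  have 1: "principal_symbol 1 (D_sym w + const_op \<i>) \<xi> = of_real (\<xi> $ w)" for w
    by (simp add: principal_symbol_plus D_sym_def const_op_def principal_symbol_single monom_fun_single)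
  show ?thesis
    using principal_symbol_mult[OF keys_D_sym_plus_const keys_D_sym_plus_const, where \<xi>=\<xi>]
    by (simp only: R_op_def 1 one_add_one[symmetric])
qed

lemma apply_op_D_sym_plus_const:
  "apply_op (D_sym u + const_op c) f = (\<lambda>x. D_op u f x + c * f x)"
  by (simp add: fun_eq_iff apply_op_plus D_sym_def const_op_def apply_op_single D_multi_single[unfolded One_nat_def])

section \<open>Averaging operators on \<open>L\<^sup>p\<close>\<close>

text \<open>Convexity of the power function, expressed by its tangent line at \<open>s\<close>. The
  lower bound is affine in \<open>t\<close> and can be averaged, which yields Jensen's inequality
  for a suitable \<open>s\<close>.\<close>

lemma young_tangent:
  assumes "t \<ge> 0" "s > 0" "r \<ge> (1::real)"
  shows "r * s powr (r - 1) * t \<le> t powr r + (r - 1) * s powr r"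
proof (cases "r = 1")
  case False
  with assms have r: "r > 1" by simp
  have "t * s powr (r - 1) \<le> t powr r / r + (s powr (r - 1)) powr (r / (r - 1)) / (r / (r - 1))"
    using r assms by (intro Youngs_inequality) (auto simp: field_simps)
  also have "(s powr (r - 1)) powr (r / (r - 1)) = s powr r"
    using r by (simp add: powr_powr)
  finally have "r * (t * s powr (r - 1)) \<le> r * (t powr r / r + s powr r / (r / (r - 1)))"
    using r by (intro mult_left_mono) auto
  also have "\<dots> = t powr r + (r - 1) * s powr r"
    using r by (simp add: field_simps)
  finally show ?thesis by (simp add: mult_ac)
qed (use assms in auto)

text \<open>The quotient of \<open>s + t\<close> by \<open>a + b\<close> is the convex combination
  of \<open>s / a\<close> and \<open>t / b\<close> with weights \<open>a / (a + b)\<close> and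
  \<open>b / (a + b)\<close>. With \<open>a\<close> and \<open>b\<close> close to the norms of two
  functions this becomes Minkowski's inequality.\<close>

lemma powr_convex_combination:
  assumes "a > 0" "b > 0" "s \<ge> 0" "t \<ge> 0" "r \<ge> (1::real)"
  shows "(s + t) powr r \<le> (a + b) powr r * (a / (a + b) * (s / a) powr r + b / (a + b) * (t / b) powr r)"
proof (cases "s + t = 0")
  case False
  \<comment> \<open>The tangent point is the weighted mean itself, so the weighted linear terms add
    up to \<open>r * m powr r\<close>.\<close>
  define m where "m = (s + t) / (a + b)"
  have m: "m > 0" using assms False by (auto simp: m_def)
  have "a / (a + b) * (r * m powr (r - 1) * (s / a)) \<le> a / (a + b) * ((s / a) powr r + (r - 1) * m powr r)"
    using assms m by (intro mult_left_mono young_tangent) auto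
  moreover have "b / (a + b) * (r * m powr (r - 1) * (t / b)) \<le> b / (a + b) * ((t / b) powr r + (r - 1) * m powr r)"
    using assms m by (intro mult_left_mono young_tangent) auto
  moreover have "a / (a + b) * (r * m powr (r - 1) * (s / a)) + b / (a + b) * (r * m powr (r - 1) * (t / b))
      = r * m powr (r - 1) * m"
  proof -
    have "a / (a + b) * (X * (s / a)) + b / (a + b) * (X * (t / b)) = X * m" for X
      using assms by (simp add: m_def add_divide_distrib distrib_left)
    then show ?thesis .
  qed
  moreover have "r * m powr (r - 1) * m = r * m powr r"
    using powr_mult_base[of m "r - 1"] m by (simp add: mult_ac)
  moreover have "a / (a + b) * ((r - 1) * m powr r) + b / (a + b) * ((r - 1) * m powr r) = (r - 1) * m powr r"
  proof -
    have "a / (a + b) * X + b / (a + b) * X = X" for X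
      using assms by (simp flip: distrib_right add_divide_distrib)
    then show ?thesis .
  qed
  moreover have "(r - 1) * m powr r = r * m powr r - m powr r"
    by (simp add: left_diff_distrib)
  ultimately have "m powr r \<le> a / (a + b) * (s / a) powr r + b / (a + b) * (t / b) powr r"
    unfolding distrib_left by linarith
  then have "(a + b) powr r * m powr r \<le> (a + b) powr r * (a / (a + b) * (s / a) powr r + b / (a + b) * (t / b) powr r)"
    by (rule mult_left_mono) auto
  moreover have "(a + b) powr r * m powr r = (s + t) powr r"
    using assms by (simp add: m_def powr_divide)
  ultimately show ?thesis by simp
qed (use assms in auto)

section \<open>Bounded integrable functions and Minkowski's inequality\<close>

lemma integral_norm_le_of_bound:
  fixes f :: "'a \<Rightarrow> 'b::{banach, second_countable_topology}"
  assumes "integrable M g" "\<And>x. norm (f x) \<le> g x"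
  shows "norm (integral\<^sup>L M f) \<le> integral\<^sup>L M g"
proof -
  have "norm (integral\<^sup>L M f) \<le> (LINT x|M. norm (f x))" by (rule integral_norm_bound)
  also have "\<dots> \<le> integral\<^sup>L M g"
    using assms by (intro integral_mono') (auto intro: order_trans[OF norm_ge_zero])
  finally show ?thesis .
qed

definition Lp_class :: "(real^'n::finite \<Rightarrow> complex) \<Rightarrow> bool" where
  "Lp_class u \<longleftrightarrow> u \<in> borel_measurable borel \<and> bounded (range u) \<and> integrable lborel u"

lemma Lp_class_measurable [measurable_dest]: "Lp_class u \<Longrightarrow> u \<in> borel_measurable borel"
  by (simp add: Lp_class_def)

lemma Lp_class_bound:
  assumes "Lp_class u" shows "\<exists>B>0. \<forall>x. norm (u x) \<le> B"
  using assms unfolding Lp_class_def bounded_pos by auto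

lemma Lp_class_add: "Lp_class u \<Longrightarrow> Lp_class v \<Longrightarrow> Lp_class (\<lambda>x. u x + v x)"
  unfolding Lp_class_def by (auto intro: bounded_plus_comp)

lemma Lp_class_cmult: "Lp_class u \<Longrightarrow> Lp_class (\<lambda>x. c * u x)"
proof -
  assume u: "Lp_class u"
  obtain B where "B > 0" "\<And>x. norm (u x) \<le> B" using Lp_class_bound[OF u] by blast
  then have "norm (c * u x) \<le> norm c * B" for x
    by (simp add: norm_mult mult_left_mono)
  then have "bounded (range (\<lambda>x. c * u x))"
    unfolding bounded_iff by blast
  moreover have [measurable]: "u \<in> borel_measurable borel" using u by measurable
  ultimately show ?thesis using u by (simp add: Lp_class_def)
qed

lemma Lp_class_zero: "Lp_class (\<lambda>x. 0)"
  by (simp add: Lp_class_def)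

lemma Lp_class_sum: "(\<And>i. i \<in> I \<Longrightarrow> Lp_class (u i)) \<Longrightarrow> Lp_class (\<lambda>x. \<Sum>i\<in>I. u i x)"
  by (induction I rule: infinite_finite_induct) (auto intro: Lp_class_add Lp_class_zero)

lemma Lp_class_powr_integrable:
  assumes u: "Lp_class u" and r: "r \<ge> 1"
  shows "integrable lborel (\<lambda>x. norm (u x) powr r)"
proof -
  obtain B where B: "B > 0" "\<And>x. norm (u x) \<le> B" using Lp_class_bound[OF u] by blast
  have "norm (u x) powr r \<le> B powr (r - 1) * norm (u x)" for x
  proof -
    have "norm (u x) powr r = norm (u x) powr (r - 1) * norm (u x)"
      by (simp add: powr_mult_base mult.commute)
    also have "\<dots> \<le> B powr (r - 1) * norm (u x)"
      using B r by (intro mult_right_mono powr_mono2) auto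
    finally show ?thesis .
  qed
  moreover have "integrable lborel (\<lambda>x. B powr (r - 1) * norm (u x))"
    using u by (auto simp: Lp_class_def)
  moreover have "(\<lambda>x. norm (u x) powr r) \<in> borel_measurable lborel"
    using u by measurable
  ultimately show ?thesis
    by (elim Bochner_Integration.integrable_bound) (use B in \<open>simp_all add: abs_mult\<close>)
qed

lemma Lp_norm_nonneg [simp]: "Lp_norm p u \<ge> 0"
  by (simp add: Lp_norm_def)

lemma ennreal_ge_1_cases:
  assumes "(p::ennreal) \<ge> 1"
  obtains "p = \<infinity>" | "p \<noteq> \<infinity>" "enn2real p \<ge> 1"
  using assms enn2real_mono[of 1 p] by (cases "p = \<infinity>") (auto simp: less_top)

lemma Lp_norm_infinity_AE:
  assumes u: "Lp_class u"
  shows "AE x in lborel. norm (u x) \<le> Lp_norm \<infinity> u"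
proof -
  have [measurable]: "u \<in> borel_measurable borel" using u by measurable
  obtain B where B: "B > 0" "\<And>x. norm (u x) \<le> B" using Lp_class_bound[OF u] by blast
  have "esssup lborel (\<lambda>x. ennreal (norm (u x))) \<le> ennreal B"
    using B by (intro esssup_I AE_I2) (auto intro: ennreal_leI)
  \<comment> \<open>The bound \<open>B\<close> makes the essential supremum finite, so
    \<open>enn2real\<close> does not collapse it to 0.\<close>
  then have "ennreal (Lp_norm \<infinity> u) = esssup lborel (\<lambda>x. ennreal (norm (u x)))"
    using le_less_trans[OF _ ennreal_less_top] by (simp add: Lp_norm_def)
  then show ?thesis
    using esssup_AE[of "\<lambda>x. ennreal (norm (u x))" lborel]
    by (auto elim!: eventually_mono simp flip: \<open>ennreal (Lp_norm \<infinity> u) = _\<close>)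
qed

lemma Lp_norm_infinity_le:
  assumes [measurable]: "u \<in> borel_measurable borel" and "c \<ge> 0" "AE x in lborel. norm (u x) \<le> c"
  shows "Lp_norm \<infinity> u \<le> c"
proof -
  have "esssup lborel (\<lambda>x. ennreal (norm (u x))) \<le> ennreal c"
    using assms(3) by (intro esssup_I) (auto intro: ennreal_leI elim!: eventually_mono)
  then show ?thesis
    using \<open>c \<ge> 0\<close> by (simp add: Lp_norm_def enn2real_leI)
qed

lemma Lp_norm_finite_le:
  assumes "p \<noteq> \<infinity>" "enn2real p \<ge> 1" "c \<ge> 0"
    and "(LINT x|lborel. norm (u x) powr enn2real p) \<le> c powr enn2real p"
  shows "Lp_norm p u \<le> c"
proof -
  have "(LINT x|lborel. norm (u x) powr enn2real p) powr (1 / enn2real p)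
      \<le> (c powr enn2real p) powr (1 / enn2real p)"
    using assms by (intro powr_mono2) (auto intro!: integral_nonneg_AE)
  also have "\<dots> = c" using assms by (simp add: powr_powr)
  finally show ?thesis using assms by (simp add: Lp_norm_def)
qed

lemma Lp_norm_powr:
  assumes "p \<noteq> \<infinity>" "enn2real p \<ge> 1"
  shows "Lp_norm p u powr enn2real p = (LINT x|lborel. norm (u x) powr enn2real p)"
  using assms by (simp add: Lp_norm_def powr_powr integral_nonneg_AE)

lemma Lp_norm_triangle:
  assumes p: "p \<ge> 1" and u: "Lp_class u" and v: "Lp_class v"
  shows "Lp_norm p (\<lambda>x. u x + v x) \<le> Lp_norm p u + Lp_norm p v"
  using p
proof (cases rule: ennreal_ge_1_cases)
  case 1
  have "Lp_norm \<infinity> (\<lambda>x. u x + v x) \<le> Lp_norm \<infinity> u + Lp_norm \<infinity> v"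
  proof (rule Lp_norm_infinity_le)
    show "AE x in lborel. norm (u x + v x) \<le> Lp_norm \<infinity> u + Lp_norm \<infinity> v"
      using Lp_norm_infinity_AE[OF u] Lp_norm_infinity_AE[OF v]
      by eventually_elim (rule order_trans[OF norm_triangle_ineq add_mono])
  qed (use u v in \<open>auto simp: Lp_class_def\<close>)
  with 1 show ?thesis by simp
next
  case 2
  define r where "r = enn2real p"
  have r: "r \<ge> 1" using 2 by (simp add: r_def)
  have "Lp_norm p (\<lambda>x. u x + v x) \<le> (Lp_norm p u + Lp_norm p v) + \<epsilon>" if "\<epsilon> > 0" for \<epsilon>
  proof -
    \<comment> \<open>Adding \<open>\<epsilon> / 2\<close> makes both numbers positive, so that they
      can serve as divisors even if a norm vanishes.\<close>
    define a b where "a = Lp_norm p u + \<epsilon> / 2" and "b = Lp_norm p v + \<epsilon> / 2"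
    have ab: "a > 0" "b > 0"
      using that by (auto simp: a_def b_def intro: add_nonneg_pos)
    note int = Lp_class_powr_integrable[OF u r] Lp_class_powr_integrable[OF v r]
    have le1: "(LINT x|lborel. norm (u x) powr r) \<le> a powr r"
      unfolding r_def Lp_norm_powr[OF 2, symmetric] using that r by (intro powr_mono2) (auto simp: a_def r_def)
    have le2: "(LINT x|lborel. norm (v x) powr r) \<le> b powr r"
      unfolding r_def Lp_norm_powr[OF 2, symmetric] using that r by (intro powr_mono2) (auto simp: b_def r_def)
    let ?g = "\<lambda>x. (a + b) powr r * (a / (a + b) * (norm (u x) powr r / a powr r)
                + b / (a + b) * (norm (v x) powr r / b powr r))"
    have "(LINT x|lborel. norm (u x + v x) powr r) \<le> (LINT x|lborel. ?g x)"
    proof (rule integral_mono)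
      show "integrable lborel (\<lambda>x. norm (u x + v x) powr r)"
        using Lp_class_powr_integrable[OF Lp_class_add[OF u v] r] .
      fix x
      have "norm (u x + v x) powr r \<le> (norm (u x) + norm (v x)) powr r"
        using r by (intro powr_mono2 norm_triangle_ineq) auto
      also have "\<dots> \<le> ?g x"
        using powr_convex_combination[of a b "norm (u x)" "norm (v x)" r] ab r by (simp add: powr_divide)
      finally show "norm (u x + v x) powr r \<le> ?g x" .
    qed (use int in auto)
    also have "\<dots> = (a + b) powr r * (a / (a + b) * ((LINT x|lborel. norm (u x) powr r) / a powr r)
                + b / (a + b) * ((LINT x|lborel. norm (v x) powr r) / b powr r))"
      using int by simp
    also have "\<dots> \<le> (a + b) powr r * (a / (a + b) * 1 + b / (a + b) * 1)"
      using ab le1 le2 by (intro mult_left_mono add_mono) auto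
    also have "\<dots> = (a + b) powr r"
      using ab by (simp flip: add_divide_distrib)
    finally have "Lp_norm p (\<lambda>x. u x + v x) \<le> a + b"
      using ab 2 by (intro Lp_norm_finite_le) (auto simp: r_def)
    then show ?thesis by (simp add: a_def b_def)
  qed
  then show ?thesis by (rule field_le_epsilon)
qed

lemma Lp_norm_cmult_le:
  assumes p: "p \<ge> 1" and u: "Lp_class u"
  shows "Lp_norm p (\<lambda>x. c * u x) \<le> norm c * Lp_norm p u"
  using p
proof (cases rule: ennreal_ge_1_cases)
  case 1
  have "Lp_norm \<infinity> (\<lambda>x. c * u x) \<le> norm c * Lp_norm \<infinity> u"
  proof (rule Lp_norm_infinity_le)
    show "AE x in lborel. norm (c * u x) \<le> norm c * Lp_norm \<infinity> u"
      using Lp_norm_infinity_AE[OF u] by eventually_elim (simp add: norm_mult mult_left_mono)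
  qed (use u in \<open>auto simp: Lp_class_def\<close>)
  with 1 show ?thesis by simp
next
  case 2
  then show ?thesis
    by (intro Lp_norm_finite_le) (simp_all add: norm_mult powr_mult Lp_norm_powr)
qed

lemma Lp_norm_sum:
  fixes u :: "'i \<Rightarrow> real^'n::finite \<Rightarrow> complex"
  assumes p: "p \<ge> 1" and "\<And>i. i \<in> I \<Longrightarrow> Lp_class (u i)"
  shows "Lp_norm p (\<lambda>x. \<Sum>i\<in>I. u i x) \<le> (\<Sum>i\<in>I. Lp_norm p (u i))"
proof -
  have "Lp_norm p (\<lambda>x :: real^'n. 0) \<le> 0"
    using Lp_norm_cmult_le[OF p Lp_class_zero, of 0] by simp
  then have "Lp_norm p (\<lambda>x :: real^'n. 0) = 0"
    by (rule antisym) simp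
  then show ?thesis
    using assms(2)
  proof (induction I rule: infinite_finite_induct)
    case (insert i I)
    then show ?case
      using Lp_norm_triangle[OF p, of "u i" "\<lambda>x. \<Sum>i\<in>I. u i x"] by (fastforce intro: Lp_class_sum)
  qed simp_all
qed

section \<open>Test functions as members of \<open>Lp_class\<close>\<close>

lemma test_bounded:
  assumes f: "f \<in> test_functions" shows "\<exists>B>0. \<forall>x. norm (f x) \<le> B"
proof -
  let ?S = "closure {x. f x \<noteq> 0}"
  have "compact (f ` ?S)"
    using f test_continuous[OF f] by (auto simp: test_functions_def intro: compact_continuous_image)
  then obtain B where B: "B > 0" "\<And>x. x \<in> ?S \<Longrightarrow> norm (f x) \<le> B"
    by (auto dest!: compact_imp_bounded simp: bounded_pos)
  have "norm (f x) \<le> B" for x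
    using B closure_subset[of "{x. f x \<noteq> 0}"] by (cases "f x = 0") auto
  with B(1) show ?thesis by blast
qed

lemma test_integrable:
  assumes f: "f \<in> test_functions" shows "integrable lborel f"
proof -
  let ?S = "closure {x. f x \<noteq> 0}"
  have "integrable lborel (\<lambda>x. indicator ?S x *\<^sub>R f x)"
    using f test_continuous[OF f] by (auto simp: test_functions_def intro: borel_integrable_compact)
  moreover have "(\<lambda>x. indicator ?S x *\<^sub>R f x) = f"
    using closure_subset[of "{x. f x \<noteq> 0}"] by (auto simp: fun_eq_iff indicator_def)
  ultimately show ?thesis by simp
qed

lemma test_Lp_class:
  assumes f: "f \<in> test_functions" shows "Lp_class f"
  unfolding Lp_class_def using test_integrable[OF f] test_measurable[OF f] test_bounded[OF f]
  by (auto simp: bounded_iff)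

text \<open>By continuity the set where the bound holds is closed, and it has full measure, so it is
  everything. A pointwise bound can be inserted into averages along an arbitrary map
  \<open>\<tau>\<close>.\<close>

lemma test_norm_le_Lp_norm_infinity:
  assumes f: "f \<in> test_functions"
  shows "norm (f x) \<le> Lp_norm \<infinity> f"
proof -
  let ?C = "{x. norm (f x) \<le> Lp_norm \<infinity> f}"
  have "closed ?C"
    using test_continuous[OF f] by (intro closed_Collect_le continuous_intros) auto
  moreover have "AE x in lebesgue. x \<in> ?C"
    using Lp_norm_infinity_AE[OF test_Lp_class[OF f]] by (auto dest: AE_completion)
  ultimately show ?thesis
    using mem_closed_if_AE_lebesgue[of ?C x] by auto
qed

section \<open>Averages of translates\<close>

lemma nn_integral_translate:
  fixes c :: "'a::euclidean_space"
  assumes [measurable]: "f \<in> borel_measurable borel"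
  shows "(\<integral>\<^sup>+x. f (x - c) \<partial>lborel) = (\<integral>\<^sup>+x. f x \<partial>lborel)"
  by (subst (2) lborel_distr_plus[of "-c", symmetric]) (simp add: nn_integral_distr)

text \<open>Jensen's inequality for the weight \<open>norm (k w)\<close>, then Tonelli and
  translation invariance. The general measure \<open>M\<close> covers convolutions, integrals over
  pairs of a radius and a point, and single translates.\<close>

lemma nn_integral_average_powr:
  fixes k :: "'w \<Rightarrow> complex" and u :: "real^'n::finite \<Rightarrow> complex"
  assumes M: "sigma_finite_measure M" and k: "integrable M k" and [measurable]: "\<tau> \<in> M \<rightarrow>\<^sub>M borel"
    and u: "Lp_class u" and r: "r \<ge> 1"
  shows "(\<integral>\<^sup>+x. ennreal (norm (LINT w|M. k w * u (x - \<tau> w)) powr r) \<partial>lborel)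
    \<le> ennreal ((LINT w|M. norm (k w)) powr r * (LINT x|lborel. norm (u x) powr r))"
proof -
  interpret sigma_finite_measure M by fact
  interpret pair_sigma_finite M lborel ..
  have [measurable]: "u \<in> borel_measurable borel" using u by measurable
  have [measurable]: "k \<in> borel_measurable M" using k by auto
  obtain B where B: "B > 0" "\<And>x. norm (u x) \<le> B" using Lp_class_bound[OF u] by blast
  define A where "A = (LINT w|M. norm (k w))"
  have A0: "A \<ge> 0" by (simp add: A_def)
  define H where "H x = (LINT w|M. norm (k w) * norm (u (x - \<tau> w)) powr r)" for x
  have int: "integrable M (\<lambda>w. norm (k w) * norm (u (x - \<tau> w)))" for x
  proof (rule Bochner_Integration.integrable_bound)
    show "integrable M (\<lambda>w. norm (k w) * B)" using k by auto
    show "AE w in M. norm (norm (k w) * norm (u (x - \<tau> w))) \<le> norm (norm (k w) * B)"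
      using B by (intro AE_I2) (auto simp: abs_mult intro!: mult_left_mono intro: order_trans)
  qed simp
  have intr: "integrable M (\<lambda>w. norm (k w) * norm (u (x - \<tau> w)) powr r)" for x
  proof (rule Bochner_Integration.integrable_bound)
    show "integrable M (\<lambda>w. norm (k w) * B powr r)" using k by auto
    show "AE w in M. norm (norm (k w) * norm (u (x - \<tau> w)) powr r) \<le> norm (norm (k w) * B powr r)"
      using B r by (intro AE_I2) (auto simp: abs_mult intro!: mult_left_mono powr_mono2)
  qed simp
  have H0: "H x \<ge> 0" for x by (simp add: H_def)
  have jensen: "norm (LINT w|M. k w * u (x - \<tau> w)) powr r \<le> A powr (r - 1) * H x" for x
  proof -
    define G where "G = (LINT w|M. norm (k w) * norm (u (x - \<tau> w)))"
    have "norm (LINT w|M. k w * u (x - \<tau> w)) \<le> G"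
      using integral_norm_bound[of M "\<lambda>w. k w * u (x - \<tau> w)"] by (simp add: G_def norm_mult)
    moreover have "G powr r \<le> A powr (r - 1) * H x"
    proof (cases "G = 0")
      case False
      have "G \<le> (LINT w|M. norm (k w) * B)"
        unfolding G_def using k B by (intro integral_mono int) (auto intro!: mult_left_mono)
      then have GA: "G \<le> A * B" by (simp add: A_def)
      have "G \<ge> 0" by (simp add: G_def)
      with False have G: "G > 0" by simp
      with GA B have A: "A > 0" by (metis less_le_trans zero_less_mult_pos2)
      \<comment> \<open>The tangent point is the weighted mean of the translates of
        \<open>norm u\<close>, as in the usual proof of Jensen's inequality.\<close>
      define s where "s = G / A"
      have s: "s > 0" using G A by (simp add: s_def)
      have "r * s powr (r - 1) * G = (LINT w|M. norm (k w) * (r * s powr (r - 1) * norm (u (x - \<tau> w))))"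
        unfolding G_def by (subst integral_mult_right_zero[symmetric]) (simp add: mult_ac)
      also have "\<dots> \<le> (LINT w|M. norm (k w) * (norm (u (x - \<tau> w)) powr r + (r - 1) * s powr r))"
      proof (rule integral_mono)
        show "integrable M (\<lambda>w. norm (k w) * (r * s powr (r - 1) * norm (u (x - \<tau> w))))"
          using integrable_mult_right[OF int[of x], of "r * s powr (r - 1)"] by (simp add: mult_ac)
        show "integrable M (\<lambda>w. norm (k w) * (norm (u (x - \<tau> w)) powr r + (r - 1) * s powr r))"
          using intr[of x] k by (simp add: distrib_left)
      qed (intro mult_left_mono young_tangent s r, auto)
      also have "\<dots> = H x + (r - 1) * s powr r * A"
        using intr[of x] k by (simp add: distrib_left H_def A_def mult_ac)
      finally have "r * s powr (r - 1) * G \<le> H x + (r - 1) * s powr r * A" .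
      moreover have "s powr (r - 1) * G = s powr r * A"
        using powr_mult_base[of s "r - 1"] s A by (simp add: s_def field_simps)
      ultimately have "r * (s powr r * A) \<le> H x + (r - 1) * (s powr r * A)"
        by (metis mult.assoc)
      then have "s powr r * A \<le> H x" by (simp add: left_diff_distrib)
      then have "A powr (r - 1) * (s powr r * A) \<le> A powr (r - 1) * H x"
        by (rule mult_left_mono) auto
      moreover have "A powr (r - 1) * (s powr r * A) = G powr r"
        using A G by (simp add: s_def powr_divide powr_diff)
      ultimately show ?thesis by simp
    qed (use r H0 in auto)
    ultimately show ?thesis
      using r by (meson norm_ge_zero order_trans powr_mono2 zero_le_one)
  qed
  have "(\<integral>\<^sup>+x. ennreal (norm (LINT w|M. k w * u (x - \<tau> w)) powr r) \<partial>lborel)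
      \<le> (\<integral>\<^sup>+x. ennreal (A powr (r - 1)) * (\<integral>\<^sup>+w. ennreal (norm (k w) * norm (u (x - \<tau> w)) powr r) \<partial>M) \<partial>lborel)"
  proof (rule nn_integral_mono)
    fix x
    have "ennreal (A powr (r - 1) * H x)
        = ennreal (A powr (r - 1)) * (\<integral>\<^sup>+w. ennreal (norm (k w) * norm (u (x - \<tau> w)) powr r) \<partial>M)"
      unfolding H_def by (subst nn_integral_eq_integral[OF intr]) (auto simp: ennreal_mult integral_nonneg_AE)
    then show "ennreal (norm (LINT w|M. k w * u (x - \<tau> w)) powr r)
        \<le> ennreal (A powr (r - 1)) * (\<integral>\<^sup>+w. ennreal (norm (k w) * norm (u (x - \<tau> w)) powr r) \<partial>M)"
      using jensen[of x] by (metis ennreal_leI)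
  qed
  also have "\<dots> = ennreal (A powr (r - 1)) * (\<integral>\<^sup>+x. (\<integral>\<^sup>+w. ennreal (norm (k w) * norm (u (x - \<tau> w)) powr r) \<partial>M) \<partial>lborel)"
    by (rule nn_integral_cmult) measurable
  also have "(\<integral>\<^sup>+x. (\<integral>\<^sup>+w. ennreal (norm (k w) * norm (u (x - \<tau> w)) powr r) \<partial>M) \<partial>lborel)
      = (\<integral>\<^sup>+w. (\<integral>\<^sup>+x. ennreal (norm (k w) * norm (u (x - \<tau> w)) powr r) \<partial>lborel) \<partial>M)"
    by (rule Fubini') measurable
  also have "\<dots> = (\<integral>\<^sup>+w. ennreal (norm (k w)) * (\<integral>\<^sup>+x. ennreal (norm (u x) powr r) \<partial>lborel) \<partial>M)"
  proof (rule nn_integral_cong)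
    fix w
    have "(\<integral>\<^sup>+x. ennreal (norm (k w) * norm (u (x - \<tau> w)) powr r) \<partial>lborel)
        = ennreal (norm (k w)) * (\<integral>\<^sup>+x. ennreal (norm (u (x - \<tau> w)) powr r) \<partial>lborel)"
      by (simp add: ennreal_mult nn_integral_cmult)
    also have "(\<integral>\<^sup>+x. ennreal (norm (u (x - \<tau> w)) powr r) \<partial>lborel) = (\<integral>\<^sup>+x. ennreal (norm (u x) powr r) \<partial>lborel)"
      by (rule nn_integral_translate) measurable
    finally show "(\<integral>\<^sup>+x. ennreal (norm (k w) * norm (u (x - \<tau> w)) powr r) \<partial>lborel)
        = ennreal (norm (k w)) * (\<integral>\<^sup>+x. ennreal (norm (u x) powr r) \<partial>lborel)" .
  qed
  also have "\<dots> = ennreal A * (LINT x|lborel. norm (u x) powr r)"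
    using k Lp_class_powr_integrable[OF u r]
    by (simp add: nn_integral_multc nn_integral_eq_integral A_def)
  also have "ennreal (A powr (r - 1)) * \<dots> = ennreal (A powr r * (LINT x|lborel. norm (u x) powr r))"
    using A0 by (simp add: ennreal_mult[symmetric] powr_mult_base mult.assoc[symmetric] mult.commute[of "A powr (r - 1)"])
  finally show ?thesis by (simp add: A_def)
qed

lemma Lp_class_average:
  fixes k :: "'w \<Rightarrow> complex" and u :: "real^'n::finite \<Rightarrow> complex"
  assumes M: "sigma_finite_measure M" and k: "integrable M k" and [measurable]: "\<tau> \<in> M \<rightarrow>\<^sub>M borel"
    and u: "Lp_class u"
  shows "Lp_class (\<lambda>x. LINT w|M. k w * u (x - \<tau> w))"
proof -
  interpret sigma_finite_measure M by fact
  have [measurable]: "u \<in> borel_measurable borel" using u by measurable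
  have [measurable]: "k \<in> borel_measurable M" using k by auto
  obtain B where B: "B > 0" "\<And>x. norm (u x) \<le> B" using Lp_class_bound[OF u] by blast
  have meas: "(\<lambda>x. LINT w|M. k w * u (x - \<tau> w)) \<in> borel_measurable borel"
    by measurable
  have "norm (LINT w|M. k w * u (x - \<tau> w)) \<le> (LINT w|M. norm (k w) * B)" for x
    using k B by (intro integral_norm_le_of_bound) (auto simp: norm_mult intro!: mult_left_mono)
  then have "bounded (range (\<lambda>x. LINT w|M. k w * u (x - \<tau> w)))"
    unfolding bounded_iff by blast
  \<comment> \<open>The case of exponent 1 of the preceding estimate gives a finite
    integral.\<close>
  moreover have "integrable lborel (\<lambda>x. LINT w|M. k w * u (x - \<tau> w))"
    using nn_integral_average_powr[OF assms order_refl] meas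
    by (auto simp: integrable_iff_bounded top_unique less_top[symmetric])
  ultimately show ?thesis
    using meas by (simp add: Lp_class_def)
qed

text \<open>The constant is the mass of the kernel for every \<open>p\<close>, including 1 and
  infinity. All analytic estimates below reduce to this one, applied to explicit integrable
  kernels.\<close>

lemma Lp_norm_average:
  fixes k :: "'w \<Rightarrow> complex" and u :: "real^'n::finite \<Rightarrow> complex"
  assumes p: "p \<ge> 1"
    and M: "sigma_finite_measure M" and k: "integrable M k" and \<tau> [measurable]: "\<tau> \<in> M \<rightarrow>\<^sub>M borel"
    and u: "u \<in> test_functions"
  shows "Lp_norm p (\<lambda>x. LINT w|M. k w * u (x - \<tau> w)) \<le> (LINT w|M. norm (k w)) * Lp_norm p u"
  using p
proof (cases rule: ennreal_ge_1_cases)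
  case 1
  interpret sigma_finite_measure M by fact
  have [measurable]: "u \<in> borel_measurable borel" using u by measurable
  have [measurable]: "k \<in> borel_measurable M" using k by auto
  have "Lp_norm \<infinity> (\<lambda>x. LINT w|M. k w * u (x - \<tau> w)) \<le> (LINT w|M. norm (k w) * Lp_norm \<infinity> u)"
  proof (rule Lp_norm_infinity_le)
    show "AE x in lborel. norm (LINT w|M. k w * u (x - \<tau> w)) \<le> (LINT w|M. norm (k w) * Lp_norm \<infinity> u)"
      using k test_norm_le_Lp_norm_infinity[OF u]
      by (intro AE_I2 integral_norm_le_of_bound) (auto simp: norm_mult intro!: mult_left_mono)
  qed (auto intro!: integral_nonneg_AE)
  with 1 show ?thesis by simp
next
  case 2
  let ?A = "LINT w|M. norm (k w)"
  note cl = test_Lp_class[OF u]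
  let ?F = "\<lambda>x. LINT w|M. k w * u (x - \<tau> w)"
  show ?thesis
  proof (rule Lp_norm_finite_le[OF 2])
    have "ennreal (LINT x|lborel. norm (?F x) powr enn2real p) = (\<integral>\<^sup>+x. ennreal (norm (?F x) powr enn2real p) \<partial>lborel)"
      using Lp_class_powr_integrable[OF Lp_class_average[OF M k \<tau> cl] 2(2)]
      by (intro nn_integral_eq_integral[symmetric]) auto
    also have "\<dots> \<le> ennreal (?A powr enn2real p * (LINT x|lborel. norm (u x) powr enn2real p))"
      by (rule nn_integral_average_powr[OF M k \<tau> cl 2(2)])
    finally have "(LINT x|lborel. norm (?F x) powr enn2real p) \<le> ?A powr enn2real p * (LINT x|lborel. norm (u x) powr enn2real p)"
      by (subst (asm) ennreal_le_iff) (auto intro!: mult_nonneg_nonneg integral_nonneg_AE)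
    then show "(LINT x|lborel. norm (?F x) powr enn2real p) \<le> (?A * Lp_norm p u) powr enn2real p"
      by (simp add: powr_mult Lp_norm_powr[OF 2])
  qed auto
qed

section \<open>Integration on \<open>real ^ 'n\<close> and polynomial functions\<close>

lemma nn_integral_affine:
  fixes t :: "'a::euclidean_space"
  assumes [measurable]: "f \<in> borel_measurable borel" and c: "c \<noteq> 0"
  shows "(\<integral>\<^sup>+x. f x \<partial>lborel) = ennreal (\<bar>c\<bar> ^ DIM('a)) * (\<integral>\<^sup>+x. f (t + c *\<^sub>R x) \<partial>lborel)"
  by (subst lborel_affine[OF c, of t])
     (simp add: nn_integral_density nn_integral_distr nn_integral_cmult ennreal_power)

lemma integrable_affine:
  fixes f :: "'a::euclidean_space \<Rightarrow> 'b::{banach, second_countable_topology}"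
  assumes f: "integrable lborel f" and c: "c \<noteq> 0"
  shows "integrable lborel (\<lambda>x. f (t + c *\<^sub>R x))"
proof -
  have [measurable]: "f \<in> borel_measurable borel" using f by auto
  have "ennreal (\<bar>c\<bar> ^ DIM('a)) \<noteq> 0" using c by simp
  with f show ?thesis
    using nn_integral_affine[of "\<lambda>x. ennreal (norm (f x))" c t] c
    unfolding integrable_iff_bounded by (auto simp: ennreal_mult_less_top)
qed

lemma integral_affine:
  fixes f :: "'a::euclidean_space \<Rightarrow> 'b::{banach, second_countable_topology}"
  assumes f: "integrable lborel f" and c: "c \<noteq> 0"
  shows "(LINT x|lborel. f x) = \<bar>c\<bar> ^ DIM('a) *\<^sub>R (LINT x|lborel. f (t + c *\<^sub>R x))"
proof -
  have [measurable]: "f \<in> borel_measurable borel" using f by auto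
  show ?thesis
    using integrable_affine[OF f c, of t]
    by (subst lborel_affine[OF c, of t])
       (simp add: integral_density integral_distr ennreal_power)
qed

text \<open>Lebesgue measure on \<open>real^'n\<close> is the image of a product measure indexed by
  \<open>Basis\<close>; the map \<open>ix\<close> identifies basis vectors with coordinates, after
  which the product rule for integrals applies.\<close>

lemma
  fixes F :: "'n::finite \<Rightarrow> real \<Rightarrow> 'b::{real_normed_field, banach, second_countable_topology}"
  assumes f: "\<And>k. integrable lborel (F k)"
  shows integrable_lborel_prod_vec: "integrable lborel (\<lambda>x::real^'n. \<Prod>k\<in>UNIV. F k (x $ k) :: 'b)"
    and integral_lborel_prod_vec:
      "(LINT x|lborel. (\<Prod>k\<in>UNIV. F k ((x::real^'n) $ k))) = (\<Prod>k\<in>UNIV. (LINT t|lborel. F k t))"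
proof -
  interpret product_sigma_finite "\<lambda>_ :: real^'n. lborel :: real measure" ..
  let ?B = "Basis :: (real^'n) set"
  define ix where "ix = the_inv_into UNIV (\<lambda>k :: 'n. axis k (1::real))"
  have inj: "inj (\<lambda>k :: 'n. axis k (1::real))"
    by (auto simp: inj_on_def axis_eq_axis)
  have ix: "ix (axis k 1) = k" for k
    unfolding ix_def by (rule the_inv_into_f_f[OF inj UNIV_I])
  have B: "?B = range (\<lambda>k. axis k 1)"
    by (auto simp: Basis_vec_def)
  have prod: "(\<Prod>k\<in>UNIV. G k) = (\<Prod>b\<in>?B. G (ix b))" for G :: "'n \<Rightarrow> 'b"
    unfolding B by (subst prod.reindex[OF inj]) (simp add: ix)
  have comp: "(\<Sum>b\<in>?B. y b *\<^sub>R b) $ k = y (axis k 1)" for y and k :: 'n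
  proof -
    have "(\<Sum>b\<in>?B. y b *\<^sub>R b) $ k = (\<Sum>b\<in>?B. y b *\<^sub>R b) \<bullet> axis k 1"
      by (simp add: inner_axis)
    also have "\<dots> = y (axis k 1)" by (rule inner_sum_left_Basis) simp
    finally show ?thesis .
  qed
  have eq: "(\<Prod>k\<in>UNIV. F k ((\<Sum>b\<in>?B. y b *\<^sub>R b) $ k)) = (\<Prod>b\<in>?B. F (ix b) (y b))" for y
  proof -
    have "(\<Prod>k\<in>UNIV. F k ((\<Sum>b\<in>?B. y b *\<^sub>R b) $ k)) = (\<Prod>k\<in>UNIV. F k (y (axis k 1)))"
      by (simp only: comp)
    also have "\<dots> = (\<Prod>b\<in>?B. F (ix b) (y b))"
      unfolding B by (subst prod.reindex[OF inj]) (simp add: ix)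
    finally show ?thesis .
  qed
  have [measurable]: "F k \<in> borel_measurable borel" for k using f[of k] by auto
  have meas: "(\<lambda>x::real^'n. \<Prod>k\<in>UNIV. F k (x $ k)) \<in> borel_measurable borel"
    by measurable
  have T: "(\<lambda>y. \<Sum>b\<in>?B. y b *\<^sub>R b) \<in> (\<Pi>\<^sub>M b\<in>?B. lborel) \<rightarrow>\<^sub>M borel"
    by measurable
  show "integrable lborel (\<lambda>x::real^'n. \<Prod>k\<in>UNIV. F k (x $ k) :: 'b)"
    unfolding lborel_eq[where 'a="real^'n"] integrable_distr_eq[OF T meas] eq
    by (rule product_integrable_prod) (auto intro: f)
  show "(LINT x|lborel. (\<Prod>k\<in>UNIV. F k ((x::real^'n) $ k))) = (\<Prod>k\<in>UNIV. (LINT t|lborel. F k t))"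
    unfolding lborel_eq[where 'a="real^'n"] integral_distr[OF T meas] eq
    by (subst product_integral_prod) (auto intro: f simp: prod)
qed

text \<open>The integrable majorant used twice: for the weights in \<open>\<xi>\<close> and for the
  kernels in \<open>x\<close>.\<close>

lemma integrable_cauchy_density_vec:
  "integrable lborel (\<lambda>x::real^'n::finite. \<Prod>k\<in>UNIV. inverse (1 + (x $ k)\<^sup>2))"
  by (rule integrable_lborel_prod_vec)
     (use integrable_inverse_1_plus_square in \<open>simp add: set_integrable_def\<close>)

text \<open>By translation invariance \<open>G (x + axis k 1) - G x\<close> has integral 0. This
  difference is also the integral of the derivative over a unit segment, and by Fubini and
  translation invariance the total is the integral of \<open>partial_deriv k G\<close>.\<close>

lemma integral_partial_deriv_eq_0:
  fixes G :: "real^'n::finite \<Rightarrow> complex"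
  assumes diff: "\<And>x. G differentiable (at x)"
    and int: "integrable lborel G" "integrable lborel (partial_deriv k G)"
    and cont: "continuous_on UNIV (partial_deriv k G)"
  shows "(LINT x|lborel. partial_deriv k G x) = 0"
proof -
  let ?e = "axis k 1 :: real^'n" and ?G' = "partial_deriv k G"
  have [measurable]: "?G' \<in> borel_measurable borel" using int by auto
  have tr: "integrable lborel (\<lambda>x. h (x + c))" "(LINT x|lborel. h (x + c)) = (LINT x|lborel. h x)"
    if "integrable lborel h" for h :: "real^'n \<Rightarrow> complex" and c
    using integrable_affine[OF that, of 1 c] integral_affine[OF that, of 1 c] by (simp_all add: add.commute)
  have trn: "(LINT x|lborel. norm (?G' (x + c))) = (LINT x|lborel. norm (?G' x))" for c
    using integral_affine[OF integrable_norm[OF int(2)], of 1 c] by (simp add: add.commute)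
  have pair: "integrable (lborel \<Otimes>\<^sub>M lborel) (\<lambda>(s, x). indicator {0..1::real} s *\<^sub>R ?G' (x + s *\<^sub>R ?e))"
  proof (rule lborel_pair.Fubini_integrable)
    show "integrable lborel (\<lambda>s. LINT x|lborel. norm (case (s, x) of (s, x) \<Rightarrow> indicator {0..1::real} s *\<^sub>R ?G' (x + s *\<^sub>R ?e)))"
      by (simp add: trn)
    show "AE s in lborel. integrable lborel (\<lambda>x. case (s, x) of (s, x) \<Rightarrow> indicator {0..1::real} s *\<^sub>R ?G' (x + s *\<^sub>R ?e))"
      using tr(1)[OF int(2)] by (intro AE_I2) simp
  qed measurable
  have "0 = (LINT x|lborel. G (x + ?e) - G x)"
    using tr[OF int(1)] int(1) by simp
  also have "\<dots> = (LINT x|lborel. LINT s|lborel. indicator {0..1::real} s *\<^sub>R ?G' (x + s *\<^sub>R ?e))"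
  proof (rule Bochner_Integration.integral_cong)
    fix x
    have "(LINT s|lborel. indicator {0..1::real} s *\<^sub>R ?G' (x + s *\<^sub>R ?e)) = G (x + 1 *\<^sub>R ?e) - G (x + 0 *\<^sub>R ?e)"
    proof (rule integral_FTC_Icc)
      show "((\<lambda>s. G (x + s *\<^sub>R ?e)) has_vector_derivative ?G' (x + s *\<^sub>R ?e)) (at s within {0..1})" for s
        unfolding partial_deriv_def by (rule has_vector_derivative_along_line[OF diff])
      show "continuous_on {0..1} (\<lambda>s. ?G' (x + s *\<^sub>R ?e))"
        by (rule continuous_on_compose2[OF cont]) (auto intro!: continuous_intros)
    qed simp
    then show "G (x + ?e) - G x = (LINT s|lborel. indicator {0..1::real} s *\<^sub>R ?G' (x + s *\<^sub>R ?e))"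
      by simp
  qed simp
  also have "\<dots> = (LINT s|lborel. LINT x|lborel. indicator {0..1::real} s *\<^sub>R ?G' (x + s *\<^sub>R ?e))"
    using lborel_pair.Fubini_integral[OF pair] by simp
  also have "\<dots> = (LINT x|lborel. ?G' x)"
    using tr(2)[OF int(2)] by simp
  finally show ?thesis ..
qed

section \<open>Polynomial functions\<close>

inductive poly_fun :: "(real^'n::finite \<Rightarrow> complex) \<Rightarrow> bool" where
  poly_fun_const: "poly_fun (\<lambda>_. c)"
| poly_fun_coord: "poly_fun (\<lambda>\<xi>. of_real (\<xi> $ k))"
| poly_fun_add: "poly_fun p \<Longrightarrow> poly_fun q \<Longrightarrow> poly_fun (\<lambda>\<xi>. p \<xi> + q \<xi>)"
| poly_fun_mult: "poly_fun p \<Longrightarrow> poly_fun q \<Longrightarrow> poly_fun (\<lambda>\<xi>. p \<xi> * q \<xi>)"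

lemma poly_fun_cmult: "poly_fun p \<Longrightarrow> poly_fun (\<lambda>\<xi>. c * p \<xi>)"
  by (intro poly_fun_mult poly_fun_const)

lemma poly_fun_diff: "poly_fun p \<Longrightarrow> poly_fun q \<Longrightarrow> poly_fun (\<lambda>\<xi>. p \<xi> - q \<xi>)"
  using poly_fun_add[of p "\<lambda>\<xi>. - 1 * q \<xi>"] poly_fun_cmult[of q "- 1"] by simp

lemma poly_fun_sum: "(\<And>i. i \<in> I \<Longrightarrow> poly_fun (p i)) \<Longrightarrow> poly_fun (\<lambda>\<xi>. \<Sum>i\<in>I. p i \<xi>)"
  by (induction I rule: infinite_finite_induct) (auto intro: poly_fun.intros)

lemma poly_fun_prod: "(\<And>i. i \<in> I \<Longrightarrow> poly_fun (p i)) \<Longrightarrow> poly_fun (\<lambda>\<xi>. \<Prod>i\<in>I. p i \<xi>)"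
  by (induction I rule: infinite_finite_induct) (auto intro: poly_fun.intros)

lemma poly_fun_power: "poly_fun p \<Longrightarrow> poly_fun (\<lambda>\<xi>. p \<xi> ^ m)"
  by (induction m) (auto intro: poly_fun.intros)

lemma poly_fun_cnj: "poly_fun p \<Longrightarrow> poly_fun (\<lambda>\<xi>. cnj (p \<xi>))"
  by (induction rule: poly_fun.induct) (auto intro: poly_fun.intros)

lemma poly_fun_monom: "poly_fun (monom_fun \<alpha>)"
  unfolding monom_fun_def by (intro poly_fun_prod poly_fun_power poly_fun_coord)

lemma poly_fun_principal_symbol: "poly_fun (principal_symbol m T)"
  unfolding principal_symbol_monom[abs_def] by (intro poly_fun_sum poly_fun_cmult poly_fun_monom)

lemma has_derivative_coord:
  "((\<lambda>\<xi>. complex_of_real (\<xi> $ k)) has_derivative (\<lambda>h. of_real (h $ k))) (at x)"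
  by (intro has_derivative_of_real bounded_linear_imp_has_derivative bounded_linear_vec_nth)

lemma poly_fun_differentiable:
  assumes "poly_fun p" shows "p differentiable (at x)"
  using assms
  by (induction rule: poly_fun.induct) (auto intro: differentiableI[OF has_derivative_coord])

lemma poly_fun_continuous: "poly_fun p \<Longrightarrow> continuous_on S p"
  by (simp add: continuous_at_imp_continuous_on differentiable_imp_continuous_within poly_fun_differentiable)

lemma poly_fun_measurable [measurable_dest]: "poly_fun p \<Longrightarrow> p \<in> borel_measurable borel"
  by (intro borel_measurable_continuous_onI poly_fun_continuous)

lemma poly_fun_partial_deriv:
  assumes "poly_fun p" shows "poly_fun (partial_deriv k p)"
  using assms
proof (induction rule: poly_fun.induct)
  case (poly_fun_const c)
  have "partial_deriv k (\<lambda>_. c) = (\<lambda>_ :: real^'a. 0)"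
    by (rule ext, subst partial_deriv_eq[OF has_derivative_const]) simp
  then show ?case by (simp add: poly_fun.poly_fun_const)
next
  case (poly_fun_coord j)
  have "partial_deriv k (\<lambda>\<xi>. of_real (\<xi> $ j)) = (\<lambda>_. of_real (axis k 1 $ j))"
    by (rule ext, subst partial_deriv_eq[OF has_derivative_coord]) simp
  then show ?case by (simp add: poly_fun.poly_fun_const)
next
  case (poly_fun_add p q)
  have "partial_deriv k (\<lambda>\<xi>. p \<xi> + q \<xi>) = (\<lambda>\<xi>. partial_deriv k p \<xi> + partial_deriv k q \<xi>)"
    using poly_fun_add by (auto simp: partial_deriv_add poly_fun_differentiable)
  with poly_fun_add show ?case by (simp add: poly_fun.poly_fun_add)
next
  case (poly_fun_mult p q)
  have "partial_deriv k (\<lambda>\<xi>. p \<xi> * q \<xi>) = (\<lambda>\<xi>. p \<xi> * partial_deriv k q \<xi> + partial_deriv k p \<xi> * q \<xi>)"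
    using poly_fun_mult by (auto simp: partial_deriv_mult poly_fun_differentiable)
  with poly_fun_mult show ?case by (simp add: poly_fun.intros)
qed

lemma poly_fun_growth:
  assumes "poly_fun p" shows "\<exists>C M. C \<ge> 0 \<and> (\<forall>\<xi>. norm (p \<xi>) \<le> C * (1 + norm \<xi>) ^ M)"
  using assms
proof (induction rule: poly_fun.induct)
  case (poly_fun_const c)
  show ?case by (rule exI[of _ "norm c"], rule exI[of _ 0]) simp
next
  case (poly_fun_coord k)
  have "norm (complex_of_real (\<xi> $ k)) \<le> 1 * (1 + norm \<xi>) ^ 1" for \<xi> :: "real^'a"
    using component_le_norm_cart[of \<xi> k] by simp
  then show ?case by (intro exI[of _ 1] exI[of _ "1::nat"]) simp
next
  case (poly_fun_add p q)
  then obtain C M D N where p: "C \<ge> 0" "\<And>\<xi>. norm (p \<xi>) \<le> C * (1 + norm \<xi>) ^ M"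
    and q: "D \<ge> 0" "\<And>\<xi>. norm (q \<xi>) \<le> D * (1 + norm \<xi>) ^ N" by blast
  have "norm (p \<xi> + q \<xi>) \<le> (C + D) * (1 + norm \<xi>) ^ max M N" for \<xi>
  proof -
    have "norm (p \<xi> + q \<xi>) \<le> C * (1 + norm \<xi>) ^ M + D * (1 + norm \<xi>) ^ N"
      by (rule order_trans[OF norm_triangle_ineq add_mono[OF p(2) q(2)]])
    also have "\<dots> \<le> C * (1 + norm \<xi>) ^ max M N + D * (1 + norm \<xi>) ^ max M N"
      using p(1) q(1) by (intro add_mono mult_left_mono power_increasing) auto
    finally show ?thesis by (simp add: distrib_right)
  qed
  with p(1) q(1) show ?case by (intro exI[of _ "C + D"] exI[of _ "max M N"]) auto
next
  case (poly_fun_mult p q)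
  then obtain C M D N where p: "C \<ge> 0" "\<And>\<xi>. norm (p \<xi>) \<le> C * (1 + norm \<xi>) ^ M"
    and q: "D \<ge> 0" "\<And>\<xi>. norm (q \<xi>) \<le> D * (1 + norm \<xi>) ^ N" by blast
  have "norm (p \<xi> * q \<xi>) \<le> (C * D) * (1 + norm \<xi>) ^ (M + N)" for \<xi>
  proof -
    have "norm (p \<xi> * q \<xi>) \<le> (C * (1 + norm \<xi>) ^ M) * (D * (1 + norm \<xi>) ^ N)"
      unfolding norm_mult using p q by (intro mult_mono) auto
    then show ?thesis by (simp add: power_add mult_ac)
  qed
  with p(1) q(1) show ?case by (intro exI[of _ "C * D"] exI[of _ "M + N"]) auto
qed

text \<open>Both sides are the derivative of \<open>p (s *\<^sub>R \<xi>)\<close> in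
  \<open>s\<close> at 1, once by the chain rule and once by homogeneity.\<close>

lemma poly_fun_euler:
  assumes p: "poly_fun p" and hom: "\<And>t \<xi>. p (t *\<^sub>R \<xi>) = of_real t ^ m * p \<xi>"
  shows "(\<Sum>k\<in>UNIV. of_real (\<xi> $ k) * partial_deriv k p \<xi>) = of_nat m * p \<xi>"
proof -
  have "((\<lambda>s. p (0 + s *\<^sub>R \<xi>)) has_vector_derivative frechet_derivative p (at (0 + 1 *\<^sub>R \<xi>)) \<xi>) (at 1)"
    by (rule has_vector_derivative_along_line) (rule poly_fun_differentiable[OF p])
  then have "((\<lambda>s. of_real s ^ m * p \<xi>) has_vector_derivative frechet_derivative p (at \<xi>) \<xi>) (at 1)"
    by (simp add: hom)
  moreover have "((\<lambda>s. of_real s ^ m * p \<xi>) has_vector_derivative of_nat m * p \<xi>) (at 1)"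
    by (rule has_vector_derivative_real_field)
       (auto intro!: derivative_eq_intros)
  ultimately have "frechet_derivative p (at \<xi>) \<xi> = of_nat m * p \<xi>"
    by (rule vector_derivative_unique_at)
  then show ?thesis
    by (simp add: frechet_derivative_partial_deriv poly_fun_differentiable[OF p])
qed

lemma power_le_fact_exp:
  assumes "(y::real) \<ge> 0" shows "y ^ M \<le> fact M * exp y"
proof -
  have "(\<Sum>n\<in>{M}. y ^ n /\<^sub>R fact n) \<le> exp y"
    unfolding exp_def using assms by (intro sum_le_suminf summable_exp_generic) auto
  then show ?thesis by (simp add: field_simps)
qed

section \<open>The kernels attached to an elliptic symbol\<close>

text \<open>Isolates what the kernel construction needs of the system: a real homogeneous
  polynomial, positive off the origin. It is instantiated below with \<open>Lsym\<close> in degree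
  \<open>2 * l\<close>.\<close>

locale elliptic_symbol =
  fixes L :: "real^'n::finite \<Rightarrow> real" and m :: nat
  assumes poly_L: "poly_fun (\<lambda>\<xi>. complex_of_real (L \<xi>))"
    and hom_L: "L (t *\<^sub>R \<xi>) = t ^ m * L \<xi>"
    and pos_L: "\<xi> \<noteq> 0 \<Longrightarrow> L \<xi> > 0"
    and m_pos: "m > 0"
begin

lemma L_0 [simp]: "L 0 = 0"
  using hom_L[of 0 0] m_pos by (simp add: power_0_left)

lemma L_nonneg: "L \<xi> \<ge> 0"
  by (cases "\<xi> = 0") (auto intro: less_imp_le pos_L)

lemma L_continuous: "continuous_on S L"
  using continuous_on_Re[OF poly_fun_continuous[OF poly_L]] by simp

lemma L_measurable [measurable]: "L \<in> borel_measurable borel"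
  by (intro borel_measurable_continuous_onI L_continuous)

text \<open>Take for \<open>c\<close> the minimum of \<open>L\<close> on the unit sphere and use
  homogeneity; inside the ball the left side is at most 0. Linear growth suffices, as its
  exponential beats every polynomial.\<close>

lemma L_lower_bound: "\<exists>c>0. \<forall>\<xi>. c * (norm \<xi> - 1) \<le> L \<xi>"
proof -
  have "\<exists>x\<in>sphere (0::real^'n) 1. \<forall>y\<in>sphere 0 1. L x \<le> L y"
    by (intro continuous_attains_inf L_continuous) auto
  then obtain x where x: "norm x = 1" "\<And>y. norm y = 1 \<Longrightarrow> L x \<le> L y" by auto
  have c: "L x > 0" using x(1) by (intro pos_L) auto
  have "L x * (norm \<xi> - 1) \<le> L \<xi>" for \<xi>
  proof (cases "norm \<xi> \<ge> 1")
    case True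
    then have \<xi>: "norm \<xi> > 0" by linarith
    have "norm \<xi> - 1 \<le> norm \<xi> ^ m"
      using self_le_power[OF True m_pos] by linarith
    then have "L x * (norm \<xi> - 1) \<le> norm \<xi> ^ m * L (\<xi> /\<^sub>R norm \<xi>)"
      using c \<xi> x(2)[of "\<xi> /\<^sub>R norm \<xi>"] True
      by (subst mult.commute) (intro mult_mono, auto)
    also have "\<dots> = L \<xi>"
      using \<xi> by (simp flip: hom_L)
    finally show ?thesis .
  next
    case False
    then have "L x * (norm \<xi> - 1) \<le> 0"
      using c by (intro mult_nonneg_nonpos) auto
    then show ?thesis using L_nonneg[of \<xi>] by linarith
  qed
  with c show ?thesis by blast
qed

definition E :: "real^'n \<Rightarrow> complex" where
  "E \<xi> = exp (- complex_of_real (L \<xi>))"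

lemma norm_E: "norm (E \<xi>) = exp (- L \<xi>)"
  by (simp add: E_def norm_exp_eq_Re)

lemma E_measurable [measurable]: "E \<in> borel_measurable borel"
  unfolding E_def by measurable

lemma weight_bounded:
  assumes "poly_fun q" shows "\<exists>B. \<forall>\<xi>. norm (q \<xi> * E \<xi>) \<le> B"
proof -
  obtain C M where q: "C \<ge> 0" "\<And>\<xi>. norm (q \<xi>) \<le> C * (1 + norm \<xi>) ^ M"
    using poly_fun_growth[OF assms] by blast
  obtain c where c: "c > 0" "\<And>\<xi>. c * (norm \<xi> - 1) \<le> L \<xi>"
    using L_lower_bound by blast
  have "norm (q \<xi> * E \<xi>) \<le> C * (fact M * exp (2 * c) / c ^ M)" for \<xi>
  proof -
    \<comment> \<open>One term of the exponential series bounds the polynomial factor; against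
      \<open>exp (- L \<xi>)\<close> only the constant \<open>exp (2 * c)\<close> is left
      over.\<close>
    have "(c * (1 + norm \<xi>)) ^ M \<le> fact M * exp (c * (1 + norm \<xi>))"
      using c(1) by (intro power_le_fact_exp) auto
    then have "(1 + norm \<xi>) ^ M \<le> fact M * exp (c * (1 + norm \<xi>)) / c ^ M"
      using c(1) unfolding power_mult_distrib by (simp add: pos_le_divide_eq mult.commute)
    then have "norm (q \<xi>) * exp (- L \<xi>) \<le> (C * (fact M * exp (c * (1 + norm \<xi>)) / c ^ M)) * exp (- (c * (norm \<xi> - 1)))"
      using q c(1) c(2)[of \<xi>]
      by (intro mult_mono order_trans[OF q(2)] mult_left_mono) (auto intro!: divide_nonneg_pos mult_nonneg_nonneg)
    also have "\<dots> = C * (fact M * (exp (c * (1 + norm \<xi>)) * exp (- (c * (norm \<xi> - 1)))) / c ^ M)"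
      by simp
    also have "exp (c * (1 + norm \<xi>)) * exp (- (c * (norm \<xi> - 1))) = exp (2 * c)"
      by (simp add: algebra_simps flip: exp_add)
    finally show ?thesis by (simp add: norm_mult norm_E)
  qed
  then show ?thesis by blast
qed

text \<open>Multiplying \<open>q\<close> by \<open>\<rho>\<close> gives a polynomial again, so
  boundedness of the new weight yields decay of the old one like
  \<open>inverse (\<rho> \<xi>)\<close>.\<close>

lemma weight_integrable:
  assumes q: "poly_fun q" shows "integrable lborel (\<lambda>\<xi>. q \<xi> * E \<xi>)"
proof -
  have [measurable]: "q \<in> borel_measurable borel" using q by measurable
  define \<rho> where "\<rho> \<xi> = (\<Prod>k\<in>UNIV. 1 + (\<xi> $ k)\<^sup>2)" for \<xi> :: "real^'n"
  have \<rho>: "\<rho> \<xi> > 0" for \<xi> unfolding \<rho>_def by (intro prod_pos) (auto intro: add_pos_nonneg)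
  have "poly_fun (\<lambda>\<xi>. of_real (\<rho> \<xi>) * q \<xi>)"
    unfolding \<rho>_def of_real_prod of_real_add of_real_power of_real_1
    by (intro poly_fun_mult poly_fun_prod poly_fun_add poly_fun_const poly_fun_power poly_fun_coord q)
  from weight_bounded[OF this] obtain B where B: "\<And>\<xi>. norm (of_real (\<rho> \<xi>) * q \<xi> * E \<xi>) \<le> B" by blast
  have inv: "inverse (\<rho> \<xi>) = (\<Prod>k\<in>UNIV. inverse (1 + (\<xi> $ k)\<^sup>2))" for \<xi>
    by (simp add: \<rho>_def prod_inversef[symmetric])
  show ?thesis
  proof (rule Bochner_Integration.integrable_bound)
    show "integrable lborel (\<lambda>\<xi>. B * inverse (\<rho> \<xi>))"
      unfolding inv by (intro integrable_mult_right integrable_cauchy_density_vec)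
    have "norm (q \<xi> * E \<xi>) \<le> B * inverse (\<rho> \<xi>)" for \<xi>
      using B[of \<xi>] \<rho>[of \<xi>] by (simp add: norm_mult field_simps)
    then show "AE \<xi> in lborel. norm (q \<xi> * E \<xi>) \<le> norm (B * inverse (\<rho> \<xi>))"
      by (intro AE_I2) (metis abs_ge_self order_trans real_norm_def)
  qed simp
qed

text \<open>The inverse Fourier transform of \<open>q \<xi> * E \<xi>\<close> without its
  normalising factor. For \<open>q = 1\<close> it is, up to a constant, the time 1 heat kernel of
  the operator with symbol \<open>L\<close>.\<close>

definition K :: "(real^'n \<Rightarrow> complex) \<Rightarrow> real^'n \<Rightarrow> complex" where
  "K q x = (LINT \<xi>|lborel. exp (\<i> * of_real (x \<bullet> \<xi>)) * (q \<xi> * E \<xi>))"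

lemma K_integrand_integrable:
  assumes q: "poly_fun q" shows "integrable lborel (\<lambda>\<xi>. exp (\<i> * of_real (x \<bullet> \<xi>)) * (q \<xi> * E \<xi>))"
proof -
  have [measurable]: "q \<in> borel_measurable borel" using q by measurable
  show ?thesis
    by (rule Bochner_Integration.integrable_bound[OF weight_integrable[OF q]]) (auto simp: norm_mult)
qed

lemma K_cmult: "K (\<lambda>\<xi>. c * q \<xi>) x = c * K q x"
  unfolding K_def by (subst integral_mult_right_zero[symmetric]) (simp add: mult_ac)

lemma K_add: "poly_fun p \<Longrightarrow> poly_fun q \<Longrightarrow> K (\<lambda>\<xi>. p \<xi> + q \<xi>) x = K p x + K q x"
  unfolding K_def by (simp add: K_integrand_integrable distrib_left distrib_right)

lemma K_sum:
  assumes "\<And>i. i \<in> I \<Longrightarrow> poly_fun (p i)"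
  shows "K (\<lambda>\<xi>. \<Sum>i\<in>I. p i \<xi>) x = (\<Sum>i\<in>I. K (p i) x)"
  unfolding K_def using assms
  by (simp add: sum_distrib_left sum_distrib_right K_integrand_integrable)

lemma K_measurable:
  assumes q: "poly_fun q" shows "K q \<in> borel_measurable borel"
proof -
  have [measurable]: "q \<in> borel_measurable borel" using q by measurable
  show ?thesis unfolding K_def by measurable
qed

lemma K_bounded: "\<exists>B. \<forall>x. norm (K q x) \<le> B"
proof -
  have "norm (K q x) \<le> (LINT \<xi>|lborel. norm (q \<xi> * E \<xi>))" for x
    unfolding K_def using integral_norm_bound[of lborel "\<lambda>\<xi>. exp (\<i> * of_real (x \<bullet> \<xi>)) * (q \<xi> * E \<xi>)"]
    by (simp add: norm_mult)
  then show ?thesis by blast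
qed

section \<open>Multiplication of kernels by coordinates and their decay\<close>

lemma partial_deriv_exp:
  assumes "\<phi> differentiable (at x)"
  shows "(\<lambda>x. exp (\<phi> x)) differentiable (at x)"
    and "partial_deriv k (\<lambda>x. exp (\<phi> x)) x = exp (\<phi> x) * partial_deriv k \<phi> x"
proof -
  have d: "((\<lambda>x. exp (\<phi> x)) has_derivative (\<lambda>h. exp (\<phi> x) * frechet_derivative \<phi> (at x) h)) (at x)"
    using has_derivative_compose[OF assms[unfolded frechet_derivative_works] DERIV_exp[unfolded has_field_derivative_def]]
    by simp
  then show "(\<lambda>x. exp (\<phi> x)) differentiable (at x)" by (rule differentiableI)
  show "partial_deriv k (\<lambda>x. exp (\<phi> x)) x = exp (\<phi> x) * partial_deriv k \<phi> x"
    using partial_deriv_eq[OF d] by (simp add: partial_deriv_def)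
qed

lemma poly_fun_inner: "poly_fun (\<lambda>\<xi>. of_real (x \<bullet> \<xi>))"
  unfolding inner_vec_def inner_real_def of_real_sum of_real_mult
  by (intro poly_fun_sum poly_fun_cmult poly_fun_coord)

lemma partial_deriv_inner: "partial_deriv k (\<lambda>\<xi>. \<i> * of_real (x \<bullet> \<xi>)) \<xi> = \<i> * of_real (x $ k)"
proof -
  have "((\<lambda>\<xi>. \<i> * complex_of_real (x \<bullet> \<xi>)) has_derivative (\<lambda>h. \<i> * of_real (x \<bullet> h))) (at \<xi>)"
    by (auto intro!: derivative_eq_intros)
  from partial_deriv_eq[OF this] show ?thesis by (simp add: inner_axis)
qed

text \<open>The derivative of \<open>q \<xi> * E \<xi>\<close> in direction \<open>k\<close>, times
  \<open>\<i>\<close>, with the factor \<open>E \<xi>\<close> taken out again.\<close>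

definition coord_mult :: "'n \<Rightarrow> (real^'n \<Rightarrow> complex) \<Rightarrow> real^'n \<Rightarrow> complex" where
  "coord_mult k q \<xi> = \<i> * (partial_deriv k q \<xi> - q \<xi> * partial_deriv k (\<lambda>\<xi>. of_real (L \<xi>)) \<xi>)"

lemma poly_fun_coord_mult: "poly_fun q \<Longrightarrow> poly_fun (coord_mult k q)"
  unfolding coord_mult_def[abs_def]
  by (intro poly_fun_cmult poly_fun_diff poly_fun_mult poly_fun_partial_deriv poly_L)

text \<open>Multiplication by \<open>x\<^sub>k\<close> becomes a differentiation in \<open>\<xi>\<^sub>k\<close>, which is moved off the exponential.\<close>

lemma K_coord_mult:
  assumes q: "poly_fun q"
  shows "of_real (x $ k) * K q x = K (coord_mult k q) x"
proof -
  \<comment> \<open>Phase and weight are merged into one polynomial exponent, so a single chain rule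
    treats both.\<close>
  define \<phi> where "\<phi> \<xi> = \<i> * of_real (x \<bullet> \<xi>) + (-1) * of_real (L \<xi>)" for \<xi>
  have \<phi>: "poly_fun \<phi>"
    unfolding \<phi>_def by (intro poly_fun_add poly_fun_cmult poly_fun_inner poly_L)
  have exp\<phi>: "exp (\<phi> \<xi>) = exp (\<i> * of_real (x \<bullet> \<xi>)) * E \<xi>" for \<xi>
    by (simp add: \<phi>_def E_def exp_add exp_diff exp_minus field_simps)
  have d\<phi>: "partial_deriv k \<phi> \<xi> = \<i> * of_real (x $ k) - partial_deriv k (\<lambda>\<xi>. of_real (L \<xi>)) \<xi>" for \<xi>
  proof -
    have "partial_deriv k \<phi> \<xi> = partial_deriv k (\<lambda>\<xi>. \<i> * of_real (x \<bullet> \<xi>)) \<xi> + partial_deriv k (\<lambda>\<xi>. (-1) * of_real (L \<xi>)) \<xi>"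
      unfolding \<phi>_def
      by (intro partial_deriv_add poly_fun_differentiable poly_fun_cmult poly_fun_inner poly_L)
    then show ?thesis
      by (simp only: partial_deriv_inner partial_deriv_cmult[OF poly_fun_differentiable[OF poly_L]]) simp
  qed
  note diff = poly_fun_differentiable[OF \<phi>] poly_fun_differentiable[OF q]
  have dG: "partial_deriv k (\<lambda>\<xi>. exp (\<phi> \<xi>) * q \<xi>) \<xi>
      = exp (\<i> * of_real (x \<bullet> \<xi>)) * ((\<i> * of_real (x $ k) * q \<xi> + (- \<i>) * coord_mult k q \<xi>) * E \<xi>)" for \<xi>
  proof -
    have "partial_deriv k (\<lambda>\<xi>. exp (\<phi> \<xi>) * q \<xi>) \<xi>
        = exp (\<phi> \<xi>) * partial_deriv k q \<xi> + exp (\<phi> \<xi>) * partial_deriv k \<phi> \<xi> * q \<xi>"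
      by (subst partial_deriv_mult) (simp_all add: diff partial_deriv_exp)
    then show ?thesis
      unfolding d\<phi> coord_mult_def exp\<phi> by (simp add: algebra_simps)
  qed
  have p: "poly_fun (\<lambda>\<xi>. \<i> * of_real (x $ k) * q \<xi> + (- \<i>) * coord_mult k q \<xi>)"
    by (intro poly_fun_add poly_fun_cmult q poly_fun_coord_mult)
  have "(LINT \<xi>|lborel. partial_deriv k (\<lambda>\<xi>. exp (\<phi> \<xi>) * q \<xi>) \<xi>) = 0"
  proof (rule integral_partial_deriv_eq_0)
    show "(\<lambda>\<xi>. exp (\<phi> \<xi>) * q \<xi>) differentiable at \<xi>" for \<xi>
      by (intro differentiable_mult partial_deriv_exp diff)
    show "integrable lborel (\<lambda>\<xi>. exp (\<phi> \<xi>) * q \<xi>)"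
      using K_integrand_integrable[OF q, of x] by (simp add: exp\<phi> mult_ac)
    show "integrable lborel (partial_deriv k (\<lambda>\<xi>. exp (\<phi> \<xi>) * q \<xi>))"
      unfolding dG[abs_def] by (rule K_integrand_integrable[OF p])
    show "continuous_on UNIV (partial_deriv k (\<lambda>\<xi>. exp (\<phi> \<xi>) * q \<xi>))"
      unfolding dG[abs_def] E_def
      by (intro continuous_intros poly_fun_continuous[OF p] poly_fun_continuous[OF poly_L])
  qed
  then have "K (\<lambda>\<xi>. \<i> * of_real (x $ k) * q \<xi> + (- \<i>) * coord_mult k q \<xi>) x = 0"
    by (simp add: dG K_def)
  moreover have "K (\<lambda>\<xi>. \<i> * of_real (x $ k) * q \<xi> + (- \<i>) * coord_mult k q \<xi>) x
      = \<i> * of_real (x $ k) * K q x + (- \<i>) * K (coord_mult k q) x"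
    using q by (simp only: K_add K_cmult poly_fun_cmult poly_fun_coord_mult)
  ultimately have "\<i> * (of_real (x $ k) * K q x - K (coord_mult k q) x) = 0"
    by (simp add: algebra_simps)
  then show ?thesis by simp
qed

text \<open>Each factor \<open>1 + (x $ k)\<^sup>2\<close> acts on the polynomial by adding
  \<open>coord_mult\<close> applied twice, so the product stays within the family of
  kernels.\<close>

lemma K_prod_mult:
  assumes "finite S" "poly_fun q"
  shows "\<exists>p. poly_fun p \<and> (\<forall>x. of_real (\<Prod>k\<in>S. 1 + (x $ k)\<^sup>2) * K q x = K p x)"
  using assms(1)
proof (induction S rule: finite_induct)
  case (insert k S)
  then obtain p where p: "poly_fun p" "\<And>x. of_real (\<Prod>k\<in>S. 1 + (x $ k)\<^sup>2) * K q x = K p x" by blast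
  let ?p = "\<lambda>\<xi>. p \<xi> + coord_mult k (coord_mult k p) \<xi>"
  have "of_real (\<Prod>k\<in>insert k S. 1 + (x $ k)\<^sup>2) * K q x = K ?p x" for x
  proof -
    have "of_real (\<Prod>k\<in>insert k S. 1 + (x $ k)\<^sup>2) * K q x = (1 + of_real (x $ k) ^ 2) * K p x"
      using insert(1,2) p(2)[of x] by (simp add: mult.assoc)
    also have "\<dots> = K p x + of_real (x $ k) * (of_real (x $ k) * K p x)"
      by (simp add: power2_eq_square algebra_simps)
    also have "\<dots> = K ?p x"
      using p(1) by (simp add: K_add K_coord_mult poly_fun_coord_mult)
    finally show ?thesis .
  qed
  moreover have "poly_fun ?p"
    using p(1) by (intro poly_fun_add poly_fun_coord_mult)
  ultimately show ?case by blast
qed (use assms(2) in auto)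

text \<open>The product of \<open>\<rho>\<close> with the kernel is again a kernel, hence bounded,
  so the kernel decays like \<open>inverse (\<rho> x)\<close>.\<close>

lemma K_integrable:
  assumes q: "poly_fun q" shows "integrable lborel (K q)"
proof -
  define \<rho> where "\<rho> x = (\<Prod>k\<in>UNIV. 1 + (x $ k)\<^sup>2)" for x :: "real^'n"
  have \<rho>: "\<rho> x > 0" for x unfolding \<rho>_def by (intro prod_pos) (auto intro: add_pos_nonneg)
  obtain p where p: "poly_fun p" "\<And>x. of_real (\<rho> x) * K q x = K p x"
    using K_prod_mult[OF finite q, of UNIV] unfolding \<rho>_def by blast
  obtain B where B: "\<And>x. norm (K p x) \<le> B" using K_bounded[of p] by blast
  have inv: "inverse (\<rho> x) = (\<Prod>k\<in>UNIV. inverse (1 + (x $ k)\<^sup>2))" for x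
    by (simp add: \<rho>_def prod_inversef[symmetric])
  show ?thesis
  proof (rule Bochner_Integration.integrable_bound)
    show "integrable lborel (\<lambda>x. B * inverse (\<rho> x))"
      unfolding inv by (intro integrable_mult_right integrable_cauchy_density_vec)
    have "norm (K q x) \<le> B * inverse (\<rho> x)" for x
      using B[of x] \<rho>[of x] by (simp add: norm_mult field_simps flip: p(2))
    then show "AE x in lborel. norm (K q x) \<le> norm (B * inverse (\<rho> x))"
      by (intro AE_I2) (metis abs_ge_self order_trans real_norm_def)
  qed (simp add: K_measurable[OF q])
qed

end

section \<open>Moving derivatives onto the kernel\<close>

lemma partial_deriv_affine:
  fixes F :: "real^'n::finite \<Rightarrow> complex"
  assumes "F differentiable (at (x - r *\<^sub>R z))"
  shows "(\<lambda>z. F (x - r *\<^sub>R z)) differentiable (at z)"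
    and "partial_deriv k (\<lambda>z. F (x - r *\<^sub>R z)) z = - of_real r * partial_deriv k F (x - r *\<^sub>R z)"
proof -
  let ?F' = "frechet_derivative F (at (x - r *\<^sub>R z))"
  have "((\<lambda>z. x - r *\<^sub>R z) has_derivative (\<lambda>h. (- r) *\<^sub>R h)) (at z)"
    by (auto intro!: derivative_eq_intros)
  from has_derivative_compose[OF this assms[unfolded frechet_derivative_works]]
  have d: "((\<lambda>z. F (x - r *\<^sub>R z)) has_derivative (\<lambda>h. ?F' ((- r) *\<^sub>R h))) (at z)" .
  then show "(\<lambda>z. F (x - r *\<^sub>R z)) differentiable (at z)" by (rule differentiableI)
  show "partial_deriv k (\<lambda>z. F (x - r *\<^sub>R z)) z = - of_real r * partial_deriv k F (x - r *\<^sub>R z)"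
    unfolding partial_deriv_eq[OF d] linear_scale[OF linear_frechet_derivative[OF assms]]
    by (simp add: partial_deriv_def scaleR_conv_of_real)
qed

lemma test_affine_integrable:
  assumes "F \<in> test_functions" "r \<noteq> 0"
  shows "integrable lborel (\<lambda>z. F (x - r *\<^sub>R z))"
  using integrable_affine[OF test_integrable[OF assms(1)], of "- r" x] assms(2) by simp

lemma integrable_iexp_mult:
  fixes h :: "'a::euclidean_space \<Rightarrow> complex"
  assumes h: "integrable lborel h"
  shows "integrable lborel (\<lambda>z. exp (\<i> * of_real (z \<bullet> \<xi>)) * h z)"
proof -
  have [measurable]: "h \<in> borel_measurable borel" using h by auto
  show ?thesis
    by (rule Bochner_Integration.integrable_bound[OF h]) (auto simp: norm_mult)
qed

context elliptic_symbol begin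

text \<open>Passes to the Fourier side, where the kernel is an explicit weight and only the
  exponential depends on \<open>z\<close>.\<close>

lemma K_fubini:
  assumes q: "poly_fun q" and h: "integrable lborel h"
  shows "(LINT z|lborel. K q z * h z)
    = (LINT \<xi>|lborel. q \<xi> * E \<xi> * (LINT z|lborel. exp (\<i> * of_real (z \<bullet> \<xi>)) * h z))"
proof -
  have [measurable]: "q \<in> borel_measurable borel" using q by measurable
  have [measurable]: "h \<in> borel_measurable borel" using h by auto
  have pair: "integrable (lborel \<Otimes>\<^sub>M lborel) (\<lambda>(z, \<xi>). exp (\<i> * of_real (z \<bullet> \<xi>)) * (q \<xi> * E \<xi>) * h z)"
  proof (rule lborel_pair.Fubini_integrable)
    show "integrable lborel (\<lambda>z. LINT \<xi>|lborel. norm (case (z, \<xi>) of (z, \<xi>) \<Rightarrow> exp (\<i> * of_real (z \<bullet> \<xi>)) * (q \<xi> * E \<xi>) * h z))"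
      using h by (simp add: norm_mult)
    show "AE z in lborel. integrable lborel (\<lambda>\<xi>. case (z, \<xi>) of (z, \<xi>) \<Rightarrow> exp (\<i> * of_real (z \<bullet> \<xi>)) * (q \<xi> * E \<xi>) * h z)"
      using K_integrand_integrable[OF q] by (intro AE_I2) simp
  qed measurable
  have "(LINT z|lborel. K q z * h z) = (LINT z|lborel. LINT \<xi>|lborel. exp (\<i> * of_real (z \<bullet> \<xi>)) * (q \<xi> * E \<xi>) * h z)"
    unfolding K_def by (simp only: integral_mult_left_zero)
  also have "\<dots> = (LINT \<xi>|lborel. LINT z|lborel. exp (\<i> * of_real (z \<bullet> \<xi>)) * (q \<xi> * E \<xi>) * h z)"
    by (rule lborel_pair.Fubini_integral[OF pair, symmetric])
  also have "\<dots> = (LINT \<xi>|lborel. q \<xi> * E \<xi> * (LINT z|lborel. exp (\<i> * of_real (z \<bullet> \<xi>)) * h z))"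
    by (subst integral_mult_right_zero[symmetric]) (simp add: mult_ac)
  finally show ?thesis .
qed

text \<open>On the Fourier side this is integration by parts against the exponential, so
  \<open>K\<close> itself is never differentiated. The factor \<open>r\<close> is the inner
  derivative of \<open>x - r *\<^sub>R z\<close>.\<close>

lemma K_transfer:
  assumes q: "poly_fun q" and F: "F \<in> test_functions" and r: "r > 0"
  shows "of_real r * (LINT z|lborel. K q z * D_op k F (x - r *\<^sub>R z))
    = (LINT z|lborel. K (\<lambda>\<xi>. of_real (\<xi> $ k) * q \<xi>) z * F (x - r *\<^sub>R z))"
proof -
  let ?e = "\<lambda>z \<xi>. exp (\<i> * complex_of_real (z \<bullet> \<xi>)) :: complex"
  have ibp: "of_real r * (LINT z|lborel. ?e z \<xi> * D_op k F (x - r *\<^sub>R z))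
      = of_real (\<xi> $ k) * (LINT z|lborel. ?e z \<xi> * F (x - r *\<^sub>R z))" for \<xi>
  proof -
    have diff: "(\<lambda>z. ?e z \<xi>) differentiable at z" for z
      unfolding inner_commute[of _ \<xi>]
      by (intro partial_deriv_exp poly_fun_differentiable poly_fun_cmult poly_fun_inner)
    have de: "partial_deriv k (\<lambda>z. ?e z \<xi>) z = ?e z \<xi> * (\<i> * of_real (\<xi> $ k))" for z
      unfolding inner_commute[of _ \<xi>]
      by (subst partial_deriv_exp)
         (simp_all add: partial_deriv_inner poly_fun_differentiable poly_fun_cmult poly_fun_inner)
    note aff = partial_deriv_affine[OF test_differentiable[OF F]]
    have DF: "partial_deriv k F y = \<i> * D_op k F y" for y
      by (simp add: D_op_def)
    have dG: "partial_deriv k (\<lambda>z. ?e z \<xi> * F (x - r *\<^sub>R z)) z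
        = \<i> * (of_real (\<xi> $ k) * (?e z \<xi> * F (x - r *\<^sub>R z)) - of_real r * (?e z \<xi> * D_op k F (x - r *\<^sub>R z)))" for z
    proof -
      have "partial_deriv k (\<lambda>z. ?e z \<xi> * F (x - r *\<^sub>R z)) z
          = ?e z \<xi> * (- of_real r * partial_deriv k F (x - r *\<^sub>R z)) + ?e z \<xi> * (\<i> * of_real (\<xi> $ k)) * F (x - r *\<^sub>R z)"
        by (subst partial_deriv_mult) (simp_all add: diff de aff)
      then show ?thesis unfolding DF by (simp add: algebra_simps)
    qed
    have int: "integrable lborel (\<lambda>z. ?e z \<xi> * F (x - r *\<^sub>R z))"
      "integrable lborel (\<lambda>z. ?e z \<xi> * D_op k F (x - r *\<^sub>R z))"
      using r by (auto intro!: integrable_iexp_mult test_affine_integrable F test_D_op)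
    have "(LINT z|lborel. partial_deriv k (\<lambda>z. ?e z \<xi> * F (x - r *\<^sub>R z)) z) = 0"
    proof (rule integral_partial_deriv_eq_0)
      show "(\<lambda>z. ?e z \<xi> * F (x - r *\<^sub>R z)) differentiable at z" for z
        by (intro differentiable_mult diff aff)
      show "integrable lborel (partial_deriv k (\<lambda>z. ?e z \<xi> * F (x - r *\<^sub>R z)))"
        unfolding dG[abs_def] using int by auto
      show "continuous_on UNIV (partial_deriv k (\<lambda>z. ?e z \<xi> * F (x - r *\<^sub>R z)))"
        unfolding dG[abs_def]
        by (intro continuous_intros continuous_on_compose2[OF test_continuous[OF F, of UNIV]]
            continuous_on_compose2[OF test_continuous[OF test_D_op[OF F], of UNIV]]) auto
    qed (rule int)
    then show ?thesis
      using int by (simp add: dG)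
  qed
  have "of_real r * (LINT z|lborel. K q z * D_op k F (x - r *\<^sub>R z))
      = of_real r * (LINT \<xi>|lborel. q \<xi> * E \<xi> * (LINT z|lborel. ?e z \<xi> * D_op k F (x - r *\<^sub>R z)))"
    using r by (subst K_fubini[OF q test_affine_integrable[OF test_D_op[OF F]]]) auto
  also have "\<dots> = (LINT \<xi>|lborel. q \<xi> * E \<xi> * (of_real r * (LINT z|lborel. ?e z \<xi> * D_op k F (x - r *\<^sub>R z))))"
    by (subst integral_mult_right_zero[symmetric]) (simp add: mult_ac)
  also have "\<dots> = (LINT \<xi>|lborel. (of_real (\<xi> $ k) * q \<xi>) * E \<xi> * (LINT z|lborel. ?e z \<xi> * F (x - r *\<^sub>R z)))"
    unfolding ibp by (simp add: mult_ac)
  also have "\<dots> = (LINT z|lborel. K (\<lambda>\<xi>. of_real (\<xi> $ k) * q \<xi>) z * F (x - r *\<^sub>R z))"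
    using r by (intro K_fubini[symmetric] poly_fun_mult poly_fun_coord q test_affine_integrable F) auto
  finally show ?thesis .
qed

end

section \<open>Gaussians and their Fourier transform\<close>

lemma fourier_gaussian:
  "(LINT t|lborel. exp (\<i> * of_real (t * s)) * of_real (exp (- t\<^sup>2 / 2))) = complex_of_real (sqrt (2 * pi) * exp (- s\<^sup>2 / 2))"
proof -
  \<comment> \<open>The transform is read off from the characteristic function of the standard
    normal distribution.\<close>
  have "complex_of_real (exp (- s\<^sup>2 / 2)) = char std_normal_distribution s"
    by (simp add: char_std_normal_distribution)
  also have "\<dots> = (LINT t|lborel. std_normal_density t *\<^sub>R exp (\<i> * of_real (s * t)))"
    unfolding char_def by (subst integral_density) auto
  also have "\<dots> = (LINT t|lborel. of_real (1 / sqrt (2 * pi)) * (exp (\<i> * of_real (t * s)) * of_real (exp (- t\<^sup>2 / 2))))"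
    unfolding std_normal_density_def by (simp add: scaleR_conv_of_real mult_ac)
  also have "\<dots> = of_real (1 / sqrt (2 * pi)) * (LINT t|lborel. (exp (\<i> * of_real (t * s)) * of_real (exp (- t\<^sup>2 / 2))))"
    by (rule integral_mult_right_zero)
  finally show ?thesis
    by (simp add: field_simps)
qed

lemma integrable_gaussian: "integrable lborel (\<lambda>t::real. exp (- t\<^sup>2 / 2))"
proof -
  have "integrable lborel (\<lambda>t. sqrt (2 * pi) * std_normal_density t)"
    by simp
  then show ?thesis unfolding std_normal_density_def by simp
qed

definition gaussian :: "real^'n::finite \<Rightarrow> real" where
  "gaussian x = (\<Prod>k\<in>UNIV. exp (- (x $ k)\<^sup>2 / 2))"

lemma gaussian_pos: "gaussian x > 0"
  unfolding gaussian_def by (intro prod_pos) auto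

lemma gaussian_le_1: "gaussian x \<le> 1"
  unfolding gaussian_def by (intro prod_le_1) auto

lemma gaussian_continuous: "continuous_on S gaussian"
  unfolding gaussian_def by (auto intro!: continuous_intros)

lemma gaussian_measurable [measurable]: "gaussian \<in> borel_measurable borel"
  by (intro borel_measurable_continuous_onI gaussian_continuous)

lemma gaussian_integrable: "integrable lborel (gaussian :: real^'n::finite \<Rightarrow> real)"
  unfolding gaussian_def by (intro integrable_lborel_prod_vec integrable_gaussian)

lemma fourier_gaussian_vec:
  fixes \<xi> :: "real^'n::finite"
  shows "(LINT z|lborel. exp (\<i> * of_real (z \<bullet> \<xi>)) * of_real (gaussian z))
    = of_real (sqrt (2 * pi) ^ CARD('n) * gaussian \<xi>)"
proof -
  have "exp (\<i> * of_real (z \<bullet> \<xi>)) * of_real (gaussian z)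
      = (\<Prod>k\<in>UNIV. exp (\<i> * of_real (z $ k * \<xi> $ k)) * of_real (exp (- (z $ k)\<^sup>2 / 2)))" for z
    unfolding gaussian_def prod.distrib of_real_prod inner_vec_def inner_real_def of_real_sum sum_distrib_left
    by (simp add: exp_sum)
  then have "(LINT z|lborel. exp (\<i> * of_real (z \<bullet> \<xi>)) * of_real (gaussian z))
      = (LINT z|lborel. (\<Prod>k\<in>UNIV. exp (\<i> * of_real (z $ k * \<xi> $ k)) * of_real (exp (- (z $ k)\<^sup>2 / 2))))"
    by simp
  also have "\<dots> = (\<Prod>k\<in>UNIV. LINT t|lborel. exp (\<i> * of_real (t * \<xi> $ k)) * of_real (exp (- t\<^sup>2 / 2)))"
  proof (rule integral_lborel_prod_vec)
    fix k
    show "integrable lborel (\<lambda>t. exp (\<i> * of_real (t * \<xi> $ k)) * complex_of_real (exp (- t\<^sup>2 / 2)))"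
      using integrable_iexp_mult[OF integrable_of_real[OF integrable_gaussian], of "\<xi> $ k"] by simp
  qed
  also have "\<dots> = of_real (sqrt (2 * pi) ^ CARD('n) * gaussian \<xi>)"
    unfolding fourier_gaussian gaussian_def by (simp add: prod.distrib)
  finally show ?thesis .
qed

section \<open>Product kernels and homogeneous parts of operators\<close>

lemma pair_kernel_integrable:
  fixes k :: "'a::euclidean_space \<Rightarrow> complex" and a :: "real \<Rightarrow> complex"
  assumes a: "integrable lborel a" and k: "integrable lborel k"
  shows "integrable (lborel \<Otimes>\<^sub>M lborel) (\<lambda>w. a (fst w) * k (snd w))"
proof (rule lborel_pair.Fubini_integrable)
  have [measurable]: "a \<in> borel_measurable borel" "k \<in> borel_measurable borel"
    using a k by auto
  show "(\<lambda>w. a (fst w) * k (snd w)) \<in> borel_measurable (lborel \<Otimes>\<^sub>M lborel)"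
    by measurable
  show "integrable lborel (\<lambda>x. LINT y|lborel. norm (a (fst (x, y)) * k (snd (x, y))))"
    using a by (simp add: norm_mult)
  show "AE x in lborel. integrable lborel (\<lambda>y. a (fst (x, y)) * k (snd (x, y)))"
    using k by simp
qed

lemma integrable_indicator_Icc: "integrable lborel (indicator {a..b::real} :: real \<Rightarrow> complex)"
proof -
  have "(\<lambda>r. indicator {a..b} r *\<^sub>R (1::complex)) = indicator {a..b}"
    by (auto simp: indicator_def fun_eq_iff)
  then show ?thesis
    using borel_integrable_compact[of "{a..b}" "\<lambda>_. 1 :: complex"] by simp
qed

lemma kernel_test_integrable:
  fixes k :: "'w \<Rightarrow> complex"
  assumes k: "integrable M k" and \<tau>: "\<tau> \<in> M \<rightarrow>\<^sub>M borel" and F: "F \<in> test_functions"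
  shows "integrable M (\<lambda>w. k w * F (x - \<tau> w))"
proof -
  have [measurable]: "F \<in> borel_measurable borel" "\<tau> \<in> M \<rightarrow>\<^sub>M borel" "k \<in> borel_measurable M"
    using F \<tau> k by auto
  obtain B where B: "B > 0" "\<And>x. norm (F x) \<le> B" using test_bounded[OF F] by blast
  show ?thesis
  proof (rule Bochner_Integration.integrable_bound)
    show "integrable M (\<lambda>w. B * norm (k w))" using k by simp
    show "AE w in M. norm (k w * F (x - \<tau> w)) \<le> norm (B * norm (k w))"
      using B by (intro AE_I2) (simp add: norm_mult mult.commute[of "norm (k _)"] mult_right_mono)
  qed measurable
qed

lemma D_multi_sum:
  assumes "\<And>i. i \<in> I \<Longrightarrow> f i \<in> test_functions"
  shows "D_multi \<alpha> (\<lambda>x. \<Sum>i\<in>I. f i x) = (\<lambda>x. \<Sum>i\<in>I. D_multi \<alpha> (f i) x)"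
  using assms
proof (induction I rule: infinite_finite_induct)
  case (insert i I)
  then show ?case by (simp add: D_multi_add test_sum)
qed (use D_multi_cmult[OF test_zero, of \<alpha> 0] in auto)

definition hom_part ::
  "nat \<Rightarrow> 'n::{finite,linorder} diffop \<Rightarrow> (real^'n::{finite,linorder} \<Rightarrow> complex) \<Rightarrow> real^'n::{finite,linorder} \<Rightarrow> complex" where
  "hom_part m T f = (\<lambda>x. \<Sum>\<alpha> | mdeg \<alpha> = m. Poly_Mapping.lookup T \<alpha> * D_multi \<alpha> f x)"

lemma test_hom_part: "f \<in> test_functions \<Longrightarrow> hom_part m T f \<in> test_functions"
  unfolding hom_part_def by (intro test_sum test_cmult test_D_multi)

lemma hom_part_D_multi:
  assumes f: "f \<in> test_functions"
  shows "hom_part m T (D_multi \<beta> f) = D_multi \<beta> (hom_part m T f)"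
  unfolding hom_part_def using f
  by (subst D_multi_sum)
     (auto intro!: test_cmult test_D_multi simp: D_multi_cmult D_multi_D_multi test_D_multi add.commute)

lemma apply_op_eq_hom_part:
  assumes "\<And>\<alpha>. \<alpha> \<in> Poly_Mapping.keys T \<Longrightarrow> mdeg \<alpha> \<le> m"
  shows "apply_op T f x = hom_part m T f x + (\<Sum>\<alpha> | mdeg \<alpha> < m. Poly_Mapping.lookup T \<alpha> * D_multi \<alpha> f x)"
proof -
  have "apply_op T f x = (\<Sum>\<alpha>\<in>{\<alpha>. mdeg \<alpha> = m} \<union> {\<alpha>. mdeg \<alpha> < m}. Poly_Mapping.lookup T \<alpha> * D_multi \<alpha> f x)"
    by (rule apply_op_superset) (use assms in \<open>auto simp: finite_mdeg_eq finite_mdeg_less le_less\<close>)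
  also have "\<dots> = hom_part m T f x + (\<Sum>\<alpha> | mdeg \<alpha> < m. Poly_Mapping.lookup T \<alpha> * D_multi \<alpha> f x)"
    unfolding hom_part_def by (rule sum.union_disjoint) (auto simp: finite_mdeg_eq finite_mdeg_less)
  finally show ?thesis .
qed

context elliptic_symbol begin

text \<open>Replaces Fourier inversion at the origin. Tested against ever wider Gaussians, the
  kernel gives integrals tending to its mass, while their Fourier side stays above a fixed positive
  number.\<close>

lemma K_mass_nonzero: "(LINT z|lborel. K (\<lambda>_. 1) z) \<noteq> 0"
proof
  assume zero: "(LINT z|lborel. K (\<lambda>_. 1) z) = 0"
  let ?K = "K (\<lambda>_. 1)"
  note K_int = K_integrable[OF poly_fun_const[of 1]]
  have [measurable]: "?K \<in> borel_measurable borel" using K_int by auto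
  let ?C = "sqrt (2 * pi) ^ CARD('n)"
  let ?J = "\<lambda>\<epsilon>. LINT z|lborel. ?K z * of_real (gaussian (\<epsilon> *\<^sub>R z))"
  \<comment> \<open>This is the value of \<open>?J\<close> at 1, which turns out to be its minimum
    on the interval from 0 to 1.\<close>
  define \<delta> where "\<delta> = ?C * (LINT \<eta>|lborel. exp (- L \<eta>) * gaussian \<eta>)"
  have int\<epsilon>: "integrable lborel (\<lambda>\<eta>. exp (- L (\<epsilon> *\<^sub>R \<eta>)) * gaussian \<eta>)" for \<epsilon>
    by (rule Bochner_Integration.integrable_bound[OF gaussian_integrable])
       (auto simp: abs_mult gaussian_pos[THEN less_imp_le] L_nonneg intro!: mult_left_le_one_le)
  have "\<delta> > 0"
  proof -
    have "(LINT \<eta>|lborel. exp (- L \<eta>) * gaussian \<eta>) \<noteq> 0"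
    proof
      assume "(LINT \<eta>|lborel. exp (- L \<eta>) * gaussian \<eta>) = 0"
      then have "AE \<eta> in (lborel :: (real^'n) measure). exp (- L \<eta>) * gaussian \<eta> = 0"
        using int\<epsilon>[of 1] gaussian_pos
        by (subst (asm) integral_nonneg_eq_0_iff_AE) (auto intro!: AE_I2 mult_nonneg_nonneg intro: less_imp_le)
      moreover have "exp (- L \<eta>) * gaussian \<eta> \<noteq> 0" for \<eta>
        using gaussian_pos[of \<eta>] by simp
      ultimately have "AE \<eta> in (lborel :: (real^'n) measure). False" by simp
      then show False by (simp add: AE_iff_null null_sets_def emeasure_lborel_UNIV)
    qed
    moreover have "(LINT \<eta>|lborel. exp (- L \<eta>) * gaussian \<eta>) \<ge> 0"
      by (intro integral_nonneg_AE AE_I2 mult_nonneg_nonneg exp_ge_zero less_imp_le[OF gaussian_pos])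
    ultimately show ?thesis by (simp add: \<delta>_def)
  qed
  \<comment> \<open>Rescaling by \<open>\<epsilon>\<close> moves the parameter from the Gaussian
    into \<open>L\<close>, and \<open>L (\<epsilon> *\<^sub>R \<eta>) \<le> L \<eta>\<close> by
    homogeneity.\<close>
  have "Re (?J \<epsilon>) \<ge> \<delta>" if \<epsilon>: "0 < \<epsilon>" "\<epsilon> \<le> 1" for \<epsilon>
  proof -
    have g: "integrable lborel (\<lambda>z :: real^'n. complex_of_real (gaussian (c *\<^sub>R z)))" if "c \<noteq> 0" for c
      using integrable_affine[OF gaussian_integrable that, of 0] by (intro integrable_of_real) simp
    have inner: "(LINT z|lborel. exp (\<i> * of_real (z \<bullet> \<xi>)) * of_real (gaussian (\<epsilon> *\<^sub>R z)))
        = of_real (?C / \<epsilon> ^ CARD('n) * gaussian (\<xi> /\<^sub>R \<epsilon>))" for \<xi> :: "real^'n"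
    proof -
      have "of_real (?C * gaussian (\<xi> /\<^sub>R \<epsilon>))
          = (LINT z|lborel. exp (\<i> * of_real (z \<bullet> (\<xi> /\<^sub>R \<epsilon>))) * of_real (gaussian z))"
        by (rule fourier_gaussian_vec[symmetric])
      also have "\<dots> = \<bar>\<epsilon>\<bar> ^ DIM(real^'n) *\<^sub>R (LINT z|lborel. exp (\<i> * of_real ((0 + \<epsilon> *\<^sub>R z) \<bullet> (\<xi> /\<^sub>R \<epsilon>))) * of_real (gaussian (0 + \<epsilon> *\<^sub>R z)))"
        using g[of 1] \<epsilon> by (intro integral_affine integrable_iexp_mult) auto
      also have "\<dots> = of_real (\<epsilon> ^ CARD('n)) * (LINT z|lborel. exp (\<i> * of_real (z \<bullet> \<xi>)) * of_real (gaussian (\<epsilon> *\<^sub>R z)))"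
      proof -
        have zi: "(0 + \<epsilon> *\<^sub>R z) \<bullet> (\<xi> /\<^sub>R \<epsilon>) = z \<bullet> \<xi>" for z
          using \<epsilon> by simp
        show ?thesis
          unfolding zi using \<epsilon> by (simp add: scaleR_conv_of_real[where 'a=complex])
      qed
      finally show ?thesis
        using \<epsilon> by (simp add: field_simps)
    qed
    have "?J \<epsilon> = (LINT \<xi>|lborel. 1 * E \<xi> * of_real (?C / \<epsilon> ^ CARD('n) * gaussian (\<xi> /\<^sub>R \<epsilon>)))"
      using g[of \<epsilon>] \<epsilon> by (subst K_fubini[OF poly_fun_const]) (simp_all add: inner)
    also have "\<dots> = of_real (?C / \<epsilon> ^ CARD('n)) * of_real (LINT \<xi>|lborel. exp (- L \<xi>) * gaussian (\<xi> /\<^sub>R \<epsilon>))"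
      unfolding E_def
      by (subst integral_complex_of_real[symmetric], subst integral_mult_right_zero[symmetric])
         (simp add: mult_ac exp_of_real[symmetric])
    also have "(LINT \<xi>|lborel. exp (- L \<xi>) * gaussian (\<xi> /\<^sub>R \<epsilon>))
        = \<bar>\<epsilon>\<bar> ^ DIM(real^'n) *\<^sub>R (LINT \<eta>|lborel. exp (- L (0 + \<epsilon> *\<^sub>R \<eta>)) * gaussian ((0 + \<epsilon> *\<^sub>R \<eta>) /\<^sub>R \<epsilon>))"
    proof (rule integral_affine)
      have "integrable lborel (\<lambda>\<xi> :: real^'n. exp (- L (\<epsilon> *\<^sub>R (0 + inverse \<epsilon> *\<^sub>R \<xi>))) * gaussian (0 + inverse \<epsilon> *\<^sub>R \<xi>))"
        using \<epsilon> by (intro integrable_affine[OF int\<epsilon>]) auto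
      then show "integrable lborel (\<lambda>\<xi>. exp (- L \<xi>) * gaussian (\<xi> /\<^sub>R \<epsilon>))"
        using \<epsilon> by simp
    qed (use \<epsilon> in auto)
    finally have J: "?J \<epsilon> = of_real (?C * (LINT \<eta>|lborel. exp (- L (\<epsilon> *\<^sub>R \<eta>)) * gaussian \<eta>))"
      using \<epsilon> by simp
    have "(LINT \<eta>|lborel. exp (- L \<eta>) * gaussian \<eta>) \<le> (LINT \<eta>|lborel. exp (- L (\<epsilon> *\<^sub>R \<eta>)) * gaussian \<eta>)"
    proof (rule integral_mono)
      show "integrable lborel (\<lambda>\<eta>. exp (- L \<eta>) * gaussian \<eta>)" using int\<epsilon>[of 1] by simp
      fix \<eta> :: "real^'n"
      have "\<epsilon> ^ m * L \<eta> \<le> L \<eta>"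
        using \<epsilon> by (intro mult_left_le_one_le L_nonneg) (auto intro: power_le_one)
      then show "exp (- L \<eta>) * gaussian \<eta> \<le> exp (- L (\<epsilon> *\<^sub>R \<eta>)) * gaussian \<eta>"
        by (intro mult_right_mono) (auto simp: hom_L gaussian_pos[THEN less_imp_le])
    qed (rule int\<epsilon>)
    then show ?thesis
      unfolding J \<delta>_def by (simp add: mult_left_mono)
  qed
  then have lower: "Re (?J (inverse (real (Suc n)))) \<ge> \<delta>" for n
    by (simp add: inverse_le_1_iff)
  \<comment> \<open>Dominated convergence as the Gaussians widen; the limit factor is
    \<open>gaussian 0 = 1\<close>.\<close>
  have "(\<lambda>n. ?J (inverse (real (Suc n)))) \<longlonglongrightarrow> (LINT z|lborel. ?K z * of_real (gaussian (0 *\<^sub>R z)))"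
  proof (rule integral_dominated_convergence)
    show "integrable lborel (\<lambda>z. norm (?K z))" using K_int by simp
    show "AE z in lborel. (\<lambda>n. ?K z * of_real (gaussian (inverse (real (Suc n)) *\<^sub>R z))) \<longlonglongrightarrow> ?K z * of_real (gaussian (0 *\<^sub>R z))"
    proof (intro AE_I2 tendsto_intros)
      fix z :: "real^'n"
      have "isCont gaussian (0 *\<^sub>R z)"
        using gaussian_continuous[of "UNIV :: (real^'n) set"] by (simp add: continuous_on_eq_continuous_at)
      then show "(\<lambda>n. gaussian (inverse (real (Suc n)) *\<^sub>R z)) \<longlonglongrightarrow> gaussian (0 *\<^sub>R z)"
        by (rule isCont_tendsto_compose) (intro tendsto_intros LIMSEQ_inverse_real_of_nat)
    qed
    show "AE z in lborel. norm (?K z * of_real (gaussian (inverse (real (Suc n)) *\<^sub>R z))) \<le> norm (?K z)" for n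
    proof -
      have "norm (complex_of_real (gaussian y)) \<le> 1" for y :: "real^'n"
        using gaussian_pos[of y] gaussian_le_1[of y] by simp
      then show ?thesis
        by (intro AE_I2) (simp only: norm_mult mult_left_le norm_ge_zero)
    qed
  qed measurable
  moreover have "(LINT z|lborel. ?K z * of_real (gaussian (0 *\<^sub>R z))) = 0"
    using zero by (simp add: gaussian_def)
  ultimately have "(\<lambda>n. ?J (inverse (real (Suc n)))) \<longlonglongrightarrow> 0" by (simp only:)
  from tendsto_Re[OF this] have "\<delta> \<le> Re 0"
    by (rule LIMSEQ_le_const) (use lower in blast)
  with \<open>\<delta> > 0\<close> show False by simp
qed

section \<open>The representation formula\<close>

definition dL :: "'n \<Rightarrow> real^'n \<Rightarrow> complex" where
  "dL k = partial_deriv k (\<lambda>\<xi>. of_real (L \<xi>))"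

lemma poly_fun_dL: "poly_fun (dL k)"
  unfolding dL_def by (intro poly_fun_partial_deriv poly_L)

text \<open>Differentiating \<open>h (x - r *\<^sub>R z)\<close> in \<open>r\<close> produces
  factors \<open>z $ k\<close>; this absorbs them into the kernel.\<close>

lemma K_one_coord: "of_real (z $ k) * K (\<lambda>_. 1) z = - \<i> * K (dL k) z"
proof -
  have "partial_deriv k (\<lambda>_. 1 :: complex) \<xi> = 0" for \<xi> :: "real^'n"
    by (subst partial_deriv_eq[OF has_derivative_const]) simp
  then have "coord_mult k (\<lambda>_. 1) = (\<lambda>\<xi>. - \<i> * dL k \<xi>)"
    by (simp add: coord_mult_def dL_def fun_eq_iff)
  then show ?thesis
    using K_coord_mult[OF poly_fun_const[of 1], of z k] by (simp only: K_cmult)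
qed

lemma K_test_integrable:
  assumes "poly_fun q" "F \<in> test_functions"
  shows "integrable lborel (\<lambda>z. K q z * F (x - r *\<^sub>R z))"
  by (rule kernel_test_integrable[OF K_integrable[OF assms(1)] _ assms(2)]) measurable

text \<open>Fundamental theorem of calculus along \<open>r \<mapsto> h (x - r z)\<close>, averaged against \<open>K 1\<close>.\<close>

lemma K_representation:
  assumes h: "h \<in> test_functions" and t: "t > 0"
  shows "(LINT z|lborel. K (\<lambda>_. 1) z) * h x = (LINT z|lborel. K (\<lambda>_. 1) z * h (x - t *\<^sub>R z))
    + (LINT r|lborel. indicator {0..t} r * (\<Sum>k\<in>UNIV. LINT z|lborel. K (dL k) z * D_op k h (x - r *\<^sub>R z)))"
proof -
  let ?K = "K (\<lambda>_. 1)"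
  have K1: "integrable lborel ?K" by (intro K_integrable poly_fun_const)
  have ftc: "?K z * h x = ?K z * h (x - t *\<^sub>R z)
      + (LINT r|lborel. (\<Sum>k\<in>UNIV. indicator {0..t} r * K (dL k) z * D_op k h (x - r *\<^sub>R z)))" for z
  proof -
    let ?g = "\<lambda>r. \<Sum>k\<in>UNIV. K (dL k) z * D_op k h (x - r *\<^sub>R z)"
    \<comment> \<open>The antiderivative carries a minus sign, so the endpoint 0 contributes
      \<open>?K z * h x\<close> with a plus sign.\<close>
    have "(LINT r|lborel. indicator {0..t} r *\<^sub>R ?g r) = - (?K z * h (x - t *\<^sub>R z)) - - (?K z * h (x - 0 *\<^sub>R z))"
    proof (rule integral_FTC_Icc)
      fix r
      have "((\<lambda>r. h (x + r *\<^sub>R (- z))) has_vector_derivative frechet_derivative h (at (x + r *\<^sub>R (- z))) (- z)) (at r within {0..t})"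
        by (rule has_vector_derivative_along_line) (rule test_differentiable[OF h])
      then have "((\<lambda>r. - (?K z * h (x - r *\<^sub>R z))) has_vector_derivative
          - (?K z * (\<Sum>k\<in>UNIV. of_real (- z $ k) * partial_deriv k h (x - r *\<^sub>R z)))) (at r within {0..t})"
        by (auto intro!: derivative_eq_intros simp: frechet_derivative_partial_deriv test_differentiable[OF h])
      moreover have "- (?K z * (\<Sum>k\<in>UNIV. of_real (- z $ k) * partial_deriv k h (x - r *\<^sub>R z))) = ?g r"
      proof -
        have "- (?K z * (of_real (- z $ k) * partial_deriv k h (x - r *\<^sub>R z))) = K (dL k) z * D_op k h (x - r *\<^sub>R z)" for k
        proof -
          have "- (?K z * (of_real (- z $ k) * partial_deriv k h (x - r *\<^sub>R z))) = (of_real (z $ k) * ?K z) * partial_deriv k h (x - r *\<^sub>R z)"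
            by simp
          then show ?thesis unfolding K_one_coord by (simp add: D_op_def)
        qed
        then show ?thesis by (simp add: sum_distrib_left flip: sum_negf)
      qed
      ultimately show "((\<lambda>r. - (?K z * h (x - r *\<^sub>R z))) has_vector_derivative ?g r) (at r within {0..t})"
        by simp
    next
      show "continuous_on {0..t} ?g"
        by (intro continuous_intros continuous_on_compose2[OF test_continuous[OF test_D_op[OF h], of UNIV]]) auto
    qed (use t in auto)
    moreover have "indicator {0..t} r *\<^sub>R ?g r = (\<Sum>k\<in>UNIV. indicator {0..t} r * K (dL k) z * D_op k h (x - r *\<^sub>R z))" for r
      by (simp add: indicator_def)
    ultimately show ?thesis by simp
  qed
  have pair: "integrable (lborel \<Otimes>\<^sub>M lborel) (\<lambda>w. indicator {0..t} (fst w) * K (dL k) (snd w) * D_op k h (x - fst w *\<^sub>R snd w))" for k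
  proof (rule kernel_test_integrable)
    show "integrable (lborel \<Otimes>\<^sub>M lborel) (\<lambda>w. indicator {0..t} (fst w) * K (dL k) (snd w))"
      by (intro pair_kernel_integrable K_integrable poly_fun_dL integrable_indicator_Icc)
    show "D_op k h \<in> test_functions" by (rule test_D_op[OF h])
  qed measurable
  have pair': "integrable (lborel \<Otimes>\<^sub>M lborel) (\<lambda>(r, z). \<Sum>k\<in>UNIV. indicator {0..t} r * K (dL k) z * D_op k h (x - r *\<^sub>R z))"
    using Bochner_Integration.integrable_sum[where I=UNIV, OF pair] by (simp add: case_prod_beta')
  have "(LINT z|lborel. ?K z) * h x = (LINT z|lborel. ?K z * h x)"
    by simp
  also have "\<dots> = (LINT z|lborel. ?K z * h (x - t *\<^sub>R z)
      + (LINT r|lborel. (\<Sum>k\<in>UNIV. indicator {0..t} r * K (dL k) z * D_op k h (x - r *\<^sub>R z))))"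
    by (simp only: ftc[symmetric])
  also have "\<dots> = (LINT z|lborel. ?K z * h (x - t *\<^sub>R z))
      + (LINT z|lborel. LINT r|lborel. (\<Sum>k\<in>UNIV. indicator {0..t} r * K (dL k) z * D_op k h (x - r *\<^sub>R z)))"
    by (intro Bochner_Integration.integral_add K_test_integrable poly_fun_const h lborel_pair.integrable_snd[OF pair'])
  also have "(LINT z|lborel. LINT r|lborel. (\<Sum>k\<in>UNIV. indicator {0..t} r * K (dL k) z * D_op k h (x - r *\<^sub>R z)))
      = (LINT r|lborel. LINT z|lborel. (\<Sum>k\<in>UNIV. indicator {0..t} r * K (dL k) z * D_op k h (x - r *\<^sub>R z)))"
    by (rule lborel_pair.Fubini_integral[OF pair'])
  also have "\<dots> = (LINT r|lborel. indicator {0..t} r * (\<Sum>k\<in>UNIV. LINT z|lborel. K (dL k) z * D_op k h (x - r *\<^sub>R z)))"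
  proof (rule Bochner_Integration.integral_cong)
    fix r
    show "(LINT z|lborel. (\<Sum>k\<in>UNIV. indicator {0..t} r * K (dL k) z * D_op k h (x - r *\<^sub>R z)))
      = indicator {0..t} r * (\<Sum>k\<in>UNIV. LINT z|lborel. K (dL k) z * D_op k h (x - r *\<^sub>R z))"
      using K_test_integrable[OF poly_fun_dL test_D_op[OF h]]
      by (simp add: mult.assoc sum_distrib_left)
  qed simp
  finally show ?thesis .
qed

text \<open>Moving each \<open>D_op k\<close> onto its kernel multiplies the symbol by
  \<open>\<xi> $ k\<close>; the resulting sum of symbols is \<open>m\<close> times \<open>L\<close>
  by Euler's identity.\<close>

lemma K_euler:
  assumes h: "h \<in> test_functions" and r: "r > 0"
  shows "of_real r * (\<Sum>k\<in>UNIV. LINT z|lborel. K (dL k) z * D_op k h (x - r *\<^sub>R z))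
    = of_nat m * (LINT z|lborel. K (\<lambda>\<xi>. of_real (L \<xi>)) z * h (x - r *\<^sub>R z))"
proof -
  have p: "poly_fun (\<lambda>\<xi>. of_real (\<xi> $ k) * dL k \<xi>)" for k
    by (intro poly_fun_mult poly_fun_coord poly_fun_dL)
  have "of_real r * (\<Sum>k\<in>UNIV. LINT z|lborel. K (dL k) z * D_op k h (x - r *\<^sub>R z))
      = (\<Sum>k\<in>UNIV. LINT z|lborel. K (\<lambda>\<xi>. of_real (\<xi> $ k) * dL k \<xi>) z * h (x - r *\<^sub>R z))"
    by (simp add: sum_distrib_left K_transfer[OF poly_fun_dL h r])
  also have "\<dots> = (LINT z|lborel. K (\<lambda>\<xi>. \<Sum>k\<in>UNIV. of_real (\<xi> $ k) * dL k \<xi>) z * h (x - r *\<^sub>R z))"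
    using p by (simp add: K_sum sum_distrib_right K_test_integrable h)
  also have "(\<lambda>\<xi>. \<Sum>k\<in>UNIV. of_real (\<xi> $ k) * dL k \<xi>) = (\<lambda>\<xi>. of_nat m * of_real (L \<xi>))"
    unfolding dL_def by (intro ext poly_fun_euler poly_L) (simp add: hom_L)
  finally show ?thesis by (simp add: K_cmult mult.assoc)
qed

end

section \<open>Elliptic systems\<close>

locale elliptic_system =
  fixes l :: nat and J :: "'j set" and P :: "'j \<Rightarrow> 'n::{finite,linorder} diffop"
  assumes order: "system_of_order l J P" and ell: "elliptic l J P" and l_pos: "l > 0"
begin

definition Lsym where
  "Lsym \<xi> = (\<Sum>j\<in>J. (norm (principal_symbol l (P j) \<xi>))\<^sup>2)"

lemma finite_J: "finite J"
  using order by (simp add: system_of_order_def)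

lemma Lsym_complex:
  "complex_of_real (Lsym \<xi>) = (\<Sum>j\<in>J. principal_symbol l (P j) \<xi> * cnj (principal_symbol l (P j) \<xi>))"
  unfolding Lsym_def of_real_sum by (intro sum.cong refl complex_norm_square)

text \<open>Positivity off the origin is where ellipticity enters the kernel construction; squaring
  the moduli doubles the degree.\<close>

sublocale elliptic_symbol Lsym "2 * l"
proof
  show "poly_fun (\<lambda>\<xi>. complex_of_real (Lsym \<xi>))"
    unfolding Lsym_complex by (intro poly_fun_sum poly_fun_mult poly_fun_cnj poly_fun_principal_symbol)
  show "Lsym (t *\<^sub>R \<xi>) = t ^ (2 * l) * Lsym \<xi>" for t \<xi>
  proof -
    have "(\<bar>t\<bar> ^ l)\<^sup>2 = t ^ (2 * l)"
      by (simp add: power_mult[symmetric] mult.commute[of l] power_even_abs)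
    then show ?thesis
      unfolding Lsym_def principal_symbol_scaleR norm_mult norm_power norm_of_real power_mult_distrib sum_distrib_left
      by (simp only:)
  qed
  show "Lsym \<xi> > 0" if nz: "\<xi> \<noteq> 0" for \<xi>
  proof -
    obtain j where "j \<in> J" "principal_symbol l (P j) \<xi> \<noteq> 0"
      using ell nz by (auto simp: elliptic_def)
    then show ?thesis
      unfolding Lsym_def by (intro sum_pos2[OF finite_J]) auto
  qed
  show "2 * l > 0" using l_pos by simp
qed

section \<open>Transfer of multi-index derivatives and of principal parts\<close>

lemma K_transfer_power:
  assumes F: "F \<in> test_functions" and r: "r > 0"
  shows "poly_fun q \<Longrightarrow> of_real r ^ a * (LINT z|lborel. K q z * (D_op k ^^ a) F (x - r *\<^sub>R z))
    = (LINT z|lborel. K (\<lambda>\<xi>. of_real (\<xi> $ k) ^ a * q \<xi>) z * F (x - r *\<^sub>R z))"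
proof (induction a arbitrary: q)
  case (Suc a)
  have p: "poly_fun (\<lambda>\<xi>. of_real (\<xi> $ k) * q \<xi>)"
    by (intro poly_fun_mult poly_fun_coord Suc.prems)
  have "of_real r ^ Suc a * (LINT z|lborel. K q z * (D_op k ^^ Suc a) F (x - r *\<^sub>R z))
      = of_real r ^ a * (of_real r * (LINT z|lborel. K q z * D_op k ((D_op k ^^ a) F) (x - r *\<^sub>R z)))"
    by (simp add: mult_ac)
  also have "\<dots> = of_real r ^ a * (LINT z|lborel. K (\<lambda>\<xi>. of_real (\<xi> $ k) * q \<xi>) z * (D_op k ^^ a) F (x - r *\<^sub>R z))"
    by (simp only: K_transfer[OF Suc.prems test_D_op_pow[OF F] r])
  also have "\<dots> = (LINT z|lborel. K (\<lambda>\<xi>. of_real (\<xi> $ k) ^ a * (of_real (\<xi> $ k) * q \<xi>)) z * F (x - r *\<^sub>R z))"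
    by (rule Suc.IH[OF p])
  finally show ?case by (simp add: mult_ac)
qed simp

lemma K_transfer_list:
  assumes F: "F \<in> test_functions" and r: "r > 0"
  shows "poly_fun q \<Longrightarrow>
    of_real r ^ (\<Sum>k\<leftarrow>ks. Poly_Mapping.lookup \<alpha> k) * (LINT z|lborel. K q z * D_list ks \<alpha> F (x - r *\<^sub>R z))
    = (LINT z|lborel. K (\<lambda>\<xi>. (\<Prod>k\<leftarrow>ks. of_real (\<xi> $ k) ^ Poly_Mapping.lookup \<alpha> k) * q \<xi>) z * F (x - r *\<^sub>R z))"
proof (induction ks arbitrary: q)
  case (Cons k ks)
  let ?a = "Poly_Mapping.lookup \<alpha> k" and ?s = "\<Sum>k\<leftarrow>ks. Poly_Mapping.lookup \<alpha> k"
  have p: "poly_fun (\<lambda>\<xi>. of_real (\<xi> $ k) ^ ?a * q \<xi>)"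
    by (intro poly_fun_mult poly_fun_power poly_fun_coord Cons.prems)
  have "of_real r ^ (\<Sum>k\<leftarrow>k # ks. Poly_Mapping.lookup \<alpha> k) * (LINT z|lborel. K q z * D_list (k # ks) \<alpha> F (x - r *\<^sub>R z))
      = of_real r ^ ?s * (of_real r ^ ?a * (LINT z|lborel. K q z * (D_op k ^^ ?a) (D_list ks \<alpha> F) (x - r *\<^sub>R z)))"
    by (simp add: power_add mult_ac)
  also have "\<dots> = of_real r ^ ?s * (LINT z|lborel. K (\<lambda>\<xi>. of_real (\<xi> $ k) ^ ?a * q \<xi>) z * D_list ks \<alpha> F (x - r *\<^sub>R z))"
    by (simp only: K_transfer_power[OF test_D_list[OF F] r Cons.prems])
  also have "\<dots> = (LINT z|lborel. K (\<lambda>\<xi>. (\<Prod>k\<leftarrow>ks. of_real (\<xi> $ k) ^ Poly_Mapping.lookup \<alpha> k) * (of_real (\<xi> $ k) ^ ?a * q \<xi>)) z * F (x - r *\<^sub>R z))"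
    by (rule Cons.IH[OF p])
  finally show ?case by (simp add: mult_ac)
qed simp

lemma K_transfer_multi:
  assumes q: "poly_fun q" and F: "F \<in> test_functions" and r: "r > 0"
  shows "of_real r ^ mdeg \<alpha> * (LINT z|lborel. K q z * D_multi \<alpha> F (x - r *\<^sub>R z))
    = (LINT z|lborel. K (\<lambda>\<xi>. monom_fun \<alpha> \<xi> * q \<xi>) z * F (x - r *\<^sub>R z))"
proof -
  have s: "(\<Sum>k\<leftarrow>sorted_list_of_set UNIV. Poly_Mapping.lookup \<alpha> k) = mdeg \<alpha>"
    unfolding mdeg_def by (subst sum_list_distinct_conv_sum_set) auto
  have p: "(\<Prod>k\<leftarrow>sorted_list_of_set UNIV. complex_of_real (\<xi> $ k) ^ Poly_Mapping.lookup \<alpha> k) = monom_fun \<alpha> \<xi>" for \<xi>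
    unfolding monom_fun_def by (subst prod.distinct_set_conv_list[symmetric]) auto
  show ?thesis
    using K_transfer_list[OF F r q, where ks="sorted_list_of_set UNIV" and \<alpha>=\<alpha>]
    by (simp only: s p D_multi_eq_D_list)
qed

text \<open>All terms have degree \<open>m\<close>, so a common power of \<open>r\<close> comes out.
  Hence only homogeneous parts are transferred, and lower order terms are treated separately
  later.\<close>

lemma K_transfer_hom_part:
  assumes q: "poly_fun q" and F: "F \<in> test_functions" and r: "r > 0"
  shows "of_real r ^ m * (LINT z|lborel. K q z * hom_part m T F (x - r *\<^sub>R z))
    = (LINT z|lborel. K (\<lambda>\<xi>. principal_symbol m T \<xi> * q \<xi>) z * F (x - r *\<^sub>R z))"
proof -
  let ?A = "{\<alpha> :: 'n \<Rightarrow>\<^sub>0 nat. mdeg \<alpha> = m}" and ?c = "Poly_Mapping.lookup T"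
  have p: "poly_fun (\<lambda>\<xi>. monom_fun \<alpha> \<xi> * q \<xi>)" for \<alpha>
    by (intro poly_fun_mult poly_fun_monom q)
  have "of_real r ^ m * (LINT z|lborel. K q z * hom_part m T F (x - r *\<^sub>R z))
      = of_real r ^ m * (LINT z|lborel. (\<Sum>\<alpha>\<in>?A. ?c \<alpha> * (K q z * D_multi \<alpha> F (x - r *\<^sub>R z))))"
    by (simp add: hom_part_def sum_distrib_left mult_ac)
  also have "\<dots> = of_real r ^ m * (\<Sum>\<alpha>\<in>?A. ?c \<alpha> * (LINT z|lborel. K q z * D_multi \<alpha> F (x - r *\<^sub>R z)))"
    by (subst Bochner_Integration.integral_sum) (auto intro!: integrable_mult_right K_test_integrable q test_D_multi F)
  also have "\<dots> = (\<Sum>\<alpha>\<in>?A. ?c \<alpha> * (of_real r ^ mdeg \<alpha> * (LINT z|lborel. K q z * D_multi \<alpha> F (x - r *\<^sub>R z))))"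
    unfolding sum_distrib_left by (intro sum.cong) (auto simp: mult_ac)
  also have "\<dots> = (\<Sum>\<alpha>\<in>?A. LINT z|lborel. ?c \<alpha> * K (\<lambda>\<xi>. monom_fun \<alpha> \<xi> * q \<xi>) z * F (x - r *\<^sub>R z))"
    by (simp only: K_transfer_multi[OF q F r] mult.assoc integral_mult_right_zero)
  also have "\<dots> = (LINT z|lborel. (\<Sum>\<alpha>\<in>?A. ?c \<alpha> * K (\<lambda>\<xi>. monom_fun \<alpha> \<xi> * q \<xi>) z * F (x - r *\<^sub>R z)))"
    by (subst Bochner_Integration.integral_sum) (auto simp: mult.assoc intro!: integrable_mult_right K_test_integrable p F)
  also have "\<dots> = (LINT z|lborel. K (\<lambda>\<xi>. \<Sum>\<alpha>\<in>?A. ?c \<alpha> * (monom_fun \<alpha> \<xi> * q \<xi>)) z * F (x - r *\<^sub>R z))"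
    by (subst K_sum) (auto intro!: poly_fun_cmult p simp: K_cmult sum_distrib_right)
  finally show ?thesis
    by (simp add: principal_symbol_monom sum_distrib_right mult.assoc)
qed

text \<open>What stays on the kernel once the factor \<open>principal_symbol l (P j)\<close> of
  \<open>Lsym\<close> has been returned to \<open>f\<close> as an operator.\<close>

definition dual_symbol where
  "dual_symbol j \<beta> \<xi> = monom_fun \<beta> \<xi> * cnj (principal_symbol l (P j) \<xi>)"

lemma poly_fun_dual_symbol: "poly_fun (dual_symbol j \<beta>)"
  unfolding dual_symbol_def[abs_def] by (intro poly_fun_mult poly_fun_monom poly_fun_cnj poly_fun_principal_symbol)

text \<open>Splitting \<open>Lsym\<close> into products, the principal symbol goes back to
  \<open>f\<close> at the cost of \<open>r\<close> to the power \<open>l\<close>, and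
  \<open>D_multi \<beta>\<close> goes onto the kernel, recovering \<open>mdeg \<beta>\<close>
  powers. One more power cancels the \<open>r\<close> of \<open>K_euler\<close>. The exponent is
  nonnegative since \<open>mdeg \<beta> < l\<close>, so nothing is singular at 0.\<close>

lemma K_euler_system:
  assumes f: "f \<in> test_functions" and \<beta>: "mdeg \<beta> < l" and r: "r > 0"
  shows "(\<Sum>k\<in>UNIV. LINT z|lborel. K (dL k) z * D_op k (D_multi \<beta> f) (x - r *\<^sub>R z))
    = (\<Sum>j\<in>J. of_nat (2 * l) * of_real r ^ (l - 1 - mdeg \<beta>) * (LINT z|lborel. K (dual_symbol j \<beta>) z * hom_part l (P j) f (x - r *\<^sub>R z)))"
    (is "?S = _")
proof -
  let ?Q = "\<lambda>j. principal_symbol l (P j)" and ?e = "l - 1 - mdeg \<beta>"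
  have l: "l = Suc (?e + mdeg \<beta>)" using \<beta> by simp
  have c: "poly_fun (\<lambda>\<xi>. cnj (?Q j \<xi>))" for j
    by (intro poly_fun_cnj poly_fun_principal_symbol)
  have p: "poly_fun (\<lambda>\<xi>. ?Q j \<xi> * cnj (?Q j \<xi>))" for j
    by (intro poly_fun_mult c poly_fun_principal_symbol)
  note h = test_D_multi[OF f, of \<beta>]
  have trm: "(LINT z|lborel. K (\<lambda>\<xi>. ?Q j \<xi> * cnj (?Q j \<xi>)) z * D_multi \<beta> f (x - r *\<^sub>R z))
      = of_real r * of_real r ^ ?e * (LINT z|lborel. K (dual_symbol j \<beta>) z * hom_part l (P j) f (x - r *\<^sub>R z))" for j
  proof -
    have "(LINT z|lborel. K (\<lambda>\<xi>. ?Q j \<xi> * cnj (?Q j \<xi>)) z * D_multi \<beta> f (x - r *\<^sub>R z))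
        = of_real r ^ l * (LINT z|lborel. K (\<lambda>\<xi>. cnj (?Q j \<xi>)) z * hom_part l (P j) (D_multi \<beta> f) (x - r *\<^sub>R z))"
      by (rule K_transfer_hom_part[OF c h r, symmetric])
    also have "\<dots> = of_real r * of_real r ^ ?e * (of_real r ^ mdeg \<beta> * (LINT z|lborel. K (\<lambda>\<xi>. cnj (?Q j \<xi>)) z * D_multi \<beta> (hom_part l (P j) f) (x - r *\<^sub>R z)))"
      by (subst (1) l) (simp add: hom_part_D_multi[OF f] power_add mult_ac)
    also have "of_real r ^ mdeg \<beta> * (LINT z|lborel. K (\<lambda>\<xi>. cnj (?Q j \<xi>)) z * D_multi \<beta> (hom_part l (P j) f) (x - r *\<^sub>R z))
        = (LINT z|lborel. K (dual_symbol j \<beta>) z * hom_part l (P j) f (x - r *\<^sub>R z))"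
      unfolding dual_symbol_def[abs_def] by (rule K_transfer_multi[OF c test_hom_part[OF f] r])
    finally show ?thesis .
  qed
  have "of_real r * ?S = of_nat (2 * l) * (LINT z|lborel. K (\<lambda>\<xi>. of_real (Lsym \<xi>)) z * D_multi \<beta> f (x - r *\<^sub>R z))"
    by (rule K_euler[OF h r])
  also have "\<dots> = of_nat (2 * l) * (\<Sum>j\<in>J. LINT z|lborel. K (\<lambda>\<xi>. ?Q j \<xi> * cnj (?Q j \<xi>)) z * D_multi \<beta> f (x - r *\<^sub>R z))"
    unfolding Lsym_complex using p by (simp add: K_sum sum_distrib_right K_test_integrable h)
  also have "\<dots> = of_real r * (\<Sum>j\<in>J. of_nat (2 * l) * of_real r ^ ?e * (LINT z|lborel. K (dual_symbol j \<beta>) z * hom_part l (P j) f (x - r *\<^sub>R z)))"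
    unfolding trm sum_distrib_left by (intro sum.cong) (auto simp: mult_ac)
  finally show ?thesis using r by simp
qed

definition radial_weight where
  "radial_weight \<beta> t r = (indicator {0..t} r * (of_nat (2 * l) * of_real r ^ (l - 1 - mdeg \<beta>)) :: complex)"

lemma radial_weight_le:
  assumes "0 < t" "t \<le> 1" shows "norm (radial_weight \<beta> t r) \<le> 2 * real l * indicator {0..t} r"
proof (cases "r \<in> {0..t}")
  case True
  then have "norm (of_real r :: complex) ^ (l - 1 - mdeg \<beta>) \<le> 1"
    using assms by (intro power_le_one) auto
  with True show ?thesis by (simp add: radial_weight_def norm_mult norm_power mult_left_le)
qed (simp add: radial_weight_def)

lemma radial_weight_integrable:
  assumes "0 < t" "t \<le> 1" shows "integrable lborel (radial_weight \<beta> t)"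
proof (rule Bochner_Integration.integrable_bound)
  show "integrable lborel (\<lambda>r. 2 * real l * indicator {0..t} r)"
    using assms by (intro integrable_mult_right integrable_real_indicator) auto
  show "radial_weight \<beta> t \<in> borel_measurable lborel"
    unfolding radial_weight_def[abs_def] by measurable
qed (use radial_weight_le[OF assms] in \<open>auto intro!: AE_I2 simp: abs_of_nonneg\<close>)

text \<open>\<open>K_representation\<close> for \<open>D_multi \<beta> f\<close>, with the inner sum
  rewritten by \<open>K_euler_system\<close>. The radial and spatial integrals are joined into one
  over pairs, the form required by \<open>Lp_norm_average\<close>.\<close>

lemma kernel_identity:
  assumes f: "f \<in> test_functions" and \<beta>: "mdeg \<beta> < l" and t: "0 < t" "t \<le> 1"
  shows "(LINT z|lborel. K (\<lambda>_. 1) z) * D_multi \<beta> f x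
    = (LINT z|lborel. K (\<lambda>_. 1) z * D_multi \<beta> f (x - t *\<^sub>R z))
    + (\<Sum>j\<in>J. LINT w|(lborel \<Otimes>\<^sub>M lborel). (radial_weight \<beta> t (fst w) * K (dual_symbol j \<beta>) (snd w)) * hom_part l (P j) f (x - fst w *\<^sub>R snd w))"
proof -
  let ?G = "\<lambda>j r. radial_weight \<beta> t r * (LINT z|lborel. K (dual_symbol j \<beta>) z * hom_part l (P j) f (x - r *\<^sub>R z))"
  let ?H = "\<lambda>r. indicator {0..t} r * (\<Sum>k\<in>UNIV. LINT z|lborel. K (dL k) z * D_op k (D_multi \<beta> f) (x - r *\<^sub>R z))"
  have pair: "integrable (lborel \<Otimes>\<^sub>M lborel) (\<lambda>w. (radial_weight \<beta> t (fst w) * K (dual_symbol j \<beta>) (snd w)) * hom_part l (P j) f (x - fst w *\<^sub>R snd w))" for j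
    by (intro kernel_test_integrable pair_kernel_integrable radial_weight_integrable t K_integrable poly_fun_dual_symbol test_hom_part f) measurable
  have pair': "integrable (lborel \<Otimes>\<^sub>M lborel) (\<lambda>(r, z). (radial_weight \<beta> t r * K (dual_symbol j \<beta>) z) * hom_part l (P j) f (x - r *\<^sub>R z))" for j
    using pair[of j] by (simp add: case_prod_beta')
  have G: "(LINT z|lborel. (radial_weight \<beta> t r * K (dual_symbol j \<beta>) z) * hom_part l (P j) f (x - r *\<^sub>R z)) = ?G j r" for j r
    by (simp add: mult.assoc)
  have Gint: "integrable lborel (?G j)" for j
    using lborel_pair.integrable_fst[OF pair'[of j]] by (simp only: G)
  have Gval: "(LINT r|lborel. ?G j r)
      = (LINT w|(lborel \<Otimes>\<^sub>M lborel). (radial_weight \<beta> t (fst w) * K (dual_symbol j \<beta>) (snd w)) * hom_part l (P j) f (x - fst w *\<^sub>R snd w))" for j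
    using lborel_pair.integral_fst[OF pair'[of j]] by (simp only: G) (simp add: case_prod_beta')
  \<comment> \<open>\<open>K_euler_system\<close> requires \<open>r > 0\<close>. For negative
    \<open>r\<close> both sides vanish by the indicator, and the point 0 is a null set.\<close>
  have "?H r = (\<Sum>j\<in>J. ?G j r)" if "r \<noteq> 0" for r
  proof (cases "r > 0")
    case True
    show ?thesis
      unfolding K_euler_system[OF f \<beta> True] by (simp add: radial_weight_def sum_distrib_left mult_ac)
  qed (use that in \<open>simp add: radial_weight_def\<close>)
  moreover have "AE r in lborel. r \<noteq> (0::real)"
    by (rule AE_lborel_singleton)
  ultimately have ae: "AE r in lborel. ?H r = (\<Sum>j\<in>J. ?G j r)"
    by (auto elim: eventually_mono)
  have "(LINT r|lborel. ?H r) = (LINT r|lborel. (\<Sum>j\<in>J. ?G j r))"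
  proof (rule integral_cong_AE)
    have [measurable]: "K (dL k) \<in> borel_measurable borel" "D_op k (D_multi \<beta> f) \<in> borel_measurable borel" for k
      by (intro K_measurable poly_fun_dL test_measurable test_D_op test_D_multi f)+
    show "?H \<in> borel_measurable lborel" by measurable
    show "(\<lambda>r. \<Sum>j\<in>J. ?G j r) \<in> borel_measurable lborel"
      using Gint by (intro borel_measurable_sum) auto
  qed (rule ae)
  also have "\<dots> = (\<Sum>j\<in>J. LINT r|lborel. ?G j r)"
    by (rule Bochner_Integration.integral_sum) (rule Gint)
  finally show ?thesis
    using K_representation[OF test_D_multi[OF f] t(1), of \<beta> x] by (simp only: Gval)
qed

end

section \<open>Bounding \<open>f\<close> by a first order operator\<close>

lemma Lp_norm_diff:
  assumes p: "p \<ge> 1" and u: "Lp_class u" and v: "Lp_class v"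
  shows "Lp_norm p (\<lambda>x. u x - v x) \<le> Lp_norm p u + Lp_norm p v"
  using Lp_norm_triangle[OF p u Lp_class_cmult[OF v, of "- 1"]] Lp_norm_cmult_le[OF p v, of "- 1"] by simp

text \<open>The derivative of \<open>exp (- s) * f (x + s *\<^sub>R axis u 1)\<close> in
  \<open>s\<close> is \<open>\<i> * exp (- s)\<close> times the translate of \<open>?h\<close>.
  Integration over the unit interval expresses \<open>f\<close> by \<open>exp (- 1)\<close> times a
  translate of \<open>f\<close> and an average of \<open>?h\<close>. As
  \<open>exp (- 1) \<le> 1 / 2\<close>, the first term is absorbed, whence the factor 2.\<close>

lemma Lp_norm_le_D_op_plus_i:
  assumes p: "p \<ge> 1" and f: "f \<in> test_functions"
  shows "Lp_norm p f \<le> 2 * Lp_norm p (\<lambda>x. D_op u f x + \<i> * f x)"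
proof -
  let ?h = "\<lambda>x. D_op u f x + \<i> * f x" and ?e = "axis u 1"
  have h: "?h \<in> test_functions"
    by (intro test_add test_cmult test_D_op f)
  \<comment> \<open>A point mass on \<open>unit\<close> makes the single translate an instance of
    the averaging lemmas.\<close>
  let ?k1 = "\<lambda>_ :: unit. complex_of_real (exp (- 1))" and ?k2 = "\<lambda>s. indicator {0..1} s * (- \<i> * complex_of_real (exp (- s)))"
  let ?F1 = "\<lambda>x. LINT w|count_space UNIV. ?k1 w * f (x - (- ?e))"
  let ?F2 = "\<lambda>x. LINT s|lborel. ?k2 s * ?h (x - (- s) *\<^sub>R ?e)"
  have k2: "norm (?k2 s) \<le> indicator {0..1} s" for s
    by (auto simp: norm_mult indicator_def)
  have ind: "integrable lborel (indicator {0..1::real} :: real \<Rightarrow> real)"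
    by (rule integrable_real_indicator) auto
  have k2_int: "integrable lborel ?k2"
    by (rule Bochner_Integration.integrable_bound[OF ind]) (use k2 in \<open>auto intro!: AE_I2 simp: abs_of_nonneg\<close>)
  have F1: "?F1 x = of_real (exp (- 1)) * f (x + ?e)" for x
    by (simp add: lebesgue_integral_count_space_finite UNIV_unit)
  have "f x = ?F1 x + ?F2 x" for x
  proof -
    let ?g = "\<lambda>s. complex_of_real (exp (- s)) * (\<i> * ?h (x + s *\<^sub>R ?e))"
    have "(LINT s|lborel. indicator {0..1} s *\<^sub>R ?g s)
        = of_real (exp (- 1)) * f (x + 1 *\<^sub>R ?e) - of_real (exp (- 0)) * f (x + 0 *\<^sub>R ?e)"
    proof (rule integral_FTC_Icc)
      fix s
      have "((\<lambda>s. f (x + s *\<^sub>R ?e)) has_vector_derivative partial_deriv u f (x + s *\<^sub>R ?e)) (at s within {0..1})"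
        unfolding partial_deriv_def by (rule has_vector_derivative_along_line) (rule test_differentiable[OF f])
      moreover have "((\<lambda>s. complex_of_real (exp (- s))) has_vector_derivative complex_of_real (- exp (- s))) (at s within {0..1})"
        by (rule has_vector_derivative_of_real)
           (auto intro!: derivative_eq_intros simp: has_real_derivative_iff_has_vector_derivative[symmetric])
      ultimately have "((\<lambda>s. of_real (exp (- s)) * f (x + s *\<^sub>R ?e)) has_vector_derivative
          of_real (exp (- s)) * partial_deriv u f (x + s *\<^sub>R ?e) + of_real (- exp (- s)) * f (x + s *\<^sub>R ?e)) (at s within {0..1})"
        by (rule has_vector_derivative_mult[rotated])
      moreover have "of_real (exp (- s)) * partial_deriv u f (x + s *\<^sub>R ?e) + of_real (- exp (- s)) * f (x + s *\<^sub>R ?e) = ?g s"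
        by (simp add: D_op_def algebra_simps)
      ultimately show "((\<lambda>s. of_real (exp (- s)) * f (x + s *\<^sub>R ?e)) has_vector_derivative ?g s) (at s within {0..1})"
        by simp
    next
      show "continuous_on {0..1} ?g"
        by (intro continuous_intros continuous_on_compose2[OF test_continuous[OF h, of UNIV]]) auto
    qed simp
    moreover have "?F2 x = - (LINT s|lborel. indicator {0..1} s *\<^sub>R ?g s)"
      unfolding Bochner_Integration.integral_minus[symmetric]
      by (intro Bochner_Integration.integral_cong) (auto simp: indicator_def)
    ultimately show ?thesis by (simp add: F1)
  qed
  then have eq: "f = (\<lambda>x. ?F1 x + ?F2 x)" by blast
  have cs: "sigma_finite_measure (count_space (UNIV :: unit set))"
    by (rule sigma_finite_measure_count_space_finite) simp
  have ics: "integrable (count_space UNIV) ?k1"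
    by (rule integrable_count_space) simp
  have cl1: "Lp_class ?F1"
    by (rule Lp_class_average[OF cs ics _ test_Lp_class[OF f]]) simp
  have cl2: "Lp_class ?F2"
    by (rule Lp_class_average[OF sigma_finite_lborel k2_int _ test_Lp_class[OF h]]) measurable
  have "Lp_norm p f \<le> Lp_norm p ?F1 + Lp_norm p ?F2"
    by (subst eq) (rule Lp_norm_triangle[OF p cl1 cl2])
  moreover have "Lp_norm p ?F1 \<le> 1 / 2 * Lp_norm p f"
  proof -
    have "Lp_norm p ?F1 \<le> (LINT w|count_space UNIV. norm (?k1 w)) * Lp_norm p f"
      by (rule Lp_norm_average[OF p cs ics _ f]) simp
    also have "(LINT w|count_space UNIV. norm (?k1 w)) = exp (- 1)"
      by (simp add: lebesgue_integral_count_space_finite UNIV_unit)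
    also have "exp (- 1) * Lp_norm p f \<le> 1 / 2 * Lp_norm p f"
      using exp_ge_add_one_self[of 1] by (intro mult_right_mono) (auto simp: exp_minus field_simps)
    finally show ?thesis .
  qed
  moreover have "Lp_norm p ?F2 \<le> Lp_norm p ?h"
  proof -
    have "Lp_norm p ?F2 \<le> (LINT s|lborel. norm (?k2 s)) * Lp_norm p ?h"
      by (rule Lp_norm_average[OF p sigma_finite_lborel k2_int _ h]) measurable
    also have "\<dots> \<le> 1 * Lp_norm p ?h"
    proof (rule mult_right_mono)
      have "(LINT s|lborel. norm (?k2 s)) \<le> (LINT s|lborel. indicator {0..1::real} s)"
        by (intro integral_mono integrable_norm k2_int ind k2)
      then show "(LINT s|lborel. norm (?k2 s)) \<le> 1" by simp
    qed simp
    finally show ?thesis by simp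
  qed
  ultimately show ?thesis by simp
qed

section \<open>A priori estimates for elliptic systems\<close>

lemma apply_op_D_multi_commute:
  assumes f: "f \<in> test_functions"
  shows "apply_op T (D_multi \<gamma> f) = D_multi \<gamma> (apply_op T f)"
proof -
  \<comment> \<open>\<open>D_multi \<gamma>\<close> is the action of a monomial, so commutativity of
    the ring product gives the claim.\<close>
  have "apply_op (Poly_Mapping.single \<gamma> 1) g = D_multi \<gamma> g" for g
    by (simp add: fun_eq_iff apply_op_single)
  then show ?thesis
    by (metis apply_op_mult[OF f] mult.commute)
qed

context elliptic_system begin

text \<open>The order of quantifiers matters: \<open>C\<close> is fixed before \<open>t\<close>,
  while \<open>D\<close> may blow up as \<open>t\<close> tends to 0. Small \<open>t\<close> thus
  makes the coefficient of the top order terms small. Both constants are uniform in \<open>p\<close>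
  and \<open>f\<close>.\<close>

lemma kernel_estimate:
  assumes \<beta>: "mdeg \<beta> < l"
  shows "\<exists>C\<ge>0. \<forall>t. 0 < t \<and> t \<le> 1 \<longrightarrow> (\<exists>D. \<forall>p\<ge>1. \<forall>f\<in>test_functions.
    Lp_norm p (D_multi (\<beta> + \<gamma>) f) \<le> D * Lp_norm p f
      + C * t * (\<Sum>j\<in>J. Lp_norm p (hom_part l (P j) (D_multi \<gamma> f))))"
proof -
  define c where "c = (LINT z|lborel. K (\<lambda>_. 1) z)"
  have c: "c \<noteq> 0" unfolding c_def by (rule K_mass_nonzero)
  have inv: "b = inverse c * d" if "c * b = d" for b d
    using that c by (auto simp: field_simps)
  define \<kappa> where "\<kappa> j = (LINT z|lborel. norm (K (dual_symbol j \<beta>) z))" for j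
  have \<kappa>: "\<kappa> j \<ge> 0" for j by (simp add: \<kappa>_def)
  define C where "C = norm (inverse c) * (2 * real l * (\<Sum>j\<in>J. \<kappa> j))"
  have "C \<ge> 0" by (simp add: C_def sum_nonneg \<kappa>)
  moreover have "\<exists>D. \<forall>p\<ge>1. \<forall>f\<in>test_functions.
    Lp_norm p (D_multi (\<beta> + \<gamma>) f) \<le> D * Lp_norm p f
      + C * t * (\<Sum>j\<in>J. Lp_norm p (hom_part l (P j) (D_multi \<gamma> f)))" if t: "0 < t" "t \<le> 1" for t
  proof -
    let ?m = "mdeg (\<beta> + \<gamma>)" and ?q = "\<lambda>\<xi>. monom_fun (\<beta> + \<gamma>) \<xi> * 1"
    \<comment> \<open>All of \<open>D_multi (\<beta> + \<gamma>)\<close> is moved onto the kernel;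
      the negative power of \<open>t\<close> is the reason why \<open>D\<close> depends on
      \<open>t\<close>.\<close>
    define k where "k z = inverse (of_real t ^ ?m) * K ?q z" for z
    have q: "poly_fun ?q" by (intro poly_fun_mult poly_fun_monom poly_fun_const)
    have k: "integrable lborel k"
      unfolding k_def[abs_def] by (intro integrable_mult_right K_integrable q)
    define kj where "kj j w = radial_weight \<beta> t (fst w) * K (dual_symbol j \<beta>) (snd w)" for j w
    have kj: "integrable (lborel \<Otimes>\<^sub>M lborel) (kj j)" for j
      unfolding kj_def[abs_def] by (intro pair_kernel_integrable radial_weight_integrable t K_integrable poly_fun_dual_symbol)
    have sf: "sigma_finite_measure (lborel \<Otimes>\<^sub>M lborel :: (real \<times> (real^'n::{finite,linorder})) measure)"
      unfolding lborel_prod by (rule sigma_finite_lborel)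
    \<comment> \<open>The factor \<open>t\<close> is the length of the radial interval, on which the
      weight is at most \<open>2 * real l\<close>.\<close>
    have kj_norm: "(LINT w|(lborel \<Otimes>\<^sub>M lborel). norm (kj j w)) \<le> 2 * real l * t * \<kappa> j" for j
    proof -
      have "(LINT w|(lborel \<Otimes>\<^sub>M lborel). norm (kj j w)) = (LINT r|lborel. LINT z|lborel. norm (kj j (r, z)))"
        using lborel_pair.integral_fst'[OF integrable_norm[OF kj[of j]]] by simp
      also have "\<dots> = (LINT r|lborel. norm (radial_weight \<beta> t r)) * \<kappa> j"
        by (simp add: kj_def norm_mult \<kappa>_def)
      also have "\<dots> \<le> (2 * real l * t) * \<kappa> j"
      proof (intro mult_right_mono \<kappa>)
        have ind: "integrable lborel (\<lambda>r. 2 * real l * indicator {0..t} r)"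
          using t by (intro integrable_mult_right integrable_real_indicator) auto
        have "(LINT r|lborel. norm (radial_weight \<beta> t r)) \<le> (LINT r|lborel. 2 * real l * indicator {0..t} r)"
          by (intro integral_mono integrable_norm radial_weight_integrable t ind radial_weight_le)
        also have "\<dots> = 2 * real l * t" using t by simp
        finally show "(LINT r|lborel. norm (radial_weight \<beta> t r)) \<le> 2 * real l * t" .
      qed
      finally show ?thesis .
    qed
    define D where "D = norm (inverse c) * (LINT z|lborel. norm (k z))"
    have "Lp_norm p (D_multi (\<beta> + \<gamma>) f) \<le> D * Lp_norm p f
        + C * t * (\<Sum>j\<in>J. Lp_norm p (hom_part l (P j) (D_multi \<gamma> f)))"
      if p: "p \<ge> 1" and f: "f \<in> test_functions" for p f
    proof -
      let ?u = "\<lambda>j. hom_part l (P j) (D_multi \<gamma> f)"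
      have u: "?u j \<in> test_functions" for j by (intro test_hom_part test_D_multi f)
      let ?A = "\<lambda>x. LINT z|lborel. k z * f (x - t *\<^sub>R z)"
      let ?B = "\<lambda>j x. LINT w|(lborel \<Otimes>\<^sub>M lborel). kj j w * ?u j (x - fst w *\<^sub>R snd w)"
      have "c * D_multi (\<beta> + \<gamma>) f x = ?A x + (\<Sum>j\<in>J. ?B j x)" for x
      proof -
        have "(LINT z|lborel. K (\<lambda>_. 1) z * D_multi \<beta> (D_multi \<gamma> f) (x - t *\<^sub>R z)) = ?A x"
          using K_transfer_multi[OF poly_fun_const[of 1] f t(1), of "\<beta> + \<gamma>" x] t
          by (simp add: D_multi_D_multi[OF f] k_def mult.assoc field_simps)
        then show ?thesis
          using kernel_identity[OF test_D_multi[OF f] \<beta> t, of \<gamma> x]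
          by (simp add: c_def kj_def D_multi_D_multi[OF f])
      qed
      then have "D_multi (\<beta> + \<gamma>) f x = inverse c * (?A x + (\<Sum>j\<in>J. ?B j x))" for x
        by (rule inv)
      then have eq: "D_multi (\<beta> + \<gamma>) f = (\<lambda>x. inverse c * (?A x + (\<Sum>j\<in>J. ?B j x)))" by blast
      have clA: "Lp_class ?A"
        by (rule Lp_class_average[OF sigma_finite_lborel k _ test_Lp_class[OF f]]) measurable
      have clB: "Lp_class (?B j)" for j
        by (rule Lp_class_average[OF sf kj _ test_Lp_class[OF u]]) measurable
      have nA: "Lp_norm p ?A \<le> (LINT z|lborel. norm (k z)) * Lp_norm p f"
        by (rule Lp_norm_average[OF p sigma_finite_lborel k _ f]) measurable
      have nB: "Lp_norm p (?B j) \<le> (2 * real l * t * (\<Sum>j\<in>J. \<kappa> j)) * Lp_norm p (?u j)" if j: "j \<in> J" for j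
      proof -
        have "Lp_norm p (?B j) \<le> (LINT w|(lborel \<Otimes>\<^sub>M lborel). norm (kj j w)) * Lp_norm p (?u j)"
          by (rule Lp_norm_average[OF p sf kj _ u]) measurable
        also have "\<dots> \<le> (2 * real l * t * \<kappa> j) * Lp_norm p (?u j)"
          by (intro mult_right_mono kj_norm) simp
        also have "\<dots> \<le> (2 * real l * t * (\<Sum>j\<in>J. \<kappa> j)) * Lp_norm p (?u j)"
          using t j \<kappa> finite_J by (intro mult_right_mono mult_left_mono member_le_sum) auto
        finally show ?thesis .
      qed
      have "Lp_norm p (D_multi (\<beta> + \<gamma>) f) \<le> norm (inverse c) * Lp_norm p (\<lambda>x. ?A x + (\<Sum>j\<in>J. ?B j x))"
        unfolding eq by (intro Lp_norm_cmult_le p Lp_class_add clA Lp_class_sum clB)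
      also have "\<dots> \<le> norm (inverse c) * (Lp_norm p ?A + Lp_norm p (\<lambda>x. \<Sum>j\<in>J. ?B j x))"
        by (intro mult_left_mono Lp_norm_triangle p clA Lp_class_sum clB norm_ge_zero)
      also have "\<dots> \<le> norm (inverse c) * (Lp_norm p ?A + (\<Sum>j\<in>J. Lp_norm p (?B j)))"
        by (intro mult_left_mono add_left_mono Lp_norm_sum p clB norm_ge_zero)
      also have "\<dots> \<le> norm (inverse c) * ((LINT z|lborel. norm (k z)) * Lp_norm p f
          + (\<Sum>j\<in>J. (2 * real l * t * (\<Sum>j\<in>J. \<kappa> j)) * Lp_norm p (?u j)))"
        by (intro mult_left_mono add_mono nA sum_mono nB norm_ge_zero)
      also have "\<dots> = D * Lp_norm p f + C * t * (\<Sum>j\<in>J. Lp_norm p (?u j))"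
        unfolding D_def C_def sum_distrib_left[symmetric] by (simp add: algebra_simps)
      finally show ?thesis .
    qed
    then show ?thesis by blast
  qed
  ultimately show ?thesis by blast
qed

text \<open>The lower order terms of \<open>P j\<close> are absorbed by taking \<open>t\<close> small in the kernel estimate.\<close>

lemma elliptic_estimate:
  "\<exists>C\<ge>0. \<forall>p\<ge>1. \<forall>f\<in>test_functions. \<forall>\<beta>. mdeg \<beta> < l \<longrightarrow>
    Lp_norm p (D_multi (\<beta> + \<gamma>) f) \<le> C * (Lp_norm p f + (\<Sum>j\<in>J. Lp_norm p (apply_op (P j) (D_multi \<gamma> f))))"
proof -
  let ?B = "{\<beta> :: 'n \<Rightarrow>\<^sub>0 nat. mdeg \<beta> < l}"
  have finB: "finite ?B" by (rule finite_mdeg_less)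
  have "\<forall>\<beta>\<in>?B. \<exists>C\<ge>0. \<forall>t. 0 < t \<and> t \<le> 1 \<longrightarrow> (\<exists>D. \<forall>p\<ge>1. \<forall>f\<in>test_functions.
    Lp_norm p (D_multi (\<beta> + \<gamma>) f) \<le> D * Lp_norm p f
      + C * t * (\<Sum>j\<in>J. Lp_norm p (hom_part l (P j) (D_multi \<gamma> f))))"
    using kernel_estimate by blast
  from bchoice[OF this] obtain C where C': "\<forall>\<beta>\<in>?B. C \<beta> \<ge> 0 \<and> (\<forall>t. 0 < t \<and> t \<le> 1 \<longrightarrow> (\<exists>D. \<forall>p\<ge>1. \<forall>f\<in>test_functions.
    Lp_norm p (D_multi (\<beta> + \<gamma>) f) \<le> D * Lp_norm p f
      + C \<beta> * t * (\<Sum>j\<in>J. Lp_norm p (hom_part l (P j) (D_multi \<gamma> f)))))" ..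
  then have C: "\<And>\<beta>. \<beta> \<in> ?B \<Longrightarrow> C \<beta> \<ge> 0" by simp
  define Cs where "Cs = (\<Sum>\<beta>\<in>?B. C \<beta>)"
  have Cs: "Cs \<ge> 0" unfolding Cs_def by (intro sum_nonneg C)
  define a where "a = (\<Sum>j\<in>J. \<Sum>\<alpha>\<in>?B. norm (Poly_Mapping.lookup (P j) \<alpha>))"
  have a: "a \<ge> 0" by (simp add: a_def sum_nonneg)
  \<comment> \<open>With \<open>a\<close> bounding the lower order coefficients, this makes
    \<open>Cs * t * a \<le> 1 / 2\<close>; the summand 1 keeps the denominator positive and
    \<open>t \<le> 1\<close>.\<close>
  define t where "t = 1 / (2 * (Cs * a + 1))"
  have pos: "Cs * a + 1 \<ge> 1" using Cs a by simp
  have t: "0 < t" "t \<le> 1" "Cs * t * a \<le> 1 / 2"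
    using pos by (auto simp: t_def divide_simps mult_ac)
  have "\<forall>\<beta>\<in>?B. \<exists>D. \<forall>p\<ge>1. \<forall>f\<in>test_functions.
    Lp_norm p (D_multi (\<beta> + \<gamma>) f) \<le> D * Lp_norm p f
      + C \<beta> * t * (\<Sum>j\<in>J. Lp_norm p (hom_part l (P j) (D_multi \<gamma> f)))"
    using C' t(1,2) by simp
  from bchoice[OF this] obtain D where D: "\<forall>\<beta>\<in>?B. \<forall>p\<ge>1. \<forall>f\<in>test_functions.
    Lp_norm p (D_multi (\<beta> + \<gamma>) f) \<le> D \<beta> * Lp_norm p f
      + C \<beta> * t * (\<Sum>j\<in>J. Lp_norm p (hom_part l (P j) (D_multi \<gamma> f)))" ..
  define Ds where "Ds = (\<Sum>\<beta>\<in>?B. D \<beta>)"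
  \<comment> \<open>The factors 2 come from absorbing half of \<open>S\<close>. The numbers
    \<open>D \<beta>\<close> carry no sign; nonnegativity of \<open>G\<close> comes from the second
    entry.\<close>
  define G where "G = max (2 * Ds) (2 * Cs * t)"
  have G: "G \<ge> 0" using Cs t by (simp add: G_def le_max_iff_disj)
  have "Lp_norm p (D_multi (\<beta> + \<gamma>) f) \<le> G * (Lp_norm p f + (\<Sum>j\<in>J. Lp_norm p (apply_op (P j) (D_multi \<gamma> f))))"
    if p: "p \<ge> 1" and f: "f \<in> test_functions" and \<beta>: "mdeg \<beta> < l" for p f \<beta>
  proof -
    \<comment> \<open>Summing over all orders below \<open>l\<close> closes the argument: the lower
      order terms of \<open>P j\<close>, applied to \<open>D_multi \<gamma> f\<close>, are bounded
      by multiples of \<open>S\<close>.\<close>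
    define S where "S = (\<Sum>\<beta>\<in>?B. Lp_norm p (D_multi (\<beta> + \<gamma>) f))"
    let ?g = "D_multi \<gamma> f"
    define A where "A = (\<Sum>j\<in>J. Lp_norm p (apply_op (P j) ?g))"
    have A: "A \<ge> 0" by (simp add: A_def sum_nonneg)
    have g: "?g \<in> test_functions" by (rule test_D_multi[OF f])
    have S_ge: "Lp_norm p (D_multi (\<alpha> + \<gamma>) f) \<le> S" if "\<alpha> \<in> ?B" for \<alpha>
      unfolding S_def using that finB by (intro member_le_sum[of \<alpha> ?B "\<lambda>\<beta>. Lp_norm p (D_multi (\<beta> + \<gamma>) f)"]) auto
    have hom: "Lp_norm p (hom_part l (P j) ?g) \<le> Lp_norm p (apply_op (P j) ?g)
        + (\<Sum>\<alpha>\<in>?B. norm (Poly_Mapping.lookup (P j) \<alpha>)) * S" if j: "j \<in> J" for j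
    proof -
      let ?low = "\<lambda>x. \<Sum>\<alpha>\<in>?B. Poly_Mapping.lookup (P j) \<alpha> * D_multi \<alpha> ?g x"
      have cl: "Lp_class (\<lambda>x. c * D_multi \<alpha> ?g x)" for c \<alpha>
        by (intro test_Lp_class test_cmult test_D_multi g)
      have "mdeg \<alpha> \<le> l" if "\<alpha> \<in> Poly_Mapping.keys (P j)" for \<alpha>
        using order j that by (auto simp: system_of_order_def)
      from apply_op_eq_hom_part[OF this, where f="?g"]
      have "hom_part l (P j) ?g = (\<lambda>x. apply_op (P j) ?g x - ?low x)"
        by (simp add: fun_eq_iff)
      then have "Lp_norm p (hom_part l (P j) ?g) \<le> Lp_norm p (apply_op (P j) ?g) + Lp_norm p ?low"
        using Lp_norm_diff[OF p test_Lp_class[OF test_apply_op[OF g]] Lp_class_sum[OF cl]] by simp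
      also have "Lp_norm p ?low \<le> (\<Sum>\<alpha>\<in>?B. Lp_norm p (\<lambda>x. Poly_Mapping.lookup (P j) \<alpha> * D_multi \<alpha> ?g x))"
        by (intro Lp_norm_sum p cl)
      also have "\<dots> \<le> (\<Sum>\<alpha>\<in>?B. norm (Poly_Mapping.lookup (P j) \<alpha>) * S)"
      proof (rule sum_mono)
        fix \<alpha> assume \<alpha>: "\<alpha> \<in> ?B"
        have "Lp_norm p (\<lambda>x. Poly_Mapping.lookup (P j) \<alpha> * D_multi \<alpha> ?g x)
            \<le> norm (Poly_Mapping.lookup (P j) \<alpha>) * Lp_norm p (D_multi \<alpha> ?g)"
          by (intro Lp_norm_cmult_le p test_Lp_class test_D_multi g)
        also have "\<dots> \<le> norm (Poly_Mapping.lookup (P j) \<alpha>) * S"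
          using S_ge[OF \<alpha>] by (intro mult_left_mono) (auto simp: D_multi_D_multi[OF f])
        finally show "Lp_norm p (\<lambda>x. Poly_Mapping.lookup (P j) \<alpha> * D_multi \<alpha> ?g x)
            \<le> norm (Poly_Mapping.lookup (P j) \<alpha>) * S" .
      qed
      finally show ?thesis by (simp add: sum_distrib_right)
    qed
    have H: "(\<Sum>j\<in>J. Lp_norm p (hom_part l (P j) ?g)) \<le> A + a * S"
      using sum_mono[OF hom] by (simp add: A_def a_def sum.distrib sum_distrib_right)
    have "S \<le> (\<Sum>\<beta>\<in>?B. D \<beta> * Lp_norm p f + C \<beta> * t * (\<Sum>j\<in>J. Lp_norm p (hom_part l (P j) ?g)))"
      unfolding S_def using D p f by (intro sum_mono) blast
    also have "\<dots> = Ds * Lp_norm p f + Cs * t * (\<Sum>j\<in>J. Lp_norm p (hom_part l (P j) ?g))"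
      by (simp add: sum.distrib Ds_def Cs_def sum_distrib_right)
    also have "\<dots> \<le> Ds * Lp_norm p f + Cs * t * (A + a * S)"
      using Cs t by (intro add_left_mono mult_left_mono H) auto
    also have "\<dots> = Ds * Lp_norm p f + Cs * t * A + (Cs * t * a) * S"
      by (simp add: algebra_simps)
    also have "\<dots> \<le> Ds * Lp_norm p f + Cs * t * A + 1 / 2 * S"
      using t by (intro add_left_mono mult_right_mono) (auto simp: S_def sum_nonneg)
    finally have "S \<le> (2 * Ds) * Lp_norm p f + (2 * Cs * t) * A" by simp
    also have "\<dots> \<le> G * Lp_norm p f + G * A"
      using A by (intro add_mono mult_right_mono) (auto simp: G_def)
    finally have "S \<le> G * (Lp_norm p f + A)" by (simp add: distrib_left)
    with S_ge[of \<beta>] \<beta> show ?thesis unfolding A_def by simp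
  qed
  with G show ?thesis by blast
qed

end

section \<open>The system \<open>P\<^sub>j R\<^sub>u\<^sub>v\<close>\<close>

lemma multi_index_split:
  assumes "Poly_Mapping.lookup \<alpha> u \<noteq> (0::nat)"
  shows "\<exists>\<beta>. \<alpha> = \<beta> + Poly_Mapping.single u 1"
proof
  show "\<alpha> = (\<alpha> - Poly_Mapping.single u 1) + Poly_Mapping.single u 1"
    using assms by (intro poly_mapping_eqI) (auto simp: lookup_add lookup_minus lookup_single when_def)
qed

text \<open>For order \<open>l + 1\<close> these are the two cases treated by different means:
  \<open>controlled_pure\<close> and \<open>controlled_mixed\<close>.\<close>

lemma multi_index_cases:
  assumes "\<alpha> \<noteq> (0 :: 'n::finite \<Rightarrow>\<^sub>0 nat)"
  obtains (pure) u where "\<alpha> = Poly_Mapping.single u (mdeg \<alpha>)"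
  | (mixed) \<beta> u v where "u \<noteq> v" "\<alpha> = \<beta> + (Poly_Mapping.single u 1 + Poly_Mapping.single v 1)"
proof -
  obtain u where u: "Poly_Mapping.lookup \<alpha> u \<noteq> 0"
    using assms by (auto simp: poly_mapping_eq_iff fun_eq_iff)
  obtain \<beta> where \<beta>: "\<alpha> = \<beta> + Poly_Mapping.single u 1"
    using multi_index_split[OF u] by blast
  show thesis
  proof (cases "\<exists>v. v \<noteq> u \<and> Poly_Mapping.lookup \<alpha> v \<noteq> 0")
    case True
    then obtain v where v: "v \<noteq> u" "Poly_Mapping.lookup \<beta> v \<noteq> 0"
      by (auto simp: \<beta> lookup_add lookup_single when_def)
    obtain \<beta>' where "\<beta> = \<beta>' + Poly_Mapping.single v 1"
      using multi_index_split[OF v(2)] by blast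
    with \<beta> v(1) show thesis
      by (intro mixed[of u v \<beta>']) (auto simp: add_ac)
  next
    case False
    then have "\<alpha> = Poly_Mapping.single u (Poly_Mapping.lookup \<alpha> u)"
      by (intro poly_mapping_eqI) (auto simp: lookup_single when_def)
    then show thesis by (intro pure[of u]) (metis mdeg_single)
  qed
qed

context elliptic_system begin

section \<open>Operators controlled by the system\<close>

definition sysJ where
  "sysJ = {(j, u :: 'n, v). j \<in> J \<and> u > v}"

lemma finite_sysJ: "finite sysJ"
  by (rule finite_subset[of _ "J \<times> UNIV \<times> UNIV"]) (auto simp: sysJ_def finite_J)

definition control_norm where
  "control_norm p f = (\<Sum>(j, u, v)\<in>sysJ. Lp_norm p (apply_op (P j * R_op u v) f)) + Lp_norm p f"

lemma control_norm_nonneg: "control_norm p f \<ge> 0"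
  unfolding control_norm_def by (intro add_nonneg_nonneg sum_nonneg) auto

text \<open>The constant is uniform in \<open>p\<close> and \<open>f\<close>. Preservation of test
  functions allows \<open>T f\<close> to be inserted into the norm inequalities above.\<close>

definition controlled ::
  "((real^'n::{finite,linorder} \<Rightarrow> complex) \<Rightarrow> real^'n::{finite,linorder} \<Rightarrow> complex) \<Rightarrow> bool" where
  "controlled T \<longleftrightarrow> (\<forall>f\<in>test_functions. T f \<in> test_functions) \<and>
    (\<exists>C\<ge>0. \<forall>p\<ge>1. \<forall>f\<in>test_functions. Lp_norm p (T f) \<le> C * control_norm p f)"

lemma controlled_test: "controlled T \<Longrightarrow> f \<in> test_functions \<Longrightarrow> T f \<in> test_functions"
  by (simp add: controlled_def)

lemma controlledI:
  assumes "\<And>f. f \<in> test_functions \<Longrightarrow> T f \<in> test_functions" "C \<ge> 0"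
    and "\<And>p f. p \<ge> 1 \<Longrightarrow> f \<in> test_functions \<Longrightarrow> Lp_norm p (T f) \<le> C * control_norm p f"
  shows "controlled T"
  using assms unfolding controlled_def by blast

lemma controlled_bound:
  "controlled T \<Longrightarrow> \<exists>C\<ge>0. \<forall>p\<ge>1. \<forall>f\<in>test_functions. Lp_norm p (T f) \<le> C * control_norm p f"
  by (simp add: controlled_def)

lemma controlled_cong:
  assumes "controlled T" "\<And>f. f \<in> test_functions \<Longrightarrow> T' f = T f" shows "controlled T'"
  using assms unfolding controlled_def by auto

lemma controlled_id: "controlled (\<lambda>f. f)"
  by (rule controlledI[where C=1]) (auto simp: control_norm_def intro!: sum_nonneg)

lemma controlled_system:
  assumes "(j, u, v) \<in> sysJ" shows "controlled (\<lambda>f. apply_op (P j * R_op u v) f)"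
proof (rule controlledI[where C=1])
  fix p and f :: "real^'n::{finite,linorder} \<Rightarrow> complex"
  have "Lp_norm p (apply_op (P j * R_op u v) f) \<le> (\<Sum>(j, u, v)\<in>sysJ. Lp_norm p (apply_op (P j * R_op u v) f))"
    using member_le_sum[OF assms, of "\<lambda>(j, u, v). Lp_norm p (apply_op (P j * R_op u v) f)"] finite_sysJ by auto
  then show "Lp_norm p (apply_op (P j * R_op u v) f) \<le> 1 * control_norm p f"
    by (simp add: control_norm_def add_increasing2)
qed (auto intro: test_apply_op)

lemma controlled_add:
  assumes "controlled S" "controlled T" shows "controlled (\<lambda>f x. S f x + T f x)"
proof -
  obtain C where C: "C \<ge> 0" "\<And>p f. p \<ge> 1 \<Longrightarrow> f \<in> test_functions \<Longrightarrow> Lp_norm p (S f) \<le> C * control_norm p f"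
    using controlled_bound[OF assms(1)] by blast
  obtain D where D: "D \<ge> 0" "\<And>p f. p \<ge> 1 \<Longrightarrow> f \<in> test_functions \<Longrightarrow> Lp_norm p (T f) \<le> D * control_norm p f"
    using controlled_bound[OF assms(2)] by blast
  show ?thesis
  proof (rule controlledI[where C="C + D"])
    fix p :: ennreal and f :: "real^'n::{finite,linorder} \<Rightarrow> complex"
    assume pf: "p \<ge> 1" "f \<in> test_functions"
    have "Lp_norm p (\<lambda>x. S f x + T f x) \<le> Lp_norm p (S f) + Lp_norm p (T f)"
      using pf by (intro Lp_norm_triangle test_Lp_class controlled_test[OF assms(1)] controlled_test[OF assms(2)])
    with C(2)[OF pf] D(2)[OF pf] show "Lp_norm p (\<lambda>x. S f x + T f x) \<le> (C + D) * control_norm p f"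
      by (simp add: distrib_right)
  qed (use C D in \<open>auto intro: test_add controlled_test[OF assms(1)] controlled_test[OF assms(2)]\<close>)
qed

lemma controlled_cmult:
  assumes "controlled T" shows "controlled (\<lambda>f x. c * T f x)"
proof -
  obtain C where C: "C \<ge> 0" "\<And>p f. p \<ge> 1 \<Longrightarrow> f \<in> test_functions \<Longrightarrow> Lp_norm p (T f) \<le> C * control_norm p f"
    using controlled_bound[OF assms] by blast
  show ?thesis
  proof (rule controlledI[where C="norm c * C"])
    fix p :: ennreal and f :: "real^'n::{finite,linorder} \<Rightarrow> complex"
    assume pf: "p \<ge> 1" "f \<in> test_functions"
    have "Lp_norm p (\<lambda>x. c * T f x) \<le> norm c * Lp_norm p (T f)"
      using pf by (intro Lp_norm_cmult_le test_Lp_class controlled_test[OF assms])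
    also have "\<dots> \<le> norm c * (C * control_norm p f)"
      using C(2)[OF pf] by (intro mult_left_mono) auto
    finally show "Lp_norm p (\<lambda>x. c * T f x) \<le> norm c * C * control_norm p f"
      by (simp add: mult.assoc)
  qed (use C in \<open>auto intro: test_cmult controlled_test[OF assms]\<close>)
qed

lemma controlled_sum:
  assumes "\<And>i. i \<in> I \<Longrightarrow> controlled (T i)" shows "controlled (\<lambda>f x. \<Sum>i\<in>I. T i f x)"
proof -
  have zero: "controlled (\<lambda>f x. 0)"
    using controlled_cmult[OF controlled_id, of 0] by simp
  show ?thesis
    using assms
  proof (induction I rule: infinite_finite_induct)
    case (insert i I)
    then show ?case using controlled_add[of "T i" "\<lambda>f x. \<Sum>i\<in>I. T i f x"] by simp
  qed (use zero in simp_all)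
qed

text \<open>\<open>Lp_norm_le_D_op_plus_i\<close> applied to \<open>T f\<close>: a factor
  \<open>D_op u\<close> plus \<open>\<i>\<close> can be stripped off.\<close>

lemma controlled_D_op_plus_i:
  assumes "controlled (\<lambda>f x. D_op u (T f) x + \<i> * T f x)"
    and T: "\<And>f. f \<in> test_functions \<Longrightarrow> T f \<in> test_functions"
  shows "controlled T"
proof -
  obtain C where C: "C \<ge> 0" "\<And>p f. p \<ge> 1 \<Longrightarrow> f \<in> test_functions \<Longrightarrow>
      Lp_norm p (\<lambda>x. D_op u (T f) x + \<i> * T f x) \<le> C * control_norm p f"
    using controlled_bound[OF assms(1)] by blast
  show ?thesis
  proof (rule controlledI[where C="2 * C"])
    fix p :: ennreal and f :: "real^'n::{finite,linorder} \<Rightarrow> complex"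
    assume pf: "p \<ge> 1" "f \<in> test_functions"
    show "Lp_norm p (T f) \<le> 2 * C * control_norm p f"
      using Lp_norm_le_D_op_plus_i[OF pf(1) T[OF pf(2)], of u] C(2)[OF pf] by simp
  qed (use C T in auto)
qed

text \<open>\<open>elliptic_estimate\<close> as a closure rule. It is used with
  \<open>\<gamma>\<close> of order 1 and 2, and so reaches the orders \<open>l\<close> and
  \<open>l + 1\<close>.\<close>

lemma controlled_elliptic:
  assumes "\<And>j. j \<in> J \<Longrightarrow> controlled (\<lambda>f. apply_op (P j) (D_multi \<gamma> f))" and \<beta>: "mdeg \<beta> < l"
  shows "controlled (D_multi (\<beta> + \<gamma>))"
proof -
  obtain C where C: "C \<ge> 0" "\<And>p f. p \<ge> 1 \<Longrightarrow> f \<in> test_functions \<Longrightarrow>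
    Lp_norm p (D_multi (\<beta> + \<gamma>) f) \<le> C * (Lp_norm p f + (\<Sum>j\<in>J. Lp_norm p (apply_op (P j) (D_multi \<gamma> f))))"
    using elliptic_estimate[of \<gamma>] \<beta> by blast
  have "\<forall>j\<in>J. \<exists>D. \<forall>p\<ge>1. \<forall>f\<in>test_functions. Lp_norm p (apply_op (P j) (D_multi \<gamma> f)) \<le> D * control_norm p f"
    using assms(1) unfolding controlled_def by blast
  from bchoice[OF this] obtain D where
    D: "\<forall>j\<in>J. \<forall>p\<ge>1. \<forall>f\<in>test_functions. Lp_norm p (apply_op (P j) (D_multi \<gamma> f)) \<le> D j * control_norm p f" ..
  show ?thesis
  \<comment> \<open>Absolute values are taken because the \<open>D j\<close> were chosen without a
    sign.\<close>
  proof (rule controlledI[where C="C * (1 + (\<Sum>j\<in>J. \<bar>D j\<bar>))"])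
    fix p :: ennreal and f :: "real^'n::{finite,linorder} \<Rightarrow> complex"
    assume pf: "p \<ge> 1" "f \<in> test_functions"
    have f: "Lp_norm p f \<le> control_norm p f"
      by (auto simp: control_norm_def intro!: sum_nonneg)
    have "Lp_norm p (apply_op (P j) (D_multi \<gamma> f)) \<le> \<bar>D j\<bar> * control_norm p f" if "j \<in> J" for j
    proof -
      have "Lp_norm p (apply_op (P j) (D_multi \<gamma> f)) \<le> D j * control_norm p f"
        using D that pf by blast
      also have "\<dots> \<le> \<bar>D j\<bar> * control_norm p f"
        by (intro mult_right_mono control_norm_nonneg) simp
      finally show ?thesis .
    qed
    then have "Lp_norm p f + (\<Sum>j\<in>J. Lp_norm p (apply_op (P j) (D_multi \<gamma> f)))
        \<le> control_norm p f + (\<Sum>j\<in>J. \<bar>D j\<bar> * control_norm p f)"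
      by (intro add_mono f sum_mono)
    also have "\<dots> = (1 + (\<Sum>j\<in>J. \<bar>D j\<bar>)) * control_norm p f"
      by (simp add: sum_distrib_right distrib_right)
    finally have "C * (Lp_norm p f + (\<Sum>j\<in>J. Lp_norm p (apply_op (P j) (D_multi \<gamma> f))))
        \<le> C * ((1 + (\<Sum>j\<in>J. \<bar>D j\<bar>)) * control_norm p f)"
      by (intro mult_left_mono C)
    with C(2)[OF pf] show "Lp_norm p (D_multi (\<beta> + \<gamma>) f) \<le> C * (1 + (\<Sum>j\<in>J. \<bar>D j\<bar>)) * control_norm p f"
      by (simp add: mult.assoc)
  qed (use C in \<open>auto intro!: test_D_multi mult_nonneg_nonneg add_nonneg_nonneg sum_nonneg\<close>)
qed

context
  assumes two: "CARD('n) \<ge> 2"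
begin

section \<open>From the system to all derivatives of order at most \<open>l + 1\<close>\<close>

lemma ex_other: "\<exists>u::'n. u \<noteq> v"
proof (rule ccontr)
  assume "\<not> ?thesis"
  then have "(UNIV :: 'n set) = {v}" by auto
  then have "CARD('n) = card {v}" by (simp only:)
  with two show False by simp
qed

abbreviation T where "T u g \<equiv> \<lambda>x. D_op u g x + \<i> * g x"

lemma controlled_TT:
  assumes "u \<noteq> v" "j \<in> J" shows "controlled (\<lambda>f. T u (T v (apply_op (P j) f)))"
proof -
  \<comment> \<open>The system contains only ordered pairs; commutativity of the ring product gives
    both orders of the factors.\<close>
  obtain a b where "a > b" and ab': "{a, b} = {u, v}"
    using assms(1) by (metis insert_commute linorder_neqE)
  then have ab: "(j, a, b) \<in> sysJ"
    using assms(2) by (simp add: sysJ_def)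
  have op: "P j * R_op a b = (D_sym u + const_op \<i>) * ((D_sym v + const_op \<i>) * P j)"
    using ab' unfolding R_op_def by (auto simp: doubleton_eq_iff mult_ac)
  show ?thesis
  proof (rule controlled_cong[OF controlled_system[OF ab]])
    fix f :: "real^'n::{finite,linorder} \<Rightarrow> complex"
    assume f: "f \<in> test_functions"
    show "T u (T v (apply_op (P j) f)) = apply_op (P j * R_op a b) f"
      unfolding op apply_op_mult[OF f] apply_op_mult[OF test_apply_op[OF f]] apply_op_D_sym_plus_const ..
  qed
qed

text \<open>In dimension at least 2 the factor \<open>T v\<close> can be completed by
  \<open>T u\<close> with \<open>u \<noteq> v\<close>, which is then stripped off.\<close>

lemma controlled_T:
  assumes "j \<in> J" shows "controlled (\<lambda>f. T v (apply_op (P j) f))"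
proof -
  obtain u where "u \<noteq> v" using ex_other by blast
  from controlled_TT[OF this assms] show ?thesis
    by (rule controlled_D_op_plus_i) (intro test_add test_cmult test_D_op test_apply_op)
qed

lemma controlled_P: "j \<in> J \<Longrightarrow> controlled (apply_op (P j))"
  by (rule controlled_D_op_plus_i[OF controlled_T]) (auto intro: test_apply_op)

lemma controlled_D_P:
  assumes "j \<in> J" shows "controlled (\<lambda>f. D_op v (apply_op (P j) f))"
  by (rule controlled_cong[OF controlled_add[OF controlled_T[OF assms, of v] controlled_cmult[OF controlled_P[OF assms], of "- \<i>"]]])
     (simp add: fun_eq_iff)

text \<open>Expand the product of the two factors of \<open>R_op u v\<close>; the first order and
  zero order terms have been controlled before, and the constant 1 is minus the square of
  \<open>\<i>\<close>.\<close>

lemma controlled_DD_P: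
  assumes uv: "u \<noteq> v" and j: "j \<in> J" shows "controlled (\<lambda>f. D_op u (D_op v (apply_op (P j) f)))"
proof (rule controlled_cong)
  show "controlled (\<lambda>f x. T u (T v (apply_op (P j) f)) x
      + (- \<i> * D_op u (apply_op (P j) f) x + (- \<i> * D_op v (apply_op (P j) f) x + 1 * apply_op (P j) f x)))"
    by (intro controlled_add controlled_TT uv j controlled_cmult controlled_D_P controlled_P)
  fix f :: "real^'n::{finite,linorder} \<Rightarrow> complex"
  assume f: "f \<in> test_functions"
  let ?w = "apply_op (P j) f"
  have w: "?w \<in> test_functions" by (rule test_apply_op[OF f])
  have "D_op u (T v ?w) = (\<lambda>x. D_op u (D_op v ?w) x + \<i> * D_op u ?w x)"
    using w by (simp add: D_op_add test_D_op test_cmult D_op_cmult)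
  then show "D_op u (D_op v ?w) = (\<lambda>x. T u (T v ?w) x
      + (- \<i> * D_op u ?w x + (- \<i> * D_op v ?w x + 1 * ?w x)))"
    by (simp add: fun_eq_iff algebra_simps)
qed

lemma controlled_P_single:
  assumes "j \<in> J" shows "controlled (\<lambda>f. apply_op (P j) (D_multi (Poly_Mapping.single u 1) f))"
proof (rule controlled_cong[OF controlled_D_P[OF assms, of u]])
  fix f :: "real^'n::{finite,linorder} \<Rightarrow> complex"
  assume f: "f \<in> test_functions"
  show "apply_op (P j) (D_multi (Poly_Mapping.single u 1) f) = D_op u (apply_op (P j) f)"
    using apply_op_D_multi_commute[OF f, of "P j" "Poly_Mapping.single u 1"] by (simp only: D_multi_single)
qed

text \<open>Splitting off one derivative as \<open>\<gamma>\<close> leaves an order below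
  \<open>l\<close>, as the elliptic estimate demands.\<close>

lemma controlled_order_le:
  assumes "mdeg \<alpha> \<le> l" shows "controlled (D_multi \<alpha>)"
proof (cases "\<alpha> = 0")
  case True
  then show ?thesis using controlled_cong[OF controlled_id, of "D_multi \<alpha>"] by simp
next
  case False
  then obtain u where u: "Poly_Mapping.lookup \<alpha> u \<noteq> 0"
    by (metis lookup_zero poly_mapping_eqI)
  obtain \<beta> where \<beta>: "\<alpha> = \<beta> + Poly_Mapping.single u 1"
    using multi_index_split[OF u] by blast
  with assms have "mdeg \<beta> < l" by (simp add: mdeg_add)
  then show ?thesis
    unfolding \<beta> by - (rule controlled_elliptic[OF controlled_P_single])
qed

text \<open>Here \<open>\<gamma>\<close> has order 2. Distinct directions are required because the
  system yields \<open>D_op u (D_op v (apply_op (P j) f))\<close> only for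
  \<open>u \<noteq> v\<close>.\<close>

lemma controlled_mixed:
  assumes uv: "u \<noteq> v" and \<beta>: "mdeg \<beta> < l"
  shows "controlled (D_multi (\<beta> + (Poly_Mapping.single u 1 + Poly_Mapping.single v 1)))"
proof (rule controlled_elliptic[OF _ \<beta>])
  fix j assume j: "j \<in> J"
  show "controlled (\<lambda>f. apply_op (P j) (D_multi (Poly_Mapping.single u 1 + Poly_Mapping.single v 1) f))"
  proof (rule controlled_cong[OF controlled_DD_P[OF uv j]])
    fix f :: "real^'n::{finite,linorder} \<Rightarrow> complex"
    assume f: "f \<in> test_functions"
    show "apply_op (P j) (D_multi (Poly_Mapping.single u 1 + Poly_Mapping.single v 1) f) = D_op u (D_op v (apply_op (P j) f))"
      using D_multi_D_multi[OF test_apply_op[OF f], of "Poly_Mapping.single u 1" "Poly_Mapping.single v 1"]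
      by (simp only: apply_op_D_multi_commute[OF f] D_multi_single)
  qed
qed

text \<open>Ellipticity in the direction of the axis \<open>u\<close> means that some \<open>P j\<close> contains \<open>D\<^sub>u\<^sup>l\<close>; then
  \<open>P j D\<^sub>u f\<close> contains \<open>D\<^sub>u\<^sup>l\<^sup>+\<^sup>1 f\<close>, and all its other terms are already controlled.\<close>

lemma controlled_pure: "controlled (D_multi (Poly_Mapping.single u (l + 1)))"
proof -
  let ?e = "Poly_Mapping.single u 1" and ?s = "Poly_Mapping.single u l"
  have "axis u 1 \<noteq> (0 :: real^'n::{finite,linorder})" by (simp add: axis_eq_0_iff)
  then have "\<exists>j\<in>J. principal_symbol l (P j) (axis u 1) \<noteq> 0"
    using ell unfolding elliptic_def by blast
  then obtain j where j: "j \<in> J" and nz: "principal_symbol l (P j) (axis u 1) \<noteq> 0" by blast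
  define c where "c = Poly_Mapping.lookup (P j) ?s"
  have "c \<noteq> 0"
  proof
    assume c: "c = 0"
    \<comment> \<open>On the axis every monomial involving another coordinate vanishes, so the
      symbol there is determined by the coefficient \<open>c\<close>.\<close>
    have "Poly_Mapping.lookup (P j) \<alpha> * monom_fun \<alpha> (axis u 1) = 0" if "mdeg \<alpha> = l" for \<alpha>
    proof (cases "\<exists>k. k \<noteq> u \<and> Poly_Mapping.lookup \<alpha> k \<noteq> 0")
      case True
      then obtain k where "k \<noteq> u" "Poly_Mapping.lookup \<alpha> k \<noteq> 0" by blast
      then have "monom_fun \<alpha> (axis u 1) = 0"
        unfolding monom_fun_def by (intro prod_zero) (auto intro!: exI[of _ k] simp: axis_def)
      then show ?thesis by simp
    next
      case False
      then have "\<alpha> = Poly_Mapping.single u (Poly_Mapping.lookup \<alpha> u)"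
        by (intro poly_mapping_eqI) (auto simp: lookup_single when_def)
      with that have "\<alpha> = ?s" by (metis mdeg_single)
      with c show ?thesis by (simp add: c_def)
    qed
    then have "principal_symbol l (P j) (axis u 1) = 0"
      unfolding principal_symbol_monom by (intro sum.neutral) auto
    with nz show False by simp
  qed
  let ?R = "{\<alpha> :: 'n \<Rightarrow>\<^sub>0 nat. mdeg \<alpha> \<le> l} - {?s}"
  \<comment> \<open>Terms of order below \<open>l\<close> have order at most \<open>l\<close> after
    the extra derivative. Those of order \<open>l\<close> other than \<open>?s\<close> contain some
    direction \<open>v \<noteq> u\<close> and become mixed.\<close>
  have rest: "controlled (D_multi (\<alpha> + ?e))" if \<alpha>: "\<alpha> \<in> ?R" for \<alpha>
  proof (cases "mdeg \<alpha> < l")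
    case True
    then show ?thesis by (intro controlled_order_le) (simp add: mdeg_add)
  next
    case False
    with \<alpha> have m: "mdeg \<alpha> = l" by simp
    with \<alpha> have "\<exists>v. v \<noteq> u \<and> Poly_Mapping.lookup \<alpha> v \<noteq> 0"
    proof -
      have "\<alpha> = ?s" if "\<forall>v. v \<noteq> u \<longrightarrow> Poly_Mapping.lookup \<alpha> v = 0"
      proof -
        have "\<alpha> = Poly_Mapping.single u (Poly_Mapping.lookup \<alpha> u)"
          using that by (intro poly_mapping_eqI) (auto simp: lookup_single when_def)
        with m show ?thesis by (metis mdeg_single)
      qed
      with \<alpha> show ?thesis by blast
    qed
    then obtain v where v: "v \<noteq> u" "Poly_Mapping.lookup \<alpha> v \<noteq> 0" by blast
    obtain \<beta> where \<beta>: "\<alpha> = \<beta> + Poly_Mapping.single v 1"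
      using multi_index_split[OF v(2)] by blast
    with m have "mdeg \<beta> < l" by (simp add: mdeg_add)
    with v(1) show ?thesis
      unfolding \<beta> add.assoc by (rule controlled_mixed)
  qed
  show ?thesis
  proof (rule controlled_cong)
    show "controlled (\<lambda>f x. inverse c * (apply_op (P j) (D_multi ?e f) x
        + (\<Sum>\<alpha>\<in>?R. - Poly_Mapping.lookup (P j) \<alpha> * D_multi (\<alpha> + ?e) f x)))"
      by (rule controlled_cmult, rule controlled_add, rule controlled_P_single[OF j],
          rule controlled_sum, rule controlled_cmult, rule rest)
    fix f :: "real^'n::{finite,linorder} \<Rightarrow> complex"
    assume f: "f \<in> test_functions"
    have "apply_op (P j) (D_multi ?e f) x = c * D_multi (Poly_Mapping.single u (l + 1)) f x
        + (\<Sum>\<alpha>\<in>?R. Poly_Mapping.lookup (P j) \<alpha> * D_multi (\<alpha> + ?e) f x)" for x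
    proof -
      have "apply_op (P j) (D_multi ?e f) x
          = (\<Sum>\<alpha> | mdeg \<alpha> \<le> l. Poly_Mapping.lookup (P j) \<alpha> * D_multi \<alpha> (D_multi ?e f) x)"
        using order j by (intro apply_op_superset finite_mdeg_le) (auto simp: system_of_order_def)
      also have "\<dots> = (\<Sum>\<alpha> | mdeg \<alpha> \<le> l. Poly_Mapping.lookup (P j) \<alpha> * D_multi (\<alpha> + ?e) f x)"
        by (simp only: D_multi_D_multi[OF f])
      also have "\<dots> = c * D_multi (?s + ?e) f x + (\<Sum>\<alpha>\<in>?R. Poly_Mapping.lookup (P j) \<alpha> * D_multi (\<alpha> + ?e) f x)"
        unfolding c_def by (intro sum.remove finite_mdeg_le) simp
      finally show ?thesis by (simp only: single_add[symmetric])
    qed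
    then show "D_multi (Poly_Mapping.single u (l + 1)) f = (\<lambda>x. inverse c * (apply_op (P j) (D_multi ?e f) x
        + (\<Sum>\<alpha>\<in>?R. - Poly_Mapping.lookup (P j) \<alpha> * D_multi (\<alpha> + ?e) f x)))"
      using \<open>c \<noteq> 0\<close> by (simp add: fun_eq_iff sum_negf field_simps)
  qed
qed

lemma controlled_D_multi:
  assumes "mdeg \<alpha> < l + 2" shows "controlled (D_multi \<alpha>)"
proof (cases "mdeg \<alpha> \<le> l")
  case True
  then show ?thesis by (rule controlled_order_le)
next
  case False
  with assms have m: "mdeg \<alpha> = l + 1" by simp
  then have "\<alpha> \<noteq> 0" by auto
  then show ?thesis
  proof (cases rule: multi_index_cases)
    case (pure u)
    then show ?thesis using controlled_pure[of u] m by simp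
  next
    case (mixed \<beta> u v)
    with m have "mdeg \<beta> < l" by (simp add: mdeg_add)
    with mixed show ?thesis using controlled_mixed by simp
  qed
qed

lemma weakly_coercive_system:
  assumes p: "p \<ge> 1"
  shows "weakly_coercive p (l + 2) sysJ (\<lambda>(j, u, v). P j * R_op u v)"
proof -
  have "\<forall>\<alpha>\<in>{\<alpha>. mdeg \<alpha> < l + 2}. \<exists>C. \<forall>f\<in>test_functions. Lp_norm p (D_multi \<alpha> f) \<le> C * control_norm p f"
    using controlled_D_multi p unfolding controlled_def by blast
  from bchoice[OF this] obtain C where
    C: "\<forall>\<alpha>\<in>{\<alpha>. mdeg \<alpha> < l + 2}. \<forall>f\<in>test_functions. Lp_norm p (D_multi \<alpha> f) \<le> C \<alpha> * control_norm p f" ..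
  \<comment> \<open>One number serves as both constants of weak coercivity.\<close>
  let ?C = "\<Sum>\<alpha> | mdeg \<alpha> < l + 2. C \<alpha>"
  have "(\<Sum>\<alpha> | mdeg \<alpha> < l + 2. Lp_norm p (D_multi \<alpha> f))
      \<le> ?C * (\<Sum>i\<in>sysJ. Lp_norm p (apply_op (case i of (j, u, v) \<Rightarrow> P j * R_op u v) f)) + ?C * Lp_norm p f"
    if f: "f \<in> test_functions" for f
  proof -
    have "(\<Sum>\<alpha> | mdeg \<alpha> < l + 2. Lp_norm p (D_multi \<alpha> f)) \<le> (\<Sum>\<alpha> | mdeg \<alpha> < l + 2. C \<alpha> * control_norm p f)"
      using C f by (intro sum_mono) blast
    also have "\<dots> = ?C * control_norm p f"
      by (simp add: sum_distrib_right)
    also have "control_norm p f = (\<Sum>i\<in>sysJ. Lp_norm p (apply_op (case i of (j, u, v) \<Rightarrow> P j * R_op u v) f)) + Lp_norm p f"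
      unfolding control_norm_def by (simp add: case_prod_beta')
    finally show ?thesis by (simp add: distrib_left)
  qed
  then show ?thesis unfolding weakly_coercive_def by blast
qed

end

section \<open>Order of the system and failure of ellipticity\<close>

lemma system_of_order_system: "system_of_order (l + 2) sysJ (\<lambda>(j, u, v). P j * R_op u v)"
  unfolding system_of_order_def
proof (intro conjI ballI)
  fix i \<alpha> assume "i \<in> sysJ" and \<alpha>: "\<alpha> \<in> Poly_Mapping.keys ((\<lambda>(j, u, v). P j * R_op u v) i)"
  then obtain j u v where i: "i = (j, u, v)" and "j \<in> J" by (auto simp: sysJ_def)
  then have "mdeg \<beta> \<le> l" if "\<beta> \<in> Poly_Mapping.keys (P j)" for \<beta>
    using order that by (auto simp: system_of_order_def)
  then show "mdeg \<alpha> \<le> l + 2"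
    using \<alpha> keys_R_op unfolding i prod.case
    by (intro mdeg_keys_mult[where S="P j" and T="R_op u v" and \<gamma>=\<alpha>]) auto
qed (rule finite_sysJ)

lemma not_elliptic_system: "\<not> elliptic (l + 2) sysJ (\<lambda>(j, u, v). P j * R_op u v)"
proof -
  obtain w :: 'n where True by simp
  \<comment> \<open>Any coordinate axis works: for \<open>u > v\<close> at least one of the two
    coordinates in the symbol of \<open>R_op u v\<close> vanishes on it.\<close>
  let ?\<xi> = "axis w 1 :: real^'n::{finite,linorder}"
  have "principal_symbol (l + 2) (P j * R_op u v) ?\<xi> = 0" if "(j, u, v) \<in> sysJ" for j u v
  proof -
    have "mdeg \<beta> \<le> l" if "\<beta> \<in> Poly_Mapping.keys (P j)" for \<beta>
      using order that \<open>(j, u, v) \<in> sysJ\<close> by (auto simp: system_of_order_def sysJ_def)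
    then have "principal_symbol (l + 2) (P j * R_op u v) ?\<xi> = principal_symbol l (P j) ?\<xi> * principal_symbol 2 (R_op u v) ?\<xi>"
      by (rule principal_symbol_mult[OF _ keys_R_op])
    moreover have "principal_symbol 2 (R_op u v) ?\<xi> = 0"
      using that by (auto simp: principal_symbol_R_op axis_def sysJ_def)
    ultimately show ?thesis by simp
  qed
  moreover have "?\<xi> \<noteq> 0" by (simp add: axis_eq_0_iff)
  ultimately show ?thesis unfolding elliptic_def by (auto intro!: exI[of _ ?\<xi>])
qed

end

theorem theorem6p2:
  fixes P :: "nat \<Rightarrow> 'n::{finite,linorder} diffop" and N l :: nat
  assumes "CARD('n) \<ge> 2"
    and "l \<ge> 1"
    and "system_of_order l {1..N} P"
    and "elliptic l {1..N} P"
  shows "let J = {(j, u, v). j \<in> {1..N} \<and> u > v};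
             S = (\<lambda>(j, u, v). P j * R_op u v)
         in system_of_order (l + 2) J S
            \<and> (\<forall>p::ennreal. p \<ge> 1 \<longrightarrow> weakly_coercive p (l + 2) J S)
            \<and> \<not> elliptic (l + 2) J S"
proof -
  interpret elliptic_system l "{1..N}" P
    using assms by unfold_locales auto
  show ?thesis
    unfolding Let_def sysJ_def[symmetric]
    using system_of_order_system weakly_coercive_system[OF assms(1)] not_elliptic_system by blast
qed

end
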